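(* Let $G$ be a signed graph and $k$ a field. The edge ring $k[G]$ satisfies Serre's condition $R_1$ if and only if every facet subgraph $H$ of $G$ satisfies $\mathrm{comp}(H)\le\mathrm{comp}(G)+1$.
   Context: A signed graph $G$ on vertex set $\{1,\dots,n\}$ is a finite undirected graph, possibly with loops but without multiple edges, together with a sign function $\mathrm{sgn}:E(G)\to\{+1,-1\}$; an edge $ij$ of sign $\pm1$ is written $\pm ij$. For an edge $e=\pm ij$ put $\rho(e)=\mathrm{sgn}(e)(e_i+e_j)\in\mathbb{R}^n$ (a loop $ii$ gives $2\,\mathrm{sgn}(ii)e_i$). The edge ring is $k[G]=k[x^a : a\in\rho(E(G))]\subseteq k[x_1^{\pm1},\dots,x_n^{\pm1}]$, where $x^a=x_1^{a_1}\cdots x_n^{a_n}$; i.e. the semigroup ring of the semigroup generated by $\rho(E(G))$. A Noetherian ring $R$ satisfies $R_1$ if $R_\mathfrak{p}$ is regular for every prime $\mathfrak{p}$ with $\dim R_\mathfrak{p}\le1$. Subgraphs are spanning: a subgraph $H$ of $G$ has vertex set $\{1,\dots,n\}$ and a subset of the edges of $G$ with the same signs; $G\setminus H$ denotes the set of edges of $G$ not in $H$. A component is a maximal connected subgraph (an isolated vertex is a component); $\mathrm{comp}(\cdot)$ is the number of components. A component is bipartite if its vertex set can be partitioned into sets $L,R$ (one possibly empty) with every edge of the component having exactly one endpoint in each (a component with a loop is not bipartite). $\mathrm{bicomp}(\cdot)$ is the number of bipartite components. A subgraph $H$ of $G$ is a facet subgraph if (1) $\mathrm{bicomp}(H)=\mathrm{bicomp}(G)+1$,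 and (2) for any bipartite component $H'$ of $H$ which is not a component of $G$, there is a bipartition $V(H')=L\cup R$ such that every edge $e\in G\setminus H$ is either a positive edge with at least one endpoint in $L$ and no endpoint in $R$, or a negative edge with at least one endpoint in $R$ and no endpoint in $L$. *)

theory Defs
  imports "HOL-Algebra.Ideal" "HOL-Algebra.Ring_Divisibility" "HOL-Library.Poly_Mapping"
    "HOL-Library.Extended_Nat"
begin

definition loc_rel :: "('a, 'b) ring_scheme \<Rightarrow> 'a set \<Rightarrow> (('a \<times> 'a) \<times> ('a \<times> 'a)) set" where
  "loc_rel R P = {((a, s), (b, t)). a \<in> carrier R \<and> b \<in> carrier R \<and>
      s \<in> carrier R - P \<and> t \<in> carrier R - P \<and>
      (\<exists>u \<in> carrier R - P. u \<otimes>\<^bsub>R\<^esub> a \<otimes>\<^bsub>R\<^esub> t = u \<otimes>\<^bsub>R\<^esub> b \<otimes>\<^bsub>R\<^esub> s)}"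

definition localization :: "('a, 'b) ring_scheme \<Rightarrow> 'a set \<Rightarrow> ('a \<times> 'a) set ring" where
  "localization R P =
    \<lparr>carrier = (carrier R \<times> (carrier R - P)) // loc_rel R P,
     mult = (\<lambda>X Y. \<Union>x\<in>X. \<Union>y\<in>Y.
               loc_rel R P `` {(fst x \<otimes>\<^bsub>R\<^esub> fst y, snd x \<otimes>\<^bsub>R\<^esub> snd y)}),
     one = loc_rel R P `` {(\<one>\<^bsub>R\<^esub>, \<one>\<^bsub>R\<^esub>)},
     zero = loc_rel R P `` {(\<zero>\<^bsub>R\<^esub>, \<one>\<^bsub>R\<^esub>)},
     add = (\<lambda>X Y. \<Union>x\<in>X. \<Union>y\<in>Y.
               loc_rel R P `` {(fst x \<otimes>\<^bsub>R\<^esub> snd y \<oplus>\<^bsub>R\<^esub> fst y \<otimes>\<^bsub>R\<^esub> snd x,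
                                snd x \<otimes>\<^bsub>R\<^esub> snd y)})\<rparr>"

definition krull_dim :: "('a, 'b) ring_scheme \<Rightarrow> enat" where
  "krull_dim R = Sup {enat n | n. \<exists>P. (\<forall>i\<le>n. primeideal (P i) R) \<and> (\<forall>i<n. P i \<subset> P (Suc i))}"

definition local_ring :: "('a, 'b) ring_scheme \<Rightarrow> bool" where
  "local_ring R \<longleftrightarrow> cring R \<and> (\<exists>!m. maximalideal m R)"

definition regular_local_ring :: "('a, 'b) ring_scheme \<Rightarrow> bool" where
  "regular_local_ring R \<longleftrightarrow> noetherian_ring R \<and> local_ring R \<and>
     (\<exists>m. maximalideal m R \<and>
        enat (LEAST d. \<exists>A. A \<subseteq> carrier R \<and> finite A \<and> card A = d \<and> genideal R A = m)
          = krull_dim R)"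

definition serre_R1 :: "('a, 'b) ring_scheme \<Rightarrow> bool" where
  "serre_R1 R \<longleftrightarrow> (\<forall>P. primeideal P R \<and> krull_dim (localization R P) \<le> 1
                        \<longrightarrow> regular_local_ring (localization R P))"

text \<open>A signed graph on vertex set {1..n}: edges are nonempty vertex sets of size at most 2
  (a singleton {i} is the loop ii); no multiple edges since E is a set of vertex sets;
  sg gives the sign of each edge.\<close>

definition signed_graph :: "nat \<Rightarrow> nat set set \<Rightarrow> (nat set \<Rightarrow> int) \<Rightarrow> bool" where
  "signed_graph n E sg \<longleftrightarrow>
     (\<forall>e\<in>E. e \<subseteq> {1..n} \<and> e \<noteq> {} \<and> card e \<le> 2 \<and> (sg e = 1 \<or> sg e = -1))"

text \<open>rho(e) = sgn(e)(e_i + e_j); for a loop ii this is 2 sgn(e) e_i.\<close>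

definition rho :: "(nat set \<Rightarrow> int) \<Rightarrow> nat set \<Rightarrow> (nat \<Rightarrow>\<^sub>0 int)" where
  "rho sg e = (\<Sum>v\<in>e. Poly_Mapping.single v (sg e * (if card e = 1 then 2 else 1)))"

inductive_set gen_monoid :: "'a::monoid_add set \<Rightarrow> 'a set" for A where
  zero: "0 \<in> gen_monoid A"
| add: "a \<in> A \<Longrightarrow> x \<in> gen_monoid A \<Longrightarrow> a + x \<in> gen_monoid A"

text \<open>Laurent polynomials over k are the group algebra (nat \<Rightarrow>0 int) \<Rightarrow>0 k (monomial x^a is
  Poly_Mapping.single a 1). The edge ring k[G] is the semigroup ring of the monoid generated
  by rho(E), i.e. the subring spanned by the monomials with exponents in that monoid.\<close>

definition edge_ring :: "nat set set \<Rightarrow> (nat set \<Rightarrow> int) \<Rightarrow> ((nat \<Rightarrow>\<^sub>0 int) \<Rightarrow>\<^sub>0 'k::field) ring" where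
  "edge_ring E sg =
    \<lparr>carrier = {f. Poly_Mapping.keys f \<subseteq> gen_monoid (rho sg ` E)},
     mult = (*), one = 1, zero = 0, add = (+)\<rparr>"

text \<open>Spanning subgraphs are given by their edge sets F (signs inherited from sg).\<close>

definition adj :: "nat set set \<Rightarrow> nat \<Rightarrow> nat \<Rightarrow> bool" where
  "adj F u v \<longleftrightarrow> {u, v} \<in> F"

definition vcomps :: "nat \<Rightarrow> nat set set \<Rightarrow> nat set set" where
  "vcomps n F = {1..n} // {(u, v). u \<in> {1..n} \<and> v \<in> {1..n} \<and> (adj F)\<^sup>*\<^sup>* u v}"

definition components :: "nat \<Rightarrow> nat set set \<Rightarrow> (nat set \<times> nat set set) set" where
  "components n F = {(C, {e \<in> F. e \<subseteq> C}) | C. C \<in> vcomps n F}"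

definition ncomp :: "nat \<Rightarrow> nat set set \<Rightarrow> nat" where
  "ncomp n F = card (components n F)"

definition bipartition :: "nat set \<times> nat set set \<Rightarrow> nat set \<Rightarrow> nat set \<Rightarrow> bool" where
  "bipartition X L R \<longleftrightarrow> L \<union> R = fst X \<and> L \<inter> R = {} \<and>
     (\<forall>e\<in>snd X. card (e \<inter> L) = 1 \<and> card (e \<inter> R) = 1)"

definition bipartite :: "nat set \<times> nat set set \<Rightarrow> bool" where
  "bipartite X \<longleftrightarrow> (\<exists>L R. bipartition X L R)"

definition bicomp :: "nat \<Rightarrow> nat set set \<Rightarrow> nat" where
  "bicomp n F = card {X \<in> components n F. bipartite X}"

definition facet_subgraph :: "nat \<Rightarrow> nat set set \<Rightarrow> (nat set \<Rightarrow> int) \<Rightarrow> nat set set \<Rightarrow> bool" where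
  "facet_subgraph n E sg F \<longleftrightarrow> F \<subseteq> E \<and>
     bicomp n F = bicomp n E + 1 \<and>
     (\<forall>X\<in>components n F. bipartite X \<and> X \<notin> components n E \<longrightarrow>
        (\<exists>L R. bipartition X L R \<and>
           (\<forall>e\<in>E - F. (sg e = 1 \<and> e \<inter> L \<noteq> {} \<and> e \<inter> R = {}) \<or>
                       (sg e = -1 \<and> e \<inter> R \<noteq> {} \<and> e \<inter> L = {}))))"

end

theory Submission
  imports Defs
begin

text \<open>
  Write \<open>k[Q]\<close> for the edge ring. A prime \<open>P\<close> of height one either contains no monomial or is
  spanned by the monomials outside a face of the cone. In the first case one localizes at all
  monomials; choosing the first coordinate in which \<open>P\<close> becomes nonzero, Euclidean division in
  that coordinate shows that the localization at \<open>P\<close> is a discrete valuation ring. In the second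
  case Farkas' lemma and the maximality of the face produce a supporting functional that is unique
  up to a scalar, and this uniqueness says precisely that the edges of the face form a facet
  subgraph \<open>H\<close>.

  For a facet subgraph \<open>H\<close> fix a bipartite component \<open>C\<close> of \<open>H\<close> that is not a component of \<open>G\<close>.
  Every edge outside \<open>H\<close> meets \<open>C\<close>, so passing from \<open>H\<close> to \<open>G\<close> merges \<open>C\<close> with the other
  components met by such edges, and \<open>comp(H) - comp(G)\<close> is the number of these. The lattice spanned
  by \<open>H\<close> is cut out by the signed sums over the bipartite components and the parities of the sums
  over the others. If at most one further component is merged, one edge outside \<open>H\<close> therefore
  generates the maximal ideal locally. If two are merged, edges from \<open>C\<close> to each of them both have
  degree one but differ by a vector that violates a parity, and the maximal ideal is not principal.
\<close>

subsection \<open>Localizations of domains\<close>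

text \<open>The obstacle is that \<open>k[G]\<close> need not be normal. The lattice spanned by a
  facet subgraph can be smaller than the kernel of its functional on the lattice of
  \<open>G\<close>. The quotient is always killed by 2, and it is trivial exactly when the bound on
  the number of components holds. Regularity is tested by divisibility in \<open>k[G]\<close>
  itself: either every nonzero \<open>f\<close> is a power of one \<open>p\<close> in
  \<open>P\<close> up to factors outside \<open>P\<close>, or no \<open>p\<close> in
  \<open>P\<close> divides all of \<open>P\<close> up to such factors. For a bad facet subgraph the
  prime of the face must also be shown to have height one, although monomials of the same degree
  need not be associated there. Since parities disappear on doubled exponents, a nonzero prime
  inside it is made to contain an element with even exponents, from this the square of a monomial,
  and thus the monomial.\<close>

lemma (in cring) idealI_cring:
  assumes "I \<subseteq> carrier R" "\<zero> \<in> I" "\<And>x y. x \<in> I \<Longrightarrow> y \<in> I \<Longrightarrow> x \<oplus> y \<in> I"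
    "\<And>a x. a \<in> carrier R \<Longrightarrow> x \<in> I \<Longrightarrow> a \<otimes> x \<in> I"
  shows "ideal I R"
proof (rule idealI)
  show "ring R" ..
  show "subgroup I (add_monoid R)"
  proof (rule subgroup.intro)
    fix x assume x: "x \<in> I"
    then have xc: "x \<in> carrier R" using assms(1) by blast
    have "(\<ominus> \<one>) \<otimes> x = \<ominus> x" using xc by (simp add: l_minus)
    then have "\<ominus> x \<in> I" using assms(4)[of "\<ominus> \<one>" x] x by simp
    then show "inv\<^bsub>add_monoid R\<^esub> x \<in> I" by (simp add: a_inv_def)
  qed (use assms in auto)
  fix a x assume "a \<in> I" "x \<in> carrier R"
  then show "x \<otimes> a \<in> I" "a \<otimes> x \<in> I" using assms m_comm by (metis subsetD)+
qed

text \<open>Rings are kept as subsets of a type with a ring structure, so that arithmetic is done by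
  type classes; the record form is the interface to \<open>localization\<close> and
  \<open>primeideal\<close>.\<close>

definition sring :: "'a::comm_ring_1 set \<Rightarrow> 'a ring" where
  "sring A = \<lparr>carrier = A, mult = (*), one = 1, zero = 0, add = (+)\<rparr>"

definition is_subring :: "'a::comm_ring_1 set \<Rightarrow> bool" where
  "is_subring A \<longleftrightarrow> 1 \<in> A \<and> (\<forall>x\<in>A. \<forall>y\<in>A. x - y \<in> A \<and> x * y \<in> A)"

definition prime_in :: "'a::comm_ring_1 set \<Rightarrow> 'a set \<Rightarrow> bool" where
  "prime_in A P \<longleftrightarrow> P \<subseteq> A \<and> 0 \<in> P \<and> (\<forall>x\<in>P. \<forall>y\<in>P. x + y \<in> P) \<and> (\<forall>a\<in>A. \<forall>x\<in>P. a * x \<in> P) \<and>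
     1 \<notin> P \<and> (\<forall>a\<in>A. \<forall>b\<in>A. a * b \<in> P \<longrightarrow> a \<in> P \<or> b \<in> P)"

lemma is_subringD:
  assumes "is_subring A"
  shows "1 \<in> A" "0 \<in> A" "x \<in> A \<Longrightarrow> y \<in> A \<Longrightarrow> x - y \<in> A" "x \<in> A \<Longrightarrow> y \<in> A \<Longrightarrow> x * y \<in> A"
    "x \<in> A \<Longrightarrow> - x \<in> A" "x \<in> A \<Longrightarrow> y \<in> A \<Longrightarrow> x + y \<in> A" "x \<in> A \<Longrightarrow> x ^ m \<in> A"
proof -
  note d = assms[unfolded is_subring_def]
  show 1: "1 \<in> A" and diff: "\<And>x y. x \<in> A \<Longrightarrow> y \<in> A \<Longrightarrow> x - y \<in> A"
    and mult: "\<And>x y. x \<in> A \<Longrightarrow> y \<in> A \<Longrightarrow> x * y \<in> A"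
    using d by auto
  show 0: "0 \<in> A" using diff[OF 1 1] by simp
  show neg: "x \<in> A \<Longrightarrow> - x \<in> A" for x using diff[OF 0, of x] by simp
  show "x \<in> A \<Longrightarrow> y \<in> A \<Longrightarrow> x + y \<in> A" using diff[OF _ neg, of x y] by simp
  show "x \<in> A \<Longrightarrow> x ^ m \<in> A" by (induction m) (auto simp: 1 mult)
qed

lemma prime_inD:
  assumes "prime_in A P"
  shows "P \<subseteq> A" "0 \<in> P" "x \<in> P \<Longrightarrow> y \<in> P \<Longrightarrow> x + y \<in> P" "a \<in> A \<Longrightarrow> x \<in> P \<Longrightarrow> a * x \<in> P"
    "a \<in> A \<Longrightarrow> x \<in> P \<Longrightarrow> x * a \<in> P"
    "1 \<notin> P" "a \<in> A \<Longrightarrow> b \<in> A \<Longrightarrow> a * b \<in> P \<Longrightarrow> a \<in> P \<or> b \<in> P"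
  using assms unfolding prime_in_def by (auto simp: mult.commute)

lemma prime_in_minus:
  assumes "is_subring A" "prime_in A P" "x \<in> P" shows "- x \<in> P"
  using prime_inD(4)[OF assms(2), of "- 1" x] is_subringD(1,5)[OF assms(1)] assms(3) by simp

lemma prime_in_diff:
  assumes "is_subring A" "prime_in A P" "x \<in> P" "y \<in> P" shows "x - y \<in> P"
  using prime_inD(3)[OF assms(2,3) prime_in_minus[OF assms(1,2,4)]] by simp

lemma prime_in_power:
  assumes "is_subring A" "prime_in A P" "x \<in> A" "x ^ m \<in> P" shows "x \<in> P"
  using assms(4)
proof (induction m)
  case 0
  then show ?case using prime_inD(6)[OF assms(2)] by simp
next
  case (Suc m)
  then show ?case using prime_inD(7)[OF assms(2,3) is_subringD(7)[OF assms(1,3)], of m] by auto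
qed

lemma prime_in_sum:
  assumes "prime_in A P" "\<And>i. i \<in> I \<Longrightarrow> f i \<in> P" shows "sum f I \<in> P"
  using assms(2) by (induction I rule: infinite_finite_induct) (auto simp: prime_inD[OF assms(1)])

lemma cring_sring: assumes "is_subring A" shows "cring (sring A)"
proof -
  note d = is_subringD[OF assms]
  show ?thesis
    by (rule cringI, rule abelian_groupI, goal_cases)
      (auto simp: sring_def d algebra_simps intro: comm_monoidI
        intro!: bexI[of _ "- x" A for x])
qed

lemma primeideal_sring_iff:
  assumes "is_subring A" shows "primeideal P (sring A) \<longleftrightarrow> prime_in A P"
proof
  assume "primeideal P (sring A)"
  then interpret primeideal P "sring A" .
  have c: "carrier (sring A) = A" "\<And>x y. x \<otimes>\<^bsub>sring A\<^esub> y = x * y" "\<And>x y. x \<oplus>\<^bsub>sring A\<^esub> y = x + y"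
     "\<one>\<^bsub>sring A\<^esub> = 1" "\<zero>\<^bsub>sring A\<^esub> = 0"
    by (auto simp: sring_def)
  have as: "additive_subgroup P (sring A)" ..
  have "1 \<notin> P" using I_notcarr one_imp_carrier by (auto simp: c)
  then show "prime_in A P"
    unfolding prime_in_def
    using a_subset additive_subgroup.zero_closed[OF as] additive_subgroup.a_closed[OF as]
      I_l_closed I_prime unfolding c by simp
next
  assume p: "prime_in A P"
  interpret cring "sring A" by (rule cring_sring[OF assms])
  show "primeideal P (sring A)"
  proof (rule primeidealI)
    show "ideal P (sring A)"
      by (rule idealI_cring) (use prime_inD[OF p] in \<open>auto simp: sring_def\<close>)
    show "cring (sring A)" ..
    show "carrier (sring A) \<noteq> P" using prime_inD(6)[OF p] is_subringD(1)[OF assms]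
      by (auto simp: sring_def)
    show "\<And>a b. a \<in> carrier (sring A) \<Longrightarrow> b \<in> carrier (sring A) \<Longrightarrow> a \<otimes>\<^bsub>sring A\<^esub> b \<in> P \<Longrightarrow> a \<in> P \<or> b \<in> P"
      using prime_inD(7)[OF p] by (auto simp: sring_def)
  qed
qed

lemma prime_in_zero:
  fixes A :: "'a::idom set" assumes "is_subring A" shows "prime_in A {0}"
  using is_subringD[OF assms] by (auto simp: prime_in_def)

locale domain_loc =
  fixes A P :: "'a::idom set"
  assumes sub: "is_subring A" and pr: "prime_in A P"
begin

abbreviation "Rp \<equiv> localization (sring A) P"

definition fraction :: "'a \<Rightarrow> 'a \<Rightarrow> ('a \<times> 'a) set" where
  "fraction a s = loc_rel (sring A) P `` {(a, s)}"

lemmas subD = is_subringD[OF sub]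
lemmas prD = prime_inD[OF pr]

lemma denom_mult: "s \<in> A - P \<Longrightarrow> t \<in> A - P \<Longrightarrow> s * t \<in> A - P"
  using subD(4) prD(7) by blast

lemma denom_one: "1 \<in> A - P" using subD prD by auto

lemma denom_nz: "s \<in> A - P \<Longrightarrow> s \<noteq> 0" using prD by auto

text \<open>In a domain the factor \<open>u\<close> of \<open>loc_rel\<close> is nonzero and
  cancels, which leaves ordinary cross-multiplication.\<close>

lemma loc_rel_iff:
  "((a, s), (b, t)) \<in> loc_rel (sring A) P \<longleftrightarrow>
     a \<in> A \<and> b \<in> A \<and> s \<in> A - P \<and> t \<in> A - P \<and> a * t = b * s"
proof -
  have "(\<exists>u\<in>A - P. u * a * t = u * b * s) \<longleftrightarrow> a * t = b * s"
    using denom_one denom_nz by (auto simp: mult.assoc)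
  then show ?thesis by (auto simp: loc_rel_def sring_def)
qed

lemma equiv_loc_rel: "equiv (A \<times> (A - P)) (loc_rel (sring A) P)"
proof (rule equivI)
  show "loc_rel (sring A) P \<subseteq> (A \<times> (A - P)) \<times> A \<times> (A - P)"
    by (auto simp: loc_rel_def sring_def)
  show "refl_on (A \<times> (A - P)) (loc_rel (sring A) P)"
    by (auto simp: refl_on_def loc_rel_iff)
  show "sym (loc_rel (sring A) P)" by (auto simp: sym_def loc_rel_iff)
  show "trans (loc_rel (sring A) P)"
  proof (rule transI, clarify)
    fix a s b t c u
    assume "((a, s), b, t) \<in> loc_rel (sring A) P" "((b, t), c, u) \<in> loc_rel (sring A) P"
    then have h: "a \<in> A" "c \<in> A" "s \<in> A - P" "u \<in> A - P" "t \<in> A - P"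
      and e: "a * t = b * s" "b * u = c * t"
      by (auto simp: loc_rel_iff)
    have "t * (a * u) = (a * t) * u" by (simp add: ac_simps)
    also have "\<dots> = (b * u) * s" by (simp add: e(1) ac_simps)
    also have "\<dots> = t * (c * s)" by (simp add: e(2) ac_simps)
    finally have "t * (a * u) = t * (c * s)" .
    then have "a * u = c * s" using denom_nz[OF h(5)] by simp
    then show "((a, s), c, u) \<in> loc_rel (sring A) P" using h by (auto simp: loc_rel_iff)
  qed
qed

lemma fraction_eq:
  assumes "a \<in> A" "b \<in> A" "s \<in> A - P" "t \<in> A - P"
  shows "fraction a s = fraction b t \<longleftrightarrow> a * t = b * s"
  unfolding fraction_def using eq_equiv_class_iff[OF equiv_loc_rel, of "(a, s)" "(b, t)"] assms
  by (auto simp: loc_rel_iff)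

lemma mem_fraction: "x \<in> fraction a s \<longleftrightarrow>
    a \<in> A \<and> fst x \<in> A \<and> s \<in> A - P \<and> snd x \<in> A - P \<and> a * snd x = fst x * s"
  by (cases x) (auto simp: fraction_def loc_rel_iff)

lemma self_mem_fraction: "a \<in> A \<Longrightarrow> s \<in> A - P \<Longrightarrow> (a, s) \<in> fraction a s"
  by (simp add: mem_fraction)

lemma carrier_Rp: "carrier Rp = {fraction a s | a s. a \<in> A \<and> s \<in> A - P}"
  by (auto simp: localization_def quotient_def fraction_def sring_def)

lemma fraction_carrier: "a \<in> A \<Longrightarrow> s \<in> A - P \<Longrightarrow> fraction a s \<in> carrier Rp"
  by (auto simp: carrier_Rp)

lemma one_Rp: "\<one>\<^bsub>Rp\<^esub> = fraction 1 1" and zero_Rp: "\<zero>\<^bsub>Rp\<^esub> = fraction 0 1"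
  by (auto simp: localization_def fraction_def sring_def)

text \<open>The operations of \<open>localization\<close> are unions over all pairs of
  representatives; independence of the representatives collapses the union to one class.\<close>

lemma UN2_const:
  assumes "X \<noteq> {}" "Y \<noteq> {}" "\<And>x y. x \<in> X \<Longrightarrow> y \<in> Y \<Longrightarrow> g x y = c"
  shows "(\<Union>x\<in>X. \<Union>y\<in>Y. g x y) = c"
  using assms by auto

lemma mult_fraction:
  assumes "a \<in> A" "b \<in> A" "s \<in> A - P" "t \<in> A - P"
  shows "fraction a s \<otimes>\<^bsub>Rp\<^esub> fraction b t = fraction (a * b) (s * t)"
proof -
  have "fraction a s \<otimes>\<^bsub>Rp\<^esub> fraction b t
      = (\<Union>x\<in>fraction a s. \<Union>y\<in>fraction b t. fraction (fst x * fst y) (snd x * snd y))"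
    by (simp add: localization_def fraction_def sring_def)
  also have "\<dots> = fraction (a * b) (s * t)"
  proof (rule UN2_const)
    fix x y assume xy: "x \<in> fraction a s" "y \<in> fraction b t"
    then have x: "fst x \<in> A" "snd x \<in> A - P" "a * snd x = fst x * s"
      and y: "fst y \<in> A" "snd y \<in> A - P" "b * snd y = fst y * t"
      by (simp_all add: mem_fraction)
    have "fst x * fst y * (s * t) = (fst x * s) * (fst y * t)" by (simp add: ac_simps)
    also have "\<dots> = a * b * (snd x * snd y)"
      by (simp only: x(3)[symmetric] y(3)[symmetric]) (simp add: ac_simps)
    finally have "fst x * fst y * (s * t) = a * b * (snd x * snd y)" .
    then show "fraction (fst x * fst y) (snd x * snd y) = fraction (a * b) (s * t)"
      using x y assms denom_mult subD by (subst fraction_eq) auto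
  qed (use assms self_mem_fraction in blast)+
  finally show ?thesis .
qed

lemma add_fraction:
  assumes "a \<in> A" "b \<in> A" "s \<in> A - P" "t \<in> A - P"
  shows "fraction a s \<oplus>\<^bsub>Rp\<^esub> fraction b t = fraction (a * t + b * s) (s * t)"
proof -
  have "fraction a s \<oplus>\<^bsub>Rp\<^esub> fraction b t
      = (\<Union>x\<in>fraction a s. \<Union>y\<in>fraction b t. fraction (fst x * snd y + fst y * snd x) (snd x * snd y))"
    by (simp add: localization_def fraction_def sring_def)
  also have "\<dots> = fraction (a * t + b * s) (s * t)"
  proof (rule UN2_const)
    fix x y assume xy: "x \<in> fraction a s" "y \<in> fraction b t"
    then have x: "fst x \<in> A" "snd x \<in> A - P" "a * snd x = fst x * s"
      and y: "fst y \<in> A" "snd y \<in> A - P" "b * snd y = fst y * t"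
      by (simp_all add: mem_fraction)
    have "(fst x * snd y + fst y * snd x) * (s * t)
        = (fst x * s) * (snd y * t) + (fst y * t) * (snd x * s)"
      by (simp add: algebra_simps)
    also have "\<dots> = (a * t + b * s) * (snd x * snd y)"
      by (simp only: x(3)[symmetric] y(3)[symmetric]) (simp add: algebra_simps)
    finally have "(fst x * snd y + fst y * snd x) * (s * t) = (a * t + b * s) * (snd x * snd y)" .
    then show "fraction (fst x * snd y + fst y * snd x) (snd x * snd y) = fraction (a * t + b * s) (s * t)"
      using x y assms denom_mult subD by (subst fraction_eq) auto
  qed (use assms self_mem_fraction in blast)+
  finally show ?thesis .
qed

lemma fraction_cases:
  assumes "x \<in> carrier Rp" obtains a s where "a \<in> A" "s \<in> A - P" "x = fraction a s"
  using assms by (auto simp: carrier_Rp)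

lemma cring_Rp: "cring Rp"
proof (rule cringI)
  have dm: "\<And>s t. s \<in> A \<Longrightarrow> s \<notin> P \<Longrightarrow> t \<in> A \<Longrightarrow> t \<notin> P \<Longrightarrow> s * t \<notin> P"
    using denom_mult by blast
  note s = mult_fraction add_fraction fraction_eq subD denom_mult denom_one fraction_carrier one_Rp zero_Rp dm
  show "abelian_group Rp"
  proof (rule abelian_groupI)
    fix x y z assume "x \<in> carrier Rp" "y \<in> carrier Rp" "z \<in> carrier Rp"
    then obtain a p b q c r where h: "a \<in> A" "p \<in> A - P" "x = fraction a p"
      "b \<in> A" "q \<in> A - P" "y = fraction b q" "c \<in> A" "r \<in> A - P" "z = fraction c r" unfolding carrier_Rp by blast
    show "x \<oplus>\<^bsub>Rp\<^esub> y \<in> carrier Rp" using h by (simp add: s)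
    show "x \<oplus>\<^bsub>Rp\<^esub> y \<oplus>\<^bsub>Rp\<^esub> z = x \<oplus>\<^bsub>Rp\<^esub> (y \<oplus>\<^bsub>Rp\<^esub> z)" using h by (simp add: s algebra_simps)
    show "x \<oplus>\<^bsub>Rp\<^esub> y = y \<oplus>\<^bsub>Rp\<^esub> x" using h by (simp add: s algebra_simps)
  next
    show "\<zero>\<^bsub>Rp\<^esub> \<in> carrier Rp" using fraction_carrier[OF subD(2) denom_one] by (simp add: zero_Rp)
    fix x assume "x \<in> carrier Rp"
    then obtain a p where h: "a \<in> A" "p \<in> A - P" "x = fraction a p" unfolding carrier_Rp by blast
    show "\<zero>\<^bsub>Rp\<^esub> \<oplus>\<^bsub>Rp\<^esub> x = x"
      using add_fraction[OF subD(2) h(1) denom_one h(2)] h(1,3) by (simp add: zero_Rp)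
    have "fraction (- a) p \<oplus>\<^bsub>Rp\<^esub> x = fraction 0 (p * p)"
      using add_fraction[OF subD(5)[OF h(1)] h(1,2,2)] h(3) by simp
    also have "\<dots> = \<zero>\<^bsub>Rp\<^esub>"
      using fraction_eq[OF subD(2,2) denom_mult[OF h(2,2)] denom_one] by (simp add: zero_Rp)
    finally have "fraction (- a) p \<oplus>\<^bsub>Rp\<^esub> x = \<zero>\<^bsub>Rp\<^esub>" .
    moreover have "fraction (- a) p \<in> carrier Rp" using h by (simp add: s)
    ultimately show "\<exists>y\<in>carrier Rp. y \<oplus>\<^bsub>Rp\<^esub> x = \<zero>\<^bsub>Rp\<^esub>" by blast
  qed
  show "comm_monoid Rp"
  proof (rule comm_monoidI)
    fix x y z assume "x \<in> carrier Rp" "y \<in> carrier Rp" "z \<in> carrier Rp"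
    then obtain a p b q c r where h: "a \<in> A" "p \<in> A - P" "x = fraction a p"
      "b \<in> A" "q \<in> A - P" "y = fraction b q" "c \<in> A" "r \<in> A - P" "z = fraction c r" unfolding carrier_Rp by blast
    show "x \<otimes>\<^bsub>Rp\<^esub> y \<in> carrier Rp" using h by (simp add: s)
    show "x \<otimes>\<^bsub>Rp\<^esub> y \<otimes>\<^bsub>Rp\<^esub> z = x \<otimes>\<^bsub>Rp\<^esub> (y \<otimes>\<^bsub>Rp\<^esub> z)" using h by (simp add: s algebra_simps)
    show "x \<otimes>\<^bsub>Rp\<^esub> y = y \<otimes>\<^bsub>Rp\<^esub> x" using h by (simp add: s algebra_simps)
    show "\<one>\<^bsub>Rp\<^esub> \<otimes>\<^bsub>Rp\<^esub> x = x"
      using mult_fraction[OF subD(1) h(1) denom_one h(2)] h(3) by (simp add: one_Rp)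
  next
    show "\<one>\<^bsub>Rp\<^esub> \<in> carrier Rp" using fraction_carrier[OF subD(1) denom_one] by (simp add: one_Rp)
  qed
  fix x y z assume "x \<in> carrier Rp" "y \<in> carrier Rp" "z \<in> carrier Rp"
  then obtain a p b q c r where h: "a \<in> A" "p \<in> A - P" "x = fraction a p"
    "b \<in> A" "q \<in> A - P" "y = fraction b q" "c \<in> A" "r \<in> A - P" "z = fraction c r" unfolding carrier_Rp by blast
  show "(x \<oplus>\<^bsub>Rp\<^esub> y) \<otimes>\<^bsub>Rp\<^esub> z = x \<otimes>\<^bsub>Rp\<^esub> z \<oplus>\<^bsub>Rp\<^esub> y \<otimes>\<^bsub>Rp\<^esub> z"
    using h by (simp add: s algebra_simps)
qed

section \<open>Contraction and extension of ideals\<close>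

sublocale Rp: cring Rp by (rule cring_Rp)

text \<open>The contraction of \<open>J\<close> to \<open>A\<close>. Together with the extension
  \<open>ext\<close> it matches the primes of the localization with the primes of \<open>A\<close>
  inside \<open>P\<close>.\<close>

definition nums :: "('a \<times> 'a) set set \<Rightarrow> 'a set" where
  "nums J = {a \<in> A. fraction a 1 \<in> J}"

definition ext :: "'a set \<Rightarrow> ('a \<times> 'a) set set" where
  "ext I = {fraction a s | a s. a \<in> I \<and> s \<in> A - P}"

lemma mem_ideal_iff_nums:
  assumes "ideal J Rp" "a \<in> A" "s \<in> A - P"
  shows "fraction a s \<in> J \<longleftrightarrow> a \<in> nums J"
proof -
  interpret ideal J Rp by fact
  have "fraction s 1 \<otimes>\<^bsub>Rp\<^esub> fraction a s = fraction a 1" "fraction 1 s \<otimes>\<^bsub>Rp\<^esub> fraction a 1 = fraction a s"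
    using assms denom_one subD denom_mult by (auto simp: mult_fraction fraction_eq)
  then show ?thesis
    using I_l_closed[of "fraction a s" "fraction s 1"] I_l_closed[of "fraction a 1" "fraction 1 s"] fraction_carrier denom_one assms
    by (auto simp: nums_def)
qed

text \<open>Denominators are units, so an ideal is recovered from its contraction.\<close>

lemma ideal_eqI:
  assumes "ideal J Rp" "ideal K Rp" "nums J = nums K" shows "J = K"
proof -
  have "J \<subseteq> carrier Rp" "K \<subseteq> carrier Rp"
    using assms(1,2) by (simp_all add: ideal_def additive_subgroup.a_subset)
  moreover have "x \<in> J \<longleftrightarrow> x \<in> K" if x: "x \<in> carrier Rp" for x
    using x mem_ideal_iff_nums[OF assms(1)] mem_ideal_iff_nums[OF assms(2)] assms(3)
    by (elim fraction_cases) simp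
  ultimately show ?thesis by blast
qed

lemma nums_ideal:
  assumes "ideal J Rp"
  shows "0 \<in> nums J" "a \<in> nums J \<Longrightarrow> b \<in> nums J \<Longrightarrow> a + b \<in> nums J"
    "c \<in> A \<Longrightarrow> a \<in> nums J \<Longrightarrow> c * a \<in> nums J"
proof -
  interpret ideal J Rp by fact
  have as: "additive_subgroup J Rp" ..
  have ac: "x \<oplus>\<^bsub>Rp\<^esub> y \<in> J" if "x \<in> J" "y \<in> J" for x y
    using additive_subgroup.a_closed[OF as] that by blast
  show "0 \<in> nums J" using additive_subgroup.zero_closed[OF as] subD(2) by (simp add: nums_def zero_Rp)
  show "a + b \<in> nums J" if "a \<in> nums J" "b \<in> nums J"
  proof -
    have "fraction a 1 \<oplus>\<^bsub>Rp\<^esub> fraction b 1 \<in> J" using ac that by (simp add: nums_def)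
    then show ?thesis using add_fraction[of a b 1 1] that subD(6) denom_one by (simp add: nums_def)
  qed
  show "c \<in> A \<Longrightarrow> a \<in> nums J \<Longrightarrow> c * a \<in> nums J"
    using I_l_closed[of "fraction a 1" "fraction c 1"] mult_fraction[of c a 1 1] subD(4) denom_one fraction_carrier[of c 1]
    by (simp add: nums_def)
qed

lemma nums_unit:
  assumes "ideal J Rp" "a \<in> nums J" "a \<notin> P" shows "J = carrier Rp"
proof -
  interpret ideal J Rp by fact
  have a: "a \<in> A - P" using assms by (auto simp: nums_def)
  have "fraction 1 1 = fraction a a" using a subD denom_one by (simp add: fraction_eq)
  also have "\<dots> \<in> J" using mem_ideal_iff_nums[OF assms(1), of a a] a assms by simp
  finally have "\<one>\<^bsub>Rp\<^esub> \<in> J" by (simp add: one_Rp)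
  then show ?thesis by (rule one_imp_carrier)
qed

lemma nums_prime:
  assumes "primeideal J Rp" shows "prime_in A (nums J)" "nums J \<subseteq> P"
proof -
  interpret primeideal J Rp by fact
  have id: "ideal J Rp" ..
  show sub: "nums J \<subseteq> P" using nums_unit[OF id] I_notcarr by auto
  have "a \<in> nums J \<or> b \<in> nums J" if "a \<in> A" "b \<in> A" "a * b \<in> nums J" for a b
    using I_prime[of "fraction a 1" "fraction b 1"] that denom_one fraction_carrier mult_fraction[of a b 1 1]
    by (auto simp: nums_def)
  then show "prime_in A (nums J)"
    unfolding prime_in_def using nums_ideal[OF id] sub prD(6) by (auto simp: nums_def)
qed

lemma mem_ext_iff:
  assumes "prime_in A I" "I \<subseteq> P" "a \<in> A" "s \<in> A - P" shows "fraction a s \<in> ext I \<longleftrightarrow> a \<in> I"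
proof
  note i = prime_inD[OF assms(1)]
  assume "fraction a s \<in> ext I"
  then obtain b t where h: "b \<in> I" "t \<in> A - P" "fraction a s = fraction b t" by (auto simp: ext_def)
  then have "a * t = b * s" using assms i(1) by (subst (asm) fraction_eq) auto
  then have "t * a \<in> I" using i(4)[of s b] h assms by (simp add: mult.commute)
  then show "a \<in> I" using i(7)[of t a] h assms by auto
qed (use assms in \<open>auto simp: ext_def\<close>)

lemma ext_prime:
  assumes I: "prime_in A I" "I \<subseteq> P" shows "primeideal (ext I) Rp" "nums (ext I) = I"
proof -
  note i = prime_inD[OF I(1)]
  have sub: "ext I \<subseteq> carrier Rp" using i(1) by (auto simp: ext_def carrier_Rp)
  show "nums (ext I) = I" using mem_ext_iff[OF I _ denom_one] i(1) by (auto simp: nums_def)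
  show "primeideal (ext I) Rp"
  proof (rule primeidealI)
    show "cring Rp" by (rule cring_Rp)
    show "ideal (ext I) Rp"
    proof (rule Rp.idealI_cring)
      show "ext I \<subseteq> carrier Rp" by fact
      show "\<zero>\<^bsub>Rp\<^esub> \<in> ext I" using i denom_one by (auto simp: ext_def zero_Rp)
      fix x y assume "x \<in> ext I" "y \<in> ext I"
      then obtain a s b t where h: "a \<in> I" "s \<in> A - P" "x = fraction a s" "b \<in> I" "t \<in> A - P" "y = fraction b t"
        by (auto simp: ext_def)
      then have "x \<oplus>\<^bsub>Rp\<^esub> y = fraction (a * t + b * s) (s * t)" using i(1) add_fraction[of a b s t] by blast
      moreover have "a * t + b * s \<in> I" using h i by auto
      ultimately show "x \<oplus>\<^bsub>Rp\<^esub> y \<in> ext I" using denom_mult[OF h(2,5)] unfolding ext_def by blast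
    next
      fix x y assume "x \<in> carrier Rp" "y \<in> ext I"
      then obtain a s b t where h: "a \<in> A" "s \<in> A - P" "x = fraction a s" "b \<in> I" "t \<in> A - P" "y = fraction b t"
        by (auto simp: ext_def carrier_Rp)
      then have "x \<otimes>\<^bsub>Rp\<^esub> y = fraction (a * b) (s * t)" using i(1) mult_fraction[of a b s t] by blast
      moreover have "a * b \<in> I" using h i by auto
      ultimately show "x \<otimes>\<^bsub>Rp\<^esub> y \<in> ext I" using denom_mult[OF h(2,5)] unfolding ext_def by blast
    qed
    have "fraction 1 1 \<notin> ext I" using mem_ext_iff[OF I subD(1) denom_one] i(6) by simp
    then show "carrier Rp \<noteq> ext I" using fraction_carrier[OF subD(1) denom_one] by auto
    fix x y assume "x \<in> carrier Rp" "y \<in> carrier Rp" and xy: "x \<otimes>\<^bsub>Rp\<^esub> y \<in> ext I"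
    then obtain a s b t where h: "a \<in> A" "s \<in> A - P" "x = fraction a s" "b \<in> A" "t \<in> A - P" "y = fraction b t"
      by (auto simp: carrier_Rp)
    then have "fraction (a * b) (s * t) \<in> ext I" using xy mult_fraction by simp
    then have "a * b \<in> I" using mem_ext_iff[OF I] h subD denom_mult by auto
    then show "x \<in> ext I \<or> y \<in> ext I" using i(7)[of a b] h by (auto simp: ext_def)
  qed
qed

lemma ideal_ext_P: "ideal (ext P) Rp"
  using ext_prime(1)[OF pr order_refl] by (simp add: primeideal_def)

text \<open>A numerator outside \<open>P\<close> is a unit, so every proper ideal lies in
  \<open>ext P\<close>.\<close>

lemma maximal_iff: "maximalideal J Rp \<longleftrightarrow> J = ext P"
proof -
  have le: "J \<subseteq> ext P" if "ideal J Rp" "J \<noteq> carrier Rp" for J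
  proof
    interpret ideal J Rp by fact
    fix x assume x: "x \<in> J"
    then have "x \<in> carrier Rp" using a_subset by blast
    then obtain a s where h: "a \<in> A" "s \<in> A - P" "x = fraction a s" by (rule fraction_cases)
    then have "a \<in> nums J" using x mem_ideal_iff_nums that(1) by simp
    then have "a \<in> P" using nums_unit that by blast
    then show "x \<in> ext P" using h by (auto simp: ext_def)
  qed
  have ne: "carrier Rp \<noteq> ext P" using ext_prime(1)[OF pr order_refl] by (auto simp: primeideal_def primeideal_axioms_def)
  have m: "maximalideal (ext P) Rp"
  proof (rule maximalidealI)
    fix J assume "ideal J Rp" "ext P \<subseteq> J" "J \<subseteq> carrier Rp"
    then show "J = ext P \<or> J = carrier Rp" using le by blast
  qed (use ideal_ext_P ne in auto)
  show ?thesis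
  proof
    assume "maximalideal J Rp"
    then interpret maximalideal J Rp .
    have "J \<subseteq> ext P" using le I_notcarr is_ideal by auto
    then show "J = ext P" using I_maximal[OF ideal_ext_P] ne additive_subgroup.a_subset[of "ext P" Rp] ideal_ext_P
      by (auto simp: ideal_def)
  qed (use m in simp)
qed

lemma local_Rp: "local_ring Rp"
  unfolding local_ring_def using cring_Rp maximal_iff by auto

section \<open>Krull dimension of the localization\<close>

lemma krull_dim_le_1:
  assumes "\<And>I. prime_in A I \<Longrightarrow> I \<subseteq> P \<Longrightarrow> I \<noteq> {0} \<Longrightarrow> I = P"
  shows "krull_dim Rp \<le> 1"
  unfolding krull_dim_def
proof (rule Sup_least, clarify)
  fix n Q assume p: "\<forall>i\<le>n. primeideal (Q i) Rp" and l: "\<forall>i<n. Q i \<subset> Q (Suc i)"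
  show "enat n \<le> 1"
  proof (rule ccontr)
    assume "\<not> enat n \<le> 1"
    then have n: "n \<ge> 2" by (simp add: one_enat_def)
    have pp: "primeideal (Q 0) Rp" "primeideal (Q 1) Rp" "primeideal (Q 2) Rp"
      using p n by auto
    have ll: "Q 0 \<subset> Q 1" "Q 1 \<subset> Q 2" using l[rule_format, of 0] l[rule_format, of 1] n
      by (auto simp: numeral_2_eq_2)
    have id: "ideal (Q 0) Rp" "ideal (Q 1) Rp" "ideal (Q 2) Rp" using pp by (auto simp: primeideal_def)
    \<comment> \<open>Contraction keeps the inclusions strict, so both upper terms of the chain
      contract to nonzero primes inside \<open>P\<close>, that is, to \<open>P\<close>
      itself.\<close>
    have "nums (Q 0) \<subseteq> nums (Q 1)" "nums (Q 1) \<subseteq> nums (Q 2)" using ll by (auto simp: nums_def)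
    moreover have "nums (Q 0) \<noteq> nums (Q 1)" "nums (Q 1) \<noteq> nums (Q 2)" using ll id ideal_eqI by blast+
    moreover have "0 \<in> nums (Q 0)" using nums_ideal id by blast
    ultimately have "nums (Q 1) \<noteq> {0}" "nums (Q 2) \<noteq> {0}" by auto
    then have "nums (Q 1) = P" "nums (Q 2) = P"
      using assms nums_prime pp by blast+
    then show False using \<open>nums (Q 1) \<noteq> nums (Q 2)\<close> by simp
  qed
qed

lemma no_prime_between:
  assumes d: "krull_dim Rp \<le> 1" and I: "prime_in A I" "I \<subseteq> P" "I \<noteq> {0}" shows "I = P"
proof (rule ccontr)
  assume "I \<noteq> P"
  \<comment> \<open>The zero ideal of a domain is prime, so \<open>{0}\<close>, \<open>I\<close>,
    \<open>P\<close> would extend to a chain with two steps.\<close>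
  define Q where "Q = (\<lambda>i::nat. ext (if i = 0 then {0} else if i = 1 then I else P))"
  note z = prime_in_zero[OF sub]
  have zP: "{0} \<subseteq> P" "{0} \<subseteq> I" using prD prime_inD(2)[OF I(1)] by auto
  have "\<forall>i\<le>2. primeideal (Q i) Rp"
    unfolding Q_def
    using ext_prime(1)[OF z zP(1)] ext_prime(1)[OF I(1,2)] ext_prime(1)[OF pr order_refl]
    by (auto split: if_split)
  moreover have "\<forall>i<2. Q i \<subset> Q (Suc i)"
  proof (intro allI impI)
    have "ext {0} \<noteq> ext I" "ext I \<noteq> ext P"
      using ext_prime(2)[OF z zP(1)] ext_prime(2)[OF I(1,2)] ext_prime(2)[OF pr order_refl] I(3) \<open>I \<noteq> P\<close>
      by metis+
    moreover have "ext {0} \<subseteq> ext I" "ext I \<subseteq> ext P" using zP I(2) unfolding ext_def by blast+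
    moreover fix i :: nat assume "i < 2"
    then have "i = 0 \<or> i = 1" by auto
    ultimately show "Q i \<subset> Q (Suc i)" by (auto simp: Q_def)
  qed
  ultimately have "enat 2 \<le> krull_dim Rp" unfolding krull_dim_def by (intro Sup_upper) blast
  then have "enat 2 \<le> 1" using d by (rule order_trans)
  then show False by (simp add: one_enat_def)
qed

lemma krull_dim_eq_1:
  assumes "\<And>I. prime_in A I \<Longrightarrow> I \<subseteq> P \<Longrightarrow> I \<noteq> {0} \<Longrightarrow> I = P" "P \<noteq> {0}"
  shows "krull_dim Rp = 1"
proof (rule antisym)
  define Q where "Q = (\<lambda>i::nat. ext (if i = 0 then {0} else P))"
  note z = prime_in_zero[OF sub]
  have zP: "{0} \<subseteq> P" using prD by auto
  have "\<forall>i\<le>1. primeideal (Q i) Rp"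
    unfolding Q_def using ext_prime(1)[OF z zP(1)] ext_prime(1)[OF pr order_refl] by (auto split: if_split)
  moreover have "\<forall>i<1. Q i \<subset> Q (Suc i)"
  proof -
    have "ext {0} \<noteq> ext P"
      using ext_prime(2)[OF z zP(1)] ext_prime(2)[OF pr order_refl] assms(2) by metis
    moreover have "ext {0} \<subseteq> ext P" using zP unfolding ext_def by blast
    ultimately show ?thesis by (auto simp: Q_def)
  qed
  ultimately show "1 \<le> krull_dim Rp" unfolding krull_dim_def one_enat_def by (intro Sup_upper) blast
qed (use krull_dim_le_1 assms in blast)

lemma krull_dim_eq_0:
  assumes "P = {0}" shows "krull_dim Rp = 0"
proof -
  have "n = 0" if p: "\<forall>i\<le>n. primeideal (Q i) Rp" and l: "\<forall>i<n. Q i \<subset> Q (Suc i)" for n Q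
  proof (rule ccontr)
    assume n: "n \<noteq> 0"
    have pp: "primeideal (Q 0) Rp" "primeideal (Q 1) Rp" using p n by auto
    then have id: "ideal (Q 0) Rp" "ideal (Q 1) Rp" by (auto simp: primeideal_def)
    have "nums (Q 0) = {0}" "nums (Q 1) = {0}"
      using nums_prime(2) nums_ideal(1) pp id assms by blast+
    then show False using ideal_eqI[OF id] l[rule_format, of 0] n by auto
  qed
  then have "{enat n |n. \<exists>Q. (\<forall>i\<le>n. primeideal (Q i) Rp) \<and> (\<forall>i<n. Q i \<subset> Q (Suc i))} \<subseteq> {0}"
    by (auto simp: zero_enat_def)
  then have "krull_dim Rp \<le> Sup {0}" unfolding krull_dim_def by (rule Sup_subset_mono)
  then show ?thesis by simp
qed

section \<open>Regularity and principal maximal ideals\<close>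

lemma genideal_empty: "Idl\<^bsub>Rp\<^esub> {} = {\<zero>\<^bsub>Rp\<^esub>}"
proof
  have "Idl\<^bsub>Rp\<^esub> {} \<subseteq> Idl\<^bsub>Rp\<^esub> {\<zero>\<^bsub>Rp\<^esub>}" by (rule Rp.subset_Idl_subset) auto
  then show "Idl\<^bsub>Rp\<^esub> {} \<subseteq> {\<zero>\<^bsub>Rp\<^esub>}" using Rp.genideal_zero by simp
  have "ideal (Idl\<^bsub>Rp\<^esub> {}) Rp" by (rule Rp.genideal_ideal) auto
  then show "{\<zero>\<^bsub>Rp\<^esub>} \<subseteq> Idl\<^bsub>Rp\<^esub> {}"
    by (auto simp: ideal_def additive_subgroup.zero_closed)
qed

text \<open>Clearing denominators turns membership in a principal ideal into divisibility in
  \<open>A\<close> up to a factor outside \<open>P\<close>.\<close>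

lemma mem_Idl_single:
  assumes "p \<in> A" "t \<in> A - P" "a \<in> A" "s \<in> A - P"
  shows "fraction a s \<in> Idl\<^bsub>Rp\<^esub> {fraction p t} \<longleftrightarrow> (\<exists>r\<in>A. \<exists>u\<in>A - P. u * a = r * p)"
proof -
  have c: "fraction p t \<in> carrier Rp" using assms fraction_carrier by auto
  have "fraction a s \<in> Idl\<^bsub>Rp\<^esub> {fraction p t} \<longleftrightarrow> (\<exists>x\<in>carrier Rp. fraction a s = x \<otimes>\<^bsub>Rp\<^esub> fraction p t)"
    using Rp.cgenideal_eq_genideal[OF c] by (auto simp: cgenideal_def)
  also have "\<dots> \<longleftrightarrow> (\<exists>r\<in>A. \<exists>u\<in>A - P. fraction a s = fraction (r * p) (u * t))"
  proof -
    have "(\<exists>x\<in>carrier Rp. fraction a s = x \<otimes>\<^bsub>Rp\<^esub> fraction p t)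
        \<longleftrightarrow> (\<exists>r\<in>A. \<exists>u\<in>A - P. fraction a s = fraction r u \<otimes>\<^bsub>Rp\<^esub> fraction p t)"
      unfolding carrier_Rp by blast
    then show ?thesis using mult_fraction assms(1,2) by simp
  qed
  also have "\<dots> \<longleftrightarrow> (\<exists>r\<in>A. \<exists>u\<in>A - P. a * (u * t) = r * p * s)"
    using assms subD denom_mult by (simp add: fraction_eq)
  also have "\<dots> \<longleftrightarrow> (\<exists>r\<in>A. \<exists>u\<in>A - P. u * a = r * p)"
  proof safe
    fix r u assume h: "r \<in> A" "u \<in> A" "u \<notin> P" "a * (u * t) = r * p * s"
    then have "(u * t) * a = (r * s) * p" by (simp add: ac_simps)
    moreover have "r * s \<in> A" "u * t \<in> A - P"
      using h(1-3) assms(2,4) subD(4)[of r s] denom_mult[of u t] by simp_all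
    ultimately show "\<exists>r\<in>A. \<exists>u\<in>A - P. u * a = r * p" by blast
  next
    fix r u assume h: "r \<in> A" "u \<in> A" "u \<notin> P" "u * a = r * p"
    have "a * ((u * s) * t) = (u * a) * (s * t)" by (simp add: ac_simps)
    also have "\<dots> = (r * t) * p * s" unfolding h(4) by (simp add: ac_simps)
    finally have "a * ((u * s) * t) = (r * t) * p * s" .
    moreover have "r * t \<in> A" "u * s \<in> A - P"
      using h(1-3) assms(2,4) subD(4)[of r t] denom_mult[of u s] by simp_all
    ultimately show "\<exists>r\<in>A. \<exists>u\<in>A - P. a * (u * t) = r * p * s" by blast
  qed
  finally show ?thesis .
qed

lemma ideal_subset_carrier: "ideal J Rp \<Longrightarrow> J \<subseteq> carrier Rp"
  by (simp add: ideal_def additive_subgroup.a_subset)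

text \<open>In dimension at most one the maximal ideal has zero or one generators; for zero
  generators \<open>p = 0\<close> serves.\<close>

lemma regular_imp_principal:
  assumes reg: "regular_local_ring Rp" and d: "krull_dim Rp \<le> 1"
  shows "\<exists>p\<in>P. \<forall>q\<in>P. \<exists>s\<in>A - P. \<exists>r\<in>A. s * q = r * p"
proof -
  let ?G = "\<lambda>d. \<exists>B. B \<subseteq> carrier Rp \<and> finite B \<and> card B = d \<and> Idl\<^bsub>Rp\<^esub> B = ext P"
  have noeth: "noetherian_ring Rp" and k: "enat (Least ?G) = krull_dim Rp"
    using reg maximal_iff unfolding regular_local_ring_def by auto
  \<comment> \<open>The Noetherian property supplies some finite generating set; without one the
    \<open>LEAST\<close> would carry no information.\<close>
  obtain B0 where "B0 \<subseteq> carrier Rp" "finite B0" "ext P = Idl\<^bsub>Rp\<^esub> B0"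
    using noetherian_ring.finetely_gen[OF noeth ideal_ext_P] by blast
  then have "?G (card B0)" by auto
  then have "?G (Least ?G)" by (rule LeastI)
  then obtain B where B: "B \<subseteq> carrier Rp" "finite B" "card B = Least ?G" "Idl\<^bsub>Rp\<^esub> B = ext P" by blast
  have "enat (card B) \<le> 1" using B(3) k d by simp
  then have "card B = 0 \<or> card B = 1" by (auto simp: one_enat_def)
  then obtain p t where p: "p \<in> A" "t \<in> A - P" "Idl\<^bsub>Rp\<^esub> {fraction p t} = ext P"
  proof
    assume "card B = 0"
    then have "Idl\<^bsub>Rp\<^esub> {\<zero>\<^bsub>Rp\<^esub>} = ext P" using B genideal_empty Rp.genideal_zero by simp
    then show ?thesis using that[of 0 1] subD denom_one by (simp add: zero_Rp)
  next
    assume "card B = 1"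
    then obtain x where x: "B = {x}" by (auto simp: card_1_singleton_iff)
    then obtain p t where "p \<in> A" "t \<in> A - P" "x = fraction p t" using B(1) by (auto elim: fraction_cases)
    then show ?thesis using that B(4) x by simp
  qed
  have "fraction p t \<in> ext P" using Rp.genideal_self'[of "fraction p t"] p fraction_carrier by simp
  then have "p \<in> P" using mem_ext_iff[OF pr order_refl p(1,2)] by simp
  moreover have "\<exists>s\<in>A - P. \<exists>r\<in>A. s * q = r * p" if q: "q \<in> P" for q
  proof -
    have "fraction q 1 \<in> Idl\<^bsub>Rp\<^esub> {fraction p t}" using p(3) q denom_one by (auto simp: ext_def)
    then show ?thesis using mem_Idl_single[OF p(1,2), of q 1] q prD(1) denom_one by auto
  qed
  ultimately show ?thesis by blast
qed

text \<open>At the zero prime the localization is the fraction field: an ideal is zero or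
  everything, and the empty set generates the maximal ideal.\<close>

lemma regular_if_zero:
  assumes P: "P = {0}" shows "regular_local_ring Rp"
proof -
  have ext: "ext P = {\<zero>\<^bsub>Rp\<^esub>}"
  proof -
    have "fraction 0 s = fraction 0 1" if "s \<in> A - P" for s using that subD denom_one by (simp add: fraction_eq)
    moreover have "ext P = {fraction 0 s | s. s \<in> A - P}" using P unfolding ext_def by blast
    ultimately show ?thesis using denom_one unfolding zero_Rp by blast
  qed
  have "noetherian_ring Rp"
  proof (rule noetherian_ring.intro[OF Rp.ring_axioms], unfold_locales)
    fix J assume J: "ideal J Rp"
    show "\<exists>B\<subseteq>carrier Rp. finite B \<and> J = Idl\<^bsub>Rp\<^esub> B"
    proof (cases "J = carrier Rp")
      case True
      then show ?thesis using Rp.genideal_one by (intro exI[of _ "{\<one>\<^bsub>Rp\<^esub>}"]) auto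
    next
      case False
      then have "nums J = {0}" using nums_unit[OF J] nums_ideal(1)[OF J] P by blast
      moreover have "nums (ext P) = {0}" using ext_prime(2)[OF pr order_refl] P by simp
      ultimately have "J = ext P" using ideal_eqI J ideal_ext_P by simp
      then show ?thesis using ext genideal_empty by (intro exI[of _ "{}"]) auto
    qed
  qed
  moreover have "(LEAST d. \<exists>B. B \<subseteq> carrier Rp \<and> finite B \<and> card B = d \<and> Idl\<^bsub>Rp\<^esub> B = ext P) = 0"
    by (rule Least_eq_0) (use ext genideal_empty in \<open>auto intro!: exI[of _ "{}"]\<close>)
  ultimately show ?thesis
    unfolding regular_local_ring_def using local_Rp maximal_iff krull_dim_eq_0[OF P]
    by (auto simp: zero_enat_def)
qed

text \<open>
  The divisibility hypothesis makes the localization a discrete valuation ring outright, so that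
  Hilbert's basis theorem is never needed.
\<close>

lemma regular_if_dvr:
  assumes p: "p \<in> P" "p \<noteq> 0"
    and D: "\<And>f. f \<in> A \<Longrightarrow> f \<noteq> 0 \<Longrightarrow> \<exists>m. \<exists>s\<in>A - P. \<exists>u\<in>A - P. s * f = u * p ^ m"
  shows "regular_local_ring Rp"
proof -
  have pA: "p \<in> A" "\<And>m. p ^ m \<in> A" using p prD(1) subD by auto
  have mem_pow: "\<exists>m. p ^ m \<in> nums J \<and> (\<exists>s\<in>A - P. \<exists>u\<in>A - P. s * f = u * p ^ m)"
    if J: "ideal J Rp" and f: "f \<in> nums J" "f \<noteq> 0" for J f
  proof -
    have fA: "f \<in> A" using f by (simp add: nums_def)
    obtain m s u where h: "s \<in> A - P" "u \<in> A - P" "s * f = u * p ^ m" using D[OF fA f(2)] by blast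
    have "s * f \<in> nums J" using nums_ideal(3)[OF J] h f by blast
    then have "fraction (p ^ m * u) (u) \<in> J"
      using mem_ideal_iff_nums[OF J, of "p ^ m * u" u] h subD pA by (simp add: mult.commute)
    moreover have "fraction (p ^ m * u) u = fraction (p ^ m) 1" using h subD pA denom_one by (simp add: fraction_eq)
    ultimately show ?thesis using h pA by (auto simp: nums_def)
  qed
  have "noetherian_ring Rp"
  proof (rule noetherian_ring.intro[OF Rp.ring_axioms], unfold_locales)
    fix J assume J: "ideal J Rp"
    show "\<exists>B\<subseteq>carrier Rp. finite B \<and> J = Idl\<^bsub>Rp\<^esub> B"
    proof (cases "nums J = {0}")
      case True
      have "nums {\<zero>\<^bsub>Rp\<^esub>} = {0}" using subD denom_one by (auto simp: nums_def zero_Rp fraction_eq)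
      then have "J = {\<zero>\<^bsub>Rp\<^esub>}" using True ideal_eqI[OF J] Rp.zeroideal by simp
      then show ?thesis using genideal_empty by (intro exI[of _ "{}"]) auto
    next
      case False
      \<comment> \<open>The valuation of \<open>J\<close>: the ideal turns out to be generated by
        the smallest power of \<open>p\<close> that it contains.\<close>
      define m where "m = (LEAST m. p ^ m \<in> nums J)"
      obtain f where "f \<in> nums J" "f \<noteq> 0" using False nums_ideal(1)[OF J] by blast
      then have m: "p ^ m \<in> nums J" unfolding m_def using mem_pow[OF J] by (metis LeastI)
      have pm: "fraction (p ^ m) 1 \<in> J" using m by (simp add: nums_def)
      have "J = Idl\<^bsub>Rp\<^esub> {fraction (p ^ m) 1}"
      proof
        show "Idl\<^bsub>Rp\<^esub> {fraction (p ^ m) 1} \<subseteq> J" using Rp.genideal_minimal[OF J] pm by simp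
        show "J \<subseteq> Idl\<^bsub>Rp\<^esub> {fraction (p ^ m) 1}"
        proof
          fix x assume x: "x \<in> J"
          then obtain a t where a: "a \<in> A" "t \<in> A - P" "x = fraction a t"
            using ideal_subset_carrier[OF J] by (blast elim: fraction_cases)
          then have aJ: "a \<in> nums J" using x mem_ideal_iff_nums[OF J] by simp
          have "\<exists>r\<in>A. \<exists>u\<in>A - P. u * a = r * p ^ m"
          proof (cases "a = 0")
            case True
            then show ?thesis using subD denom_one by (intro bexI[of _ 0] bexI[of _ 1]) auto
          next
            case False
            obtain k s u where h: "p ^ k \<in> nums J" "s \<in> A - P" "u \<in> A - P" "s * a = u * p ^ k"
              using mem_pow[OF J aJ False] by blast
            have "m \<le> k" unfolding m_def using h(1) by (rule Least_le)
            then have "s * a = (u * p ^ (k - m)) * p ^ m"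
              using h(4) by (simp add: mult.assoc power_add[symmetric])
            moreover have "u * p ^ (k - m) \<in> A" using h(3) subD(4) pA(2) by blast
            ultimately show ?thesis using h(2) by blast
          qed
          then show "x \<in> Idl\<^bsub>Rp\<^esub> {fraction (p ^ m) 1}"
            using mem_Idl_single[OF pA(2) denom_one a(1,2)] a(3) by simp
        qed
      qed
      then show ?thesis using fraction_carrier pA denom_one by (intro exI[of _ "{fraction (p ^ m) 1}"]) auto
    qed
  qed
  moreover have gen: "Idl\<^bsub>Rp\<^esub> {fraction p 1} = ext P"
  proof
    show "Idl\<^bsub>Rp\<^esub> {fraction p 1} \<subseteq> ext P"
      by (rule Rp.genideal_minimal[OF ideal_ext_P]) (use p denom_one in \<open>auto simp: ext_def\<close>)
    show "ext P \<subseteq> Idl\<^bsub>Rp\<^esub> {fraction p 1}"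
    proof
      fix x assume "x \<in> ext P"
      then obtain a t where a: "a \<in> P" "t \<in> A - P" "x = fraction a t" by (auto simp: ext_def)
      then have aA: "a \<in> A" using prD by blast
      have "\<exists>r\<in>A. \<exists>u\<in>A - P. u * a = r * p"
      proof (cases "a = 0")
        case True
        then show ?thesis using subD denom_one by (intro bexI[of _ 0] bexI[of _ 1]) auto
      next
        case False
        obtain m s u where h: "s \<in> A - P" "u \<in> A - P" "s * a = u * p ^ m" using D[OF aA False] by blast
        have "s * a \<in> P" using a h prD by blast
        \<comment> \<open>For \<open>m = 0\<close> the equation would put \<open>u\<close> into
          \<open>P\<close>.\<close>
        then have "m \<noteq> 0" using h by (intro notI) simp
        then have "s * a = (u * p ^ (m - 1)) * p" using h(3) by (cases m) (auto simp: algebra_simps)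
        moreover have "u * p ^ (m - 1) \<in> A" using h(2) subD(4) pA(2) by blast
        ultimately show ?thesis using h(1) by blast
      qed
      then show "x \<in> Idl\<^bsub>Rp\<^esub> {fraction p 1}"
        using mem_Idl_single[OF pA(1) denom_one aA a(2)] a(3) by simp
    qed
  qed
  moreover have "(LEAST d. \<exists>B. B \<subseteq> carrier Rp \<and> finite B \<and> card B = d \<and> Idl\<^bsub>Rp\<^esub> B = ext P) = 1"
  proof (rule Least_equality)
    show "\<exists>B. B \<subseteq> carrier Rp \<and> finite B \<and> card B = 1 \<and> Idl\<^bsub>Rp\<^esub> B = ext P"
      using gen fraction_carrier pA denom_one by (intro exI[of _ "{fraction p 1}"]) auto
    fix d assume "\<exists>B. B \<subseteq> carrier Rp \<and> finite B \<and> card B = d \<and> Idl\<^bsub>Rp\<^esub> B = ext P"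
    then obtain B where B: "finite B" "card B = d" "Idl\<^bsub>Rp\<^esub> B = ext P" by blast
    have "d \<noteq> 0"
    proof
      assume "d = 0"
      then have "ext P = {fraction 0 1}" using B genideal_empty by (simp add: zero_Rp)
      moreover have "fraction p 1 \<in> ext P" using p denom_one by (auto simp: ext_def)
      ultimately have "fraction p 1 = fraction 0 1" by simp
      then show False using p(2) pA subD denom_one by (simp add: fraction_eq)
    qed
    then show "1 \<le> d" by simp
  qed
  moreover have "krull_dim Rp = 1"
  proof (rule krull_dim_eq_1)
    show "P \<noteq> {0}" using p by auto
    fix I assume I: "prime_in A I" "I \<subseteq> P" "I \<noteq> {0}"
    note e = ext_prime[OF I(1,2)]
    obtain f where "f \<in> I" "f \<noteq> 0" using I prime_inD(2)[OF I(1)] by blast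
    \<comment> \<open>A nonzero element of \<open>I\<close> is a power of \<open>p\<close> up to
      units of the localization, so the prime \<open>I\<close> contains \<open>p\<close>.\<close>
    then obtain m where "p ^ m \<in> I" using mem_pow[of "ext I" f] e by (auto simp: primeideal_def)
    then have "p \<in> I" using prime_in_power[OF sub I(1) pA(1)] by blast
    then have "fraction p 1 \<in> ext I" using denom_one by (auto simp: ext_def)
    then have "ext P \<subseteq> ext I" using Rp.genideal_minimal[of "ext I" "{fraction p 1}"] e gen by (auto simp: primeideal_def)
    then have "nums (ext P) \<subseteq> nums (ext I)" by (auto simp: nums_def)
    then show "I = P" using e(2) ext_prime(2)[OF pr order_refl] I by auto
  qed
  ultimately show ?thesis
    unfolding regular_local_ring_def using local_Rp maximal_iff by (auto simp: one_enat_def)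
qed

end

subsection \<open>Graded parts of Laurent polynomials\<close>

type_synonym 'k laurent = "(nat \<Rightarrow>\<^sub>0 int) \<Rightarrow>\<^sub>0 'k"

abbreviation "keys \<equiv> Poly_Mapping.keys"
abbreviation "lookup \<equiv> Poly_Mapping.lookup"

definition mring :: "'b set \<Rightarrow> ('b \<Rightarrow>\<^sub>0 'k::zero) set" where
  "mring S = {f. keys f \<subseteq> S}"

lift_definition restr :: "'b set \<Rightarrow> ('b \<Rightarrow>\<^sub>0 'k::zero) \<Rightarrow> ('b \<Rightarrow>\<^sub>0 'k)" is
  "\<lambda>S f q. if q \<in> S then f q else 0"
  by (rule finite_subset[rotated]) auto

abbreviation mon :: "'b \<Rightarrow> ('b \<Rightarrow>\<^sub>0 'k::{zero, one})" where
  "mon q \<equiv> Poly_Mapping.single q 1"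

lemma mon_nz [simp]: "(mon q :: _ \<Rightarrow>\<^sub>0 'k::zero_neq_one) \<noteq> 0"
  by (metis keys_eq_empty keys_single insert_not_empty zero_neq_one)

lemma mon_mon_mult: "mon a * (mon b * f) = mon (a + b) * (f :: 'b::monoid_add \<Rightarrow>\<^sub>0 'k::semiring_1)"
  by (simp add: mult_single mult.assoc[symmetric])

definition additive_fun :: "('b::ab_group_add \<Rightarrow> 'c::ab_group_add) \<Rightarrow> bool" where
  "additive_fun \<delta> \<longleftrightarrow> (\<forall>p q. \<delta> (p + q) = \<delta> p + \<delta> q)"

text \<open>For additive \<open>\<delta>\<close> this is the homogeneous component of degree
  \<open>\<gamma>\<close> in the grading that \<open>\<delta>\<close> induces on the group
  ring.\<close>

abbreviation part :: "('b \<Rightarrow> 'c) \<Rightarrow> 'c \<Rightarrow> ('b \<Rightarrow>\<^sub>0 'k::zero) \<Rightarrow> ('b \<Rightarrow>\<^sub>0 'k)" where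
  "part \<delta> \<gamma> \<equiv> restr {q. \<delta> q = \<gamma>}"

lemma additive_funD:
  assumes "additive_fun \<delta>"
  shows "\<delta> (p + q) = \<delta> p + \<delta> q" "\<delta> 0 = 0" "\<delta> (- p) = - \<delta> p" "\<delta> (p - q) = \<delta> p - \<delta> q"
proof -
  show a: "\<delta> (p + q) = \<delta> p + \<delta> q" for p q using assms by (simp add: additive_fun_def)
  show z: "\<delta> 0 = 0" using a[of 0 0] by simp
  show m: "\<delta> (- p) = - \<delta> p" for p using a[of p "- p"] z by (simp add: eq_neg_iff_add_eq_0 add.commute)
  show "\<delta> (p - q) = \<delta> p - \<delta> q" using a[of p "- q"] m by simp
qed

lemma lookup_restr: "lookup (restr S f) q = (if q \<in> S then lookup f q else 0)"
  by transfer simp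

lemma keys_restr: "keys (restr S f) = keys f \<inter> S"
  by (auto simp: in_keys_iff lookup_restr split: if_splits)

lemma restr_add: "restr S (f + g) = restr S f + restr S (g :: _ \<Rightarrow>\<^sub>0 _::monoid_add)"
  by (rule poly_mapping_eqI) (simp add: lookup_restr lookup_add)

lemma restr_diff: "restr S (f - g) = restr S f - restr S (g :: _ \<Rightarrow>\<^sub>0 _::ab_group_add)"
  by (rule poly_mapping_eqI) (simp add: lookup_restr lookup_minus)

lemma restr_sum: "restr S (sum f I) = (\<Sum>i\<in>I. restr S (f i :: _ \<Rightarrow>\<^sub>0 _::comm_monoid_add))"
  by (rule poly_mapping_eqI) (simp add: lookup_restr lookup_sum)

lemma restr_split: "f = restr S f + restr (- S) (f :: _ \<Rightarrow>\<^sub>0 _::monoid_add)"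
  by (rule poly_mapping_eqI) (simp add: lookup_restr lookup_add)

lemma restr_id: "keys f \<subseteq> S \<Longrightarrow> restr S f = f"
  by (rule poly_mapping_eqI) (auto simp: lookup_restr in_keys_iff)

lemma restr_0: "keys f \<inter> S = {} \<Longrightarrow> restr S f = 0"
  by (rule poly_mapping_eqI) (auto simp: lookup_restr in_keys_iff)

lemma keys_mult_elim:
  assumes "q \<in> keys (f * g)"
  obtains a b where "a \<in> keys f" "b \<in> keys g" "q = a + b"
  using assms keys_mult by blast

lemma keys_minus_elim:
  assumes "q \<in> keys (f - (g :: _ \<Rightarrow>\<^sub>0 _::ab_group_add))"
  shows "q \<in> keys f \<or> q \<in> keys g"
  using assms by (auto simp: in_keys_iff lookup_minus)

lemma keys_mon_mult:
  fixes f :: "'b::ab_group_add \<Rightarrow>\<^sub>0 'k::comm_ring_1"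
  shows "keys (mon c * f) = (+) c ` keys f"
proof -
  have sub: "keys (mon c * f) \<subseteq> (+) c ` keys f" for c and f :: "'b \<Rightarrow>\<^sub>0 'k"
    by (auto elim!: keys_mult_elim)
  have "f = mon (- c) * (mon c * f)"
    by (simp add: mult.assoc[symmetric] mult_single)
  then have "keys f \<subseteq> (+) (- c) ` keys (mon c * f)"
    using sub[of "- c" "mon c * f"] by simp
  then have "(+) c ` keys f \<subseteq> (+) c ` ((+) (- c) ` keys (mon c * f))"
    by (rule image_mono)
  also have "\<dots> = keys (mon c * f)" by (simp add: image_image)
  finally show ?thesis using sub by blast
qed

text \<open>The assumption \<open>ext\<close> says that total degree \<open>a + b\<close> arises
  only from degrees \<open>a\<close> and \<open>b\<close>, so there are no cross terms. It holds for
  top components, for bottom components and when one factor is homogeneous.\<close>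

lemma part_mult_extreme:
  fixes f g :: "'b::ab_group_add \<Rightarrow>\<^sub>0 'k::comm_ring_1" and \<delta> :: "'b \<Rightarrow> 'c::ab_group_add"
  assumes d: "additive_fun \<delta>"
    and ext: "\<And>p q. p \<in> keys f \<Longrightarrow> q \<in> keys g \<Longrightarrow> \<delta> p + \<delta> q = a + b \<Longrightarrow> \<delta> p = a"
  shows "part \<delta> (a + b) (f * g) = part \<delta> a f * part \<delta> b g"
proof -
  let ?f = "part \<delta> a f" and ?g = "part \<delta> b g"
  let ?f' = "restr (- {q. \<delta> q = a}) f" and ?g' = "restr (- {q. \<delta> q = b}) g"
  have "f * g = (?f + ?f') * (?g + ?g')" by (simp flip: restr_split)
  also have "\<dots> = ?f * ?g + (?f * ?g' + ?f' * g)" by (simp add: algebra_simps flip: restr_split distrib_left)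
  finally have e: "f * g = ?f * ?g + (?f * ?g' + ?f' * g)" .
  have "part \<delta> (a + b) (?f * ?g) = ?f * ?g"
    by (rule restr_id) (auto simp: keys_restr additive_funD[OF d] elim!: keys_mult_elim)
  moreover have "part \<delta> (a + b) (?f * ?g') = 0"
    by (rule restr_0) (auto simp: keys_restr additive_funD[OF d] elim!: keys_mult_elim)
  moreover have "part \<delta> (a + b) (?f' * g) = 0"
    by (rule restr_0) (auto simp: keys_restr additive_funD[OF d] dest: ext elim!: keys_mult_elim)
  ultimately show ?thesis by (subst e) (simp only: restr_add add_0_right)
qed

lemma part_mult_homogeneous:
  fixes f g :: "'b::ab_group_add \<Rightarrow>\<^sub>0 'k::comm_ring_1" and \<delta> :: "'b \<Rightarrow> 'c::ab_group_add"
  assumes d: "additive_fun \<delta>" and f: "\<And>p. p \<in> keys f \<Longrightarrow> \<delta> p = a"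
  shows "part \<delta> c (f * g) = f * part \<delta> (c - a) g"
proof -
  have "part \<delta> a f = f" using f by (intro restr_id) auto
  then show ?thesis using part_mult_extreme[OF d, of f g a "c - a"] f by simp
qed

lemma sum_parts: "(f :: 'b \<Rightarrow>\<^sub>0 'k::comm_monoid_add) = (\<Sum>\<gamma>\<in>\<delta> ` keys f. part \<delta> \<gamma> f)"
proof (rule poly_mapping_eqI)
  fix q
  show "lookup f q = lookup (\<Sum>\<gamma>\<in>\<delta> ` keys f. part \<delta> \<gamma> f) q"
    by (auto simp: lookup_sum lookup_restr sum.delta' in_keys_iff image_iff)
qed

text \<open>For \<open>f = 0\<close> the maximum is over the empty set, hence the nonzero
  assumptions wherever the value matters. Applied to the negative of \<open>\<delta>\<close> it
  yields the lowest degree with opposite sign.\<close>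

definition top_deg :: "('b \<Rightarrow> 'c::linorder) \<Rightarrow> ('b \<Rightarrow>\<^sub>0 'k::zero) \<Rightarrow> 'c" where
  "top_deg \<delta> f = Max (\<delta> ` keys f)"

lemma top_deg_ge: "q \<in> keys f \<Longrightarrow> \<delta> q \<le> top_deg \<delta> f"
  by (simp add: top_deg_def)

lemma top_deg_le: "f \<noteq> 0 \<Longrightarrow> (\<And>q. q \<in> keys f \<Longrightarrow> \<delta> q \<le> c) \<Longrightarrow> top_deg \<delta> f \<le> c"
  by (simp add: top_deg_def)

lemma top_deg_attained:
  assumes "f \<noteq> 0" obtains q where "q \<in> keys f" "\<delta> q = top_deg \<delta> f"
proof -
  have "top_deg \<delta> f \<in> \<delta> ` keys f" unfolding top_deg_def using assms by (intro Max_in) auto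
  then show ?thesis using that by auto
qed

lemma top_part_nz: assumes "f \<noteq> 0" shows "part \<delta> (top_deg \<delta> f) f \<noteq> 0"
proof -
  obtain q where "q \<in> keys f" "\<delta> q = top_deg \<delta> f" using top_deg_attained[OF assms] .
  then have "q \<in> keys (part \<delta> (top_deg \<delta> f) f)" by (simp add: keys_restr)
  then show ?thesis by auto
qed

lemma top_part_mult:
  fixes f g :: "'b::ab_group_add \<Rightarrow>\<^sub>0 'k::comm_ring_1" and \<delta> :: "'b \<Rightarrow> 'c::linordered_ab_group_add"
  assumes d: "additive_fun \<delta>"
  shows "part \<delta> (top_deg \<delta> f + top_deg \<delta> g) (f * g) = part \<delta> (top_deg \<delta> f) f * part \<delta> (top_deg \<delta> g) g"
  by (rule part_mult_extreme[OF d]) (metis add_le_cancel_left add_mono antisym top_deg_ge add_le_imp_le_right)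

text \<open>The linear order on the exponents makes the group ring a domain, so the product of the
  two top components does not vanish.\<close>

lemma top_deg_mult:
  fixes f g :: "'b::{linordered_ab_group_add} \<Rightarrow>\<^sub>0 'k::idom" and \<delta> :: "'b \<Rightarrow> 'c::linordered_ab_group_add"
  assumes d: "additive_fun \<delta>" and nz: "f \<noteq> 0" "g \<noteq> 0"
  shows "top_deg \<delta> (f * g) = top_deg \<delta> f + top_deg \<delta> g"
proof (rule antisym)
  show "top_deg \<delta> (f * g) \<le> top_deg \<delta> f + top_deg \<delta> g"
    using nz by (intro top_deg_le) (auto simp: additive_funD[OF d] top_deg_ge add_mono elim!: keys_mult_elim)
  have "part \<delta> (top_deg \<delta> f + top_deg \<delta> g) (f * g) \<noteq> 0"
    using top_part_mult[OF d, of f g] nz top_part_nz by auto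
  then obtain q where "q \<in> keys (f * g)" "\<delta> q = top_deg \<delta> f + top_deg \<delta> g"
    unfolding keys_eq_empty[symmetric] keys_restr by auto
  then show "top_deg \<delta> f + top_deg \<delta> g \<le> top_deg \<delta> (f * g)" using top_deg_ge by metis
qed

definition submonoid :: "'b::monoid_add set \<Rightarrow> bool" where
  "submonoid S \<longleftrightarrow> 0 \<in> S \<and> (\<forall>x\<in>S. \<forall>y\<in>S. x + y \<in> S)"

lemma is_subring_mring:
  fixes S :: "'b::ab_group_add set"
  assumes "submonoid S" shows "is_subring (mring S :: ('b \<Rightarrow>\<^sub>0 'k::comm_ring_1) set)"
  unfolding is_subring_def
proof (intro conjI ballI)
  show "1 \<in> (mring S :: ('b \<Rightarrow>\<^sub>0 'k) set)" using assms by (simp add: mring_def submonoid_def)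
  fix x y :: "'b \<Rightarrow>\<^sub>0 'k" assume x: "x \<in> mring S" "y \<in> mring S"
  then show "x - y \<in> mring S" using keys_minus_elim[of _ x y] unfolding mring_def by blast
  show "x * y \<in> mring S"
    using x assms unfolding mring_def submonoid_def by (auto elim!: keys_mult_elim) 
qed

lemma mon_in_mring [simp]: "(mon q :: _ \<Rightarrow>\<^sub>0 'k::zero_neq_one) \<in> mring S \<longleftrightarrow> q \<in> S"
  by (simp add: mring_def)

lemma restr_in_mring: "f \<in> mring S \<Longrightarrow> restr T f \<in> mring S"
  by (auto simp: mring_def keys_restr)

text \<open>The largest \<open>\<delta>\<close>-graded ideal contained in \<open>P\<close>.\<close>

definition graded_core :: "('b \<Rightarrow> 'c) \<Rightarrow> ('b \<Rightarrow>\<^sub>0 'k::zero) set \<Rightarrow> ('b \<Rightarrow>\<^sub>0 'k) set" where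
  "graded_core \<delta> P = {f. \<forall>\<gamma>. part \<delta> \<gamma> f \<in> P}"

lemma graded_core_subset: assumes "prime_in A P" shows "graded_core \<delta> P \<subseteq> P"
proof
  fix f assume "f \<in> graded_core \<delta> P"
  then have "(\<Sum>\<gamma>\<in>\<delta> ` keys f. part \<delta> \<gamma> f) \<in> P"
    by (intro prime_in_sum[OF assms]) (auto simp: graded_core_def)
  then show "f \<in> P" using sum_parts[of f \<delta>] by simp
qed

text \<open>Degrees are linearly ordered, so primality can be tested on top components: if neither
  factor is in the core, both can be changed modulo the core until their top components lie outside
  \<open>P\<close>.\<close>

lemma graded_core_prime:
  fixes P :: "('b::linordered_ab_group_add \<Rightarrow>\<^sub>0 'k::idom) set"
    and \<delta> :: "'b \<Rightarrow> 'c::linordered_ab_group_add"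
  assumes S: "submonoid S" and P: "prime_in (mring S) P" and d: "additive_fun \<delta>"
  shows "prime_in (mring S) (graded_core \<delta> P)"
proof -
  note pD = prime_inD[OF P]
  have sub: "graded_core \<delta> P \<subseteq> P" by (rule graded_core_subset[OF P])
  have z: "0 \<in> graded_core \<delta> P" using pD(2) by (simp add: graded_core_def restr_0)
  have add: "x + y \<in> graded_core \<delta> P" if "x \<in> graded_core \<delta> P" "y \<in> graded_core \<delta> P" for x y
    using that pD(3) by (simp add: graded_core_def restr_add)
  have diff: "x - y \<in> graded_core \<delta> P" if "x \<in> graded_core \<delta> P" "y \<in> graded_core \<delta> P" for x y
    using that prime_in_diff[OF is_subring_mring[OF S] P] by (simp add: graded_core_def restr_diff)
  have mult: "a * x \<in> graded_core \<delta> P" if a: "a \<in> mring S" and x: "x \<in> graded_core \<delta> P" for a x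
    unfolding graded_core_def
  proof (intro CollectI allI)
    fix \<gamma>
    have "a * x = (\<Sum>\<alpha>\<in>\<delta> ` keys a. part \<delta> \<alpha> a * x)"
      by (subst sum_parts[of a \<delta>]) (simp only: sum_distrib_right)
    then have "part \<delta> \<gamma> (a * x) = (\<Sum>\<alpha>\<in>\<delta> ` keys a. part \<delta> \<gamma> (part \<delta> \<alpha> a * x))"
      by (simp only: restr_sum)
    also have "\<dots> = (\<Sum>\<alpha>\<in>\<delta> ` keys a. part \<delta> \<alpha> a * part \<delta> (\<gamma> - \<alpha>) x)"
      by (intro sum.cong refl part_mult_homogeneous[OF d]) (simp add: keys_restr)
    also have "\<dots> \<in> P"
      using x by (intro prime_in_sum[OF P] pD(4) restr_in_mring a) (simp add: graded_core_def)
    finally show "part \<delta> \<gamma> (a * x) \<in> P" .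
  qed
  have bad: "\<exists>f' f''. f = f' + f'' \<and> f'' \<in> graded_core \<delta> P \<and> f' \<in> mring S \<and> part \<delta> (top_deg \<delta> f') f' \<notin> P"
    if f: "f \<in> mring S" "f \<notin> graded_core \<delta> P" for f
  proof -
    \<comment> \<open>\<open>?T\<close> keeps the homogeneous components of \<open>f\<close> outside
      \<open>P\<close>; the discarded ones form an element of the core.\<close>
    let ?T = "{q. part \<delta> (\<delta> q) f \<notin> P}"
    have T: "part \<delta> \<gamma> (restr ?T f) = (if part \<delta> \<gamma> f \<in> P then 0 else part \<delta> \<gamma> f)"
      "part \<delta> \<gamma> (restr (- ?T) f) = (if part \<delta> \<gamma> f \<in> P then part \<delta> \<gamma> f else 0)" for \<gamma>
      by (rule poly_mapping_eqI; auto simp: lookup_restr)+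
    have "restr (- ?T) f \<in> graded_core \<delta> P" using pD(2) by (simp add: graded_core_def T)
    moreover obtain \<gamma> where g: "part \<delta> \<gamma> f \<notin> P" using f(2) by (auto simp: graded_core_def)
    then have "part \<delta> \<gamma> (restr ?T f) \<noteq> 0" using T pD(2) by auto
    then have "restr ?T f \<noteq> 0" by (auto simp: restr_0)
    then have "part \<delta> (top_deg \<delta> (restr ?T f)) (restr ?T f) \<noteq> 0" by (rule top_part_nz)
    then have "part \<delta> (top_deg \<delta> (restr ?T f)) (restr ?T f) \<notin> P" using T by metis
    ultimately show ?thesis using restr_split[of f ?T] restr_in_mring[OF f(1)] by blast
  qed
  have prime: "f \<in> graded_core \<delta> P \<or> g \<in> graded_core \<delta> P" if fg: "f \<in> mring S" "g \<in> mring S" "f * g \<in> graded_core \<delta> P" for f g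
  proof (rule ccontr)
    assume "\<not> ?thesis"
    then obtain f' f'' g' g'' where
      f: "f = f' + f''" "f'' \<in> graded_core \<delta> P" "f' \<in> mring S" "part \<delta> (top_deg \<delta> f') f' \<notin> P" and
      g: "g = g' + g''" "g'' \<in> graded_core \<delta> P" "g' \<in> mring S" "part \<delta> (top_deg \<delta> g') g' \<notin> P"
      using bad[of f] bad[of g] fg by blast
    have "f' * g' = (f * g - g * f'') - f' * g''" using f(1) g(1) by (simp add: algebra_simps)
    also have "\<dots> \<in> graded_core \<delta> P" by (intro diff fg mult f g)
    finally have "part \<delta> (top_deg \<delta> f' + top_deg \<delta> g') (f' * g') \<in> P" by (simp add: graded_core_def)
    then show False unfolding top_part_mult[OF d]
      using pD(7)[OF restr_in_mring[OF f(3)] restr_in_mring[OF g(3)]] f(4) g(4) by blast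
  qed
  show ?thesis
    unfolding prime_in_def using sub pD(1,6) z add mult prime by blast
qed

lemma mring_zero_unit:
  fixes f :: "'b::monoid_add \<Rightarrow>\<^sub>0 'k::field"
  assumes "f \<in> mring {0}" "f \<noteq> 0" shows "\<exists>g\<in>mring {0}. g * f = 1"
proof -
  define c where "c = lookup f 0"
  have f: "f = Poly_Mapping.single 0 c"
    by (rule poly_mapping_eqI) (use assms in \<open>auto simp: c_def mring_def lookup_single when_def in_keys_iff\<close>)
  then have "c \<noteq> 0" using assms by auto
  then have "Poly_Mapping.single 0 (inverse c) * f = 1" by (simp add: f mult_single)
  then show ?thesis by (intro bexI[of _ "Poly_Mapping.single 0 (inverse c)"]) (auto simp: mring_def)
qed

subsection \<open>Primes without monomials\<close>

text \<open>The Euclidean degree for Laurent polynomials: highest minus lowest degree, which is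
  unchanged by multiplication with a monomial.\<close>

definition width :: "('b \<Rightarrow> int) \<Rightarrow> ('b \<Rightarrow>\<^sub>0 'k::zero) \<Rightarrow> nat" where
  "width \<delta> f = nat (top_deg \<delta> f + top_deg (\<lambda>q. - \<delta> q) f)"

lemma width_nonneg: assumes "f \<noteq> 0" shows "0 \<le> top_deg \<delta> f + top_deg (\<lambda>q. - \<delta> q) (f :: _ \<Rightarrow>\<^sub>0 _) + (0::int)"
proof -
  obtain q where "q \<in> keys f" using assms by (meson all_not_in_conv keys_eq_empty)
  then show ?thesis using top_deg_ge[of q f \<delta>] top_deg_ge[of q f "\<lambda>q. - \<delta> q"] by linarith
qed

lemma additive_fun_uminus: "additive_fun \<delta> \<Longrightarrow> additive_fun (\<lambda>q. - \<delta> q)"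
  by (simp add: additive_fun_def)

lemma width_mult:
  fixes f g :: "'b::{linordered_ab_group_add} \<Rightarrow>\<^sub>0 'k::idom"
  assumes d: "additive_fun \<delta>" and nz: "f \<noteq> 0" "g \<noteq> 0"
  shows "width \<delta> (f * g) = width \<delta> f + width \<delta> g"
  using top_deg_mult[OF d nz] top_deg_mult[OF additive_fun_uminus[OF d] nz]
    width_nonneg[OF nz(1), of \<delta>] width_nonneg[OF nz(2), of \<delta>]
  by (simp add: width_def)

lemma width_mono:
  assumes "f \<noteq> 0" "keys f \<subseteq> keys g" shows "width \<delta> f \<le> width \<delta> g"
proof -
  have "top_deg \<delta> f \<le> top_deg \<delta> g" "top_deg (\<lambda>q. - \<delta> q) f \<le> top_deg (\<lambda>q. - \<delta> q) g"
    using assms by (intro top_deg_le top_deg_ge; blast)+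
  then show ?thesis by (simp add: width_def)
qed

lemma width_eq_0:
  assumes "width \<delta> f = 0" "p \<in> keys f" "q \<in> keys f" shows "\<delta> p = \<delta> q"
  using assms(1) top_deg_ge[OF assms(2), of \<delta>] top_deg_ge[OF assms(2), of "\<lambda>q. - \<delta> q"]
    top_deg_ge[OF assms(3), of \<delta>] top_deg_ge[OF assms(3), of "\<lambda>q. - \<delta> q"]
  unfolding width_def by linarith

lemma width_eq_0I:
  assumes "f \<noteq> 0" "\<And>q. q \<in> keys f \<Longrightarrow> \<delta> q = a" shows "width \<delta> f = 0"
proof -
  have "top_deg \<delta> f \<le> a" "top_deg (\<lambda>q. - \<delta> q) f \<le> - a" using assms by (auto intro!: top_deg_le)
  then show ?thesis by (simp add: width_def)
qed

text \<open>Conceptually, inverting the nonzero elements in the coordinates below \<open>i\<close>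
  leaves Laurent polynomials in coordinate \<open>i\<close> over a field, a principal ideal domain,
  and the later coordinates only add units. The proof stays inside \<open>mring M\<close> and
  carries the denominators along.\<close>

lemma laurent_dvr:
  fixes P :: "'k::field laurent set"
  assumes M: "submonoid M" "\<And>q. q \<in> M \<Longrightarrow> - q \<in> M"
    and fin: "\<And>q. q \<in> M \<Longrightarrow> keys q \<subseteq> {..<n}"
    and P: "prime_in (mring M) P" "P \<noteq> {0}"
    and ht: "\<And>I. prime_in (mring M) I \<Longrightarrow> I \<subseteq> P \<Longrightarrow> I \<noteq> {0} \<Longrightarrow> I = P"
  shows "\<exists>p\<in>P. p \<noteq> 0 \<and>
    (\<forall>f\<in>mring M. f \<noteq> 0 \<longrightarrow> (\<exists>m. \<exists>s\<in>mring M - P. \<exists>u\<in>mring M - P. s * f = u * p ^ m))"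
proof -
  note pD = prime_inD[OF P(1)]
  have sr: "is_subring (mring M :: 'k laurent set)" by (rule is_subring_mring[OF M(1)])
  note sD = is_subringD[OF sr]
  define N where "N = (\<lambda>j. {q \<in> M. keys q \<subseteq> {..<j}})"
  define j where "j = (LEAST j. P \<inter> mring (N j) \<noteq> {0})"
  have zk: "0 \<in> P \<inter> mring (N j)" for j using pD(2) by (simp add: mring_def)
  have "N n = M" using fin by (auto simp: N_def)
  then have "P \<inter> mring (N n) \<noteq> {0}" using P(2) pD(1) by (simp add: Int_absorb2)
  then have j: "P \<inter> mring (N j) \<noteq> {0}" unfolding j_def by (rule LeastI)
  \<comment> \<open>With no coordinates only constants remain, and a nonzero constant is a
    unit.\<close>
  have "j \<noteq> 0"
  proof
    assume "j = 0"
    then have "N j \<subseteq> {0}" by (auto simp: N_def)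
    then have "N j = {0}" using M(1) by (auto simp: N_def submonoid_def)
    then obtain f where f: "f \<in> P" "f \<in> mring {0}" "f \<noteq> 0" using j zk[of j] by auto
    then obtain g where g: "g \<in> mring {0}" "g * f = 1" using mring_zero_unit by blast
    then have "g \<in> mring M" using M(1) by (auto simp: mring_def submonoid_def)
    then show False using pD(4)[of g f] g f pD(6) by simp
  qed
  then obtain i where i: "j = Suc i" by (cases j) auto
  have Ni: "P \<inter> mring (N i) = {0}" using not_less_Least[of i, folded j_def] i
    by (metis (mono_tags, lifting) j_def lessI not_less_Least)
  \<comment> \<open>\<open>P\<close> first becomes nonzero through coordinate \<open>i\<close>, the
    last one below \<open>j\<close>. This coordinate is \<open>deg\<close>; the ones after it are
    kept by \<open>\<delta>\<close>.\<close>
  define \<delta> :: "(nat \<Rightarrow>\<^sub>0 int) \<Rightarrow> (nat \<Rightarrow>\<^sub>0 int)" where "\<delta> = restr {j..}"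
  define deg :: "(nat \<Rightarrow>\<^sub>0 int) \<Rightarrow> int" where "deg = (\<lambda>q. lookup q i)"
  have d: "additive_fun \<delta>" by (simp add: additive_fun_def \<delta>_def restr_add)
  have dg: "additive_fun deg" by (simp add: additive_fun_def deg_def lookup_add)
  have N_iff: "q \<in> N j \<longleftrightarrow> q \<in> M \<and> \<delta> q = 0" for q
    unfolding N_def \<delta>_def keys_eq_empty[symmetric] keys_restr by fastforce
  have Nsuc: "q - c \<in> N i" if "q \<in> N j" "c \<in> N j" "deg q = deg c" for q c
  proof -
    have "q - c \<in> M" using that M unfolding N_def submonoid_def by (metis (no_types, lifting) mem_Collect_eq diff_conv_add_uminus)
    moreover have "keys (q - c) \<subseteq> {..<i}"
    proof
      fix v assume v: "v \<in> keys (q - c)"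
      then have "v \<noteq> i" using that(3) by (auto simp: deg_def in_keys_iff lookup_minus)
      moreover have "v < j" using keys_minus_elim[OF v] that by (auto simp: N_def)
      ultimately show "v \<in> {..<i}" using i by simp
    qed
    ultimately show ?thesis by (simp add: N_def)
  qed
  have unit: "mon c * f \<in> P \<Longrightarrow> f \<in> P" if "c \<in> M" "f \<in> mring M" for c and f :: "'k laurent"
    using pD(4)[of "mon (- c)" "mon c * f"] that M(2) by (simp add: mult.assoc[symmetric] mult_single)
  \<comment> \<open>\<open>P\<close> meets the Laurent polynomials in the coordinates below \<open>j\<close>, but not those in the
    coordinates below \<open>i\<close>; by height one it is then graded in all the later coordinates.\<close>
  have graded_core: "graded_core \<delta> P = P"
  proof (rule ht)
    show "prime_in (mring M) (graded_core \<delta> P)" by (rule graded_core_prime[OF M(1) P(1) d])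
    show "graded_core \<delta> P \<subseteq> P" by (rule graded_core_subset[OF P(1)])
    obtain f where f: "f \<in> P" "f \<in> mring (N j)" "f \<noteq> 0" using j zk[of j] by auto
    have "part \<delta> \<gamma> f = (if \<gamma> = 0 then f else 0)" for \<gamma>
      using f(2) N_iff by (auto simp: mring_def intro!: restr_id restr_0)
    then have "f \<in> graded_core \<delta> P" using f(1) pD(2) by (simp add: graded_core_def)
    then show "graded_core \<delta> P \<noteq> {0}" using f(3) by auto
  qed
  have shift: "mon (- c) * f \<in> mring (N j)" if sh: "f \<in> mring M" "c \<in> keys f" "\<And>q. q \<in> keys f \<Longrightarrow> \<delta> q = \<gamma>"
    for c \<gamma> and f :: "'k laurent"
  proof -
    have "- c + q \<in> N j" if q: "q \<in> keys f" for q
    proof -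
      have "q \<in> M" "- c \<in> M" using q sh(1,2) M(2) by (auto simp: mring_def)
      then have "- c + q \<in> M" using M(1) by (auto simp: submonoid_def simp del: uminus_add_conv_diff)
      moreover have "\<delta> (- c + q) = 0"
        using sh(3)[OF q] sh(3)[OF sh(2)] by (simp add: additive_funD[OF d] del: uminus_add_conv_diff)
      ultimately show ?thesis by (simp add: N_iff)
    qed
    then show ?thesis by (auto simp: mring_def keys_mon_mult)
  qed
  \<comment> \<open>These are the admissible denominators: up to a monomial they involve only
    coordinates below \<open>i\<close>, where \<open>P\<close> contains nothing but 0.\<close>
  define hom where "hom = (\<lambda>s :: 'k laurent. s \<noteq> 0 \<and> s \<in> mring (N j) \<and> (\<exists>\<alpha>. \<forall>q\<in>keys s. deg q = \<alpha>))"
  have hom_notin: "s \<in> mring M - P" if "hom s" for s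
  proof -
    have s: "s \<noteq> 0" "s \<in> mring (N j)" "\<And>p q. p \<in> keys s \<Longrightarrow> q \<in> keys s \<Longrightarrow> deg p = deg q"
      using that by (auto simp: hom_def)
    have sM: "s \<in> mring M" using s(2) by (auto simp: mring_def N_def)
    obtain c where c: "c \<in> keys s" using s(1) by (meson all_not_in_conv keys_eq_empty)
    have "- c + q \<in> N i" if "q \<in> keys s" for q
      using Nsuc[of q c] s(2) s(3)[OF that c] that c by (auto simp: mring_def)
    then have "mon (- c) * s \<in> mring (N i)" by (auto simp: mring_def keys_mon_mult)
    moreover have "mon (- c) * s \<noteq> 0" using s(1) by simp
    ultimately have "mon (- c) * s \<notin> P" using Ni by blast
    moreover have "- c \<in> M" using c sM M(2) by (auto simp: mring_def)
    ultimately show ?thesis using pD(4)[of "mon (- c)" s] sM by auto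
  qed
  have hom_mult: "hom (s * t)" if "hom s" "hom t" for s t
  proof -
    have "submonoid (N j)" using M(1) by (auto simp: submonoid_def N_iff additive_funD[OF d])
    then have "s * t \<in> mring (N j)" using that is_subringD(4)[OF is_subring_mring] by (auto simp: hom_def)
    moreover obtain \<alpha> \<beta> where "\<forall>q\<in>keys s. deg q = \<alpha>" "\<forall>q\<in>keys t. deg q = \<beta>"
      using \<open>hom s\<close> \<open>hom t\<close> by (auto simp: hom_def)
    then have "\<forall>q\<in>keys (s * t). deg q = \<alpha> + \<beta>"
      by (auto simp: additive_funD[OF dg] elim!: keys_mult_elim)
    ultimately show ?thesis using that by (auto simp: hom_def)
  qed
  let ?F = "\<lambda>f. f \<in> P \<and> f \<in> mring (N j) \<and> f \<noteq> 0"
  obtain f0 where f0: "f0 \<in> P" "f0 \<in> mring (N j)" "f0 \<noteq> 0"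
    and f0_min: "\<And>f. ?F f \<Longrightarrow> width deg f0 \<le> width deg f"
  proof -
    have "\<exists>f. ?F f" using j zk[of j] by auto
    then show ?thesis using that ex_has_least_nat[of ?F _ "width deg"] by metis
  qed
  have f0M: "f0 \<in> mring M" using f0 pD(1) by blast
  \<comment> \<open>An element of width 0 is homogeneous in coordinate \<open>i\<close>, and such
    elements lie outside \<open>P\<close>.\<close>
  have f0_w: "0 < width deg f0"
  proof (rule ccontr)
    assume "\<not> ?thesis"
    then have w0: "width deg f0 = 0" by simp
    obtain c where "c \<in> keys f0" using f0(3) by (meson all_not_in_conv keys_eq_empty)
    then have "\<forall>q\<in>keys f0. deg q = deg c" using width_eq_0[OF w0] by blast
    then have "hom f0" using f0 unfolding hom_def by blast
    then show False using hom_notin f0(1) by blast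
  qed
  \<comment> \<open>Minimality was arranged inside \<open>mring (N j)\<close>. Since
    \<open>P\<close> is graded by \<open>\<delta>\<close>, any \<open>r\<close> in \<open>P\<close>
    has a nonzero component in \<open>P\<close>, and a monomial moves it into
    \<open>mring (N j)\<close> without changing its width.\<close>
  have f0_le: "width deg f0 \<le> width deg r" if r: "r \<in> P" "r \<noteq> 0" for r
  proof -
    obtain q where q: "q \<in> keys r" using r(2) by (meson all_not_in_conv keys_eq_empty)
    let ?r = "part \<delta> (\<delta> q) r"
    have rP: "?r \<in> P" using r(1) graded_core by (auto simp: graded_core_def)
    have q': "q \<in> keys ?r" using q by (simp add: keys_restr)
    then have nz: "?r \<noteq> 0" by auto
    have qM: "q \<in> M" using q r pD(1) by (auto simp: mring_def)
    have "mon (- q) * ?r \<in> mring (N j)"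
      by (rule shift[OF _ q']) (use rP pD(1) in \<open>auto simp: keys_restr\<close>)
    moreover have "mon (- q) * ?r \<in> P" using pD(4)[of "mon (- q)"] rP qM M(2) by simp
    moreover have "mon (- q) * ?r \<noteq> 0" using nz by simp
    ultimately have "width deg f0 \<le> width deg (mon (- q) * ?r)" using f0_min by blast
    also have "\<dots> = width deg (mon (- q) :: 'k laurent) + width deg ?r"
      using width_mult[OF dg _ nz, of "mon (- q)"] by simp
    also have "width deg (mon (- q) :: 'k laurent) = 0" by (rule width_eq_0I[where a = "deg (- q)"]) auto
    also have "width deg ?r \<le> width deg r" using nz by (intro width_mono) (auto simp: keys_restr)
    finally show ?thesis by simp
  qed
  \<comment> \<open>Pseudo-division by \<open>f0\<close> in coordinate \<open>i\<close>: the multipliers are homogeneous in that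
    coordinate, hence lie outside \<open>P\<close>.\<close>
  have divide: "\<exists>s q. hom s \<and> q \<in> mring M \<and> s * g = q * f0" if "g \<in> P" for g
    using that
  proof (induction "width deg g" arbitrary: g rule: less_induct)
    case less
    have hom1: "hom 1" using M(1) by (auto simp: hom_def mring_def N_def submonoid_def)
    have gM: "g \<in> mring M" using less.prems pD(1) by blast
    show ?case
    proof (cases "g = 0")
      case True
      then show ?thesis using hom1 sD(2) by (intro exI[of _ 1] exI[of _ 0]) auto
    next
      case g: False
      let ?a = "top_deg deg f0" and ?b = "top_deg deg g"
      let ?a' = "top_deg (\<lambda>q. - deg q) f0" and ?b' = "top_deg (\<lambda>q. - deg q) g"
      define ft where "ft = part deg ?a f0"
      define gt where "gt = part deg ?b g"
      \<comment> \<open>Both products have the component \<open>ft * gt\<close> in degree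
        \<open>?a + ?b\<close>, so the difference loses its top degree.\<close>
      define g' where "g' = ft * g - gt * f0"
      have ft: "hom ft" using f0 top_part_nz[OF f0(3)]
        unfolding hom_def ft_def by (simp add: restr_in_mring keys_restr)
      have ftM: "ft \<in> mring M" using hom_notin[OF ft] by blast
      have gt: "gt \<in> mring M" using gM by (simp add: gt_def restr_in_mring)
      have g'P: "g' \<in> P" unfolding g'_def
        using less.prems f0(1) ftM gt by (intro prime_in_diff[OF sr P(1)] pD(4))
      have eq: "ft * g = gt * f0 + g'" by (simp add: g'_def)
      show ?thesis
      proof (cases "g' = 0")
        case True
        then show ?thesis using ft gt eq by (intro exI[of _ ft] exI[of _ gt]) simp
      next
        case nz: False
        have w: "width deg f0 \<le> width deg g" by (rule f0_le[OF less.prems g])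
        have wf: "int (width deg f0) = ?a + ?a'" and wg: "int (width deg g) = ?b + ?b'"
          using width_nonneg[OF f0(3), of deg] width_nonneg[OF g, of deg] by (simp_all add: width_def)
        \<comment> \<open>The lower end must not drop either: \<open>gt * f0\<close> reaches no
          lower than \<open>ft * g\<close> can, because \<open>f0\<close> is not wider than
          \<open>g\<close>.\<close>
        have keys: "deg q \<le> ?a + ?b - 1 \<and> - deg q \<le> ?b' - ?a" if q: "q \<in> keys g'" for q
        proof -
          have "part deg (?a + ?b) g' = part deg (?a + ?b) (ft * g) - part deg (?a + ?b) (gt * f0)"
            by (simp add: g'_def restr_diff)
          also have "part deg (?a + ?b) (ft * g) = ft * gt"
            unfolding gt_def using part_mult_homogeneous[OF dg, of ft ?a "?a + ?b" g]
            by (simp add: ft_def keys_restr)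
          also have "part deg (?a + ?b) (gt * f0) = gt * ft"
            unfolding ft_def using part_mult_homogeneous[OF dg, of gt ?b "?a + ?b" f0]
            by (simp add: gt_def keys_restr)
          finally have "part deg (?a + ?b) g' = 0" by (simp add: mult.commute)
          then have "deg q \<noteq> ?a + ?b" using q unfolding keys_eq_empty[symmetric] keys_restr by auto
          moreover have "deg q \<le> ?a + ?b \<and> - deg q \<le> ?b' - ?a"
            using keys_minus_elim[OF q[unfolded g'_def]]
          proof
            assume "q \<in> keys (ft * g)"
            then obtain x y where xy: "x \<in> keys ft" "y \<in> keys g" "q = x + y"
              by (rule keys_mult_elim)
            then have "deg q = ?a + deg y" by (simp add: ft_def keys_restr additive_funD[OF dg])
            then show ?thesis
              using top_deg_ge[OF xy(2), of deg] top_deg_ge[OF xy(2), of "\<lambda>q. - deg q"] by linarith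
          next
            assume "q \<in> keys (gt * f0)"
            then obtain x y where xy: "x \<in> keys gt" "y \<in> keys f0" "q = x + y"
              by (rule keys_mult_elim)
            then have "deg q = ?b + deg y" by (simp add: gt_def keys_restr additive_funD[OF dg])
            then show ?thesis
              using top_deg_ge[OF xy(2), of deg] top_deg_ge[OF xy(2), of "\<lambda>q. - deg q"] w wf wg by linarith
          qed
          ultimately show ?thesis by linarith
        qed
        have "top_deg deg g' \<le> ?a + ?b - 1" "top_deg (\<lambda>q. - deg q) g' \<le> ?b' - ?a"
          by (rule top_deg_le[OF nz]; use keys in blast)+
        then have "width deg g' < width deg g" using wg w wf f0_w by (simp add: width_def)
        then obtain s q where sq: "hom s" "q \<in> mring M" "s * g' = q * f0" using less.hyps g'P by blast
        have sM: "s \<in> mring M" using hom_notin[OF sq(1)] by blast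
        have "(s * ft) * g = s * (ft * g)" by (simp add: mult.assoc)
        also have "\<dots> = s * gt * f0 + s * g'" by (simp only: eq distrib_left mult.assoc)
        also have "\<dots> = (q + s * gt) * f0" by (simp only: sq(3) distrib_right add.commute)
        finally have "(s * ft) * g = (q + s * gt) * f0" .
        moreover have "q + s * gt \<in> mring M" by (rule sD(6)[OF sq(2) sD(4)[OF sM gt]])
        ultimately show ?thesis using hom_mult[OF sq(1) ft] by blast
      qed
    qed
  qed
  \<comment> \<open>Each division by \<open>f0\<close> lowers the width by that of
    \<open>f0\<close>, which is positive, so after finitely many divisions the quotient leaves
    \<open>P\<close>.\<close>
  have "\<exists>m. \<exists>s\<in>mring M - P. \<exists>u\<in>mring M - P. s * f = u * f0 ^ m" if "f \<in> mring M" "f \<noteq> 0" for f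
    using that
  proof (induction "width deg f" arbitrary: f rule: less_induct)
    case (less f)
    show ?case
    proof (cases "f \<in> P")
      case False
      then show ?thesis using less.prems sD(1) pD(6) by (intro exI[of _ 0] bexI[of _ 1] bexI[of _ f]) auto
    next
      case True
      then obtain s q where sq: "hom s" "q \<in> mring M" "s * f = q * f0" using divide by blast
      have s: "s \<noteq> 0" "s \<in> mring M - P" using hom_notin[OF sq(1)] sq(1) by (auto simp: hom_def)
      have q: "q \<noteq> 0" using sq(3) s(1) less.prems by auto
      have "width deg s + width deg f = width deg q + width deg f0"
        using width_mult[OF dg s(1) less.prems(2)] width_mult[OF dg q f0(3)] sq(3) by simp
      moreover have "width deg s = 0"
        using sq(1) width_eq_0I unfolding hom_def by blast
      ultimately have "width deg q < width deg f" using f0_w by simp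
      then obtain m t u where h: "t \<in> mring M - P" "u \<in> mring M - P" "t * q = u * f0 ^ m"
        using less.hyps sq(2) q by blast
      have "(t * s) * f = t * (s * f)" by (simp add: mult.assoc)
      also have "\<dots> = (t * q) * f0" by (simp add: sq(3) mult.assoc)
      also have "\<dots> = u * f0 ^ Suc m" by (simp only: h(3) power_Suc mult.assoc mult.commute[of f0])
      finally have "(t * s) * f = u * f0 ^ Suc m" .
      moreover have "t * s \<in> mring M - P" using h(1) s(2) sD(4)[of t s] pD(7)[of t s] by blast
      ultimately show ?thesis using h(2) by blast
    qed
  qed
  then show ?thesis using f0 by blast
qed

section \<open>Inverting all monomials\<close>

definition diffs :: "'b::ab_group_add set \<Rightarrow> 'b set" where
  "diffs S = {p - q | p q. p \<in> S \<and> q \<in> S}"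

lemma diffs_submonoid:
  assumes "submonoid S"
  shows "submonoid (diffs S)" "q \<in> diffs S \<Longrightarrow> - q \<in> diffs S" "S \<subseteq> diffs S"
proof -
  have add: "x + y \<in> diffs S" if "x \<in> diffs S" "y \<in> diffs S" for x y
  proof -
    obtain a b c d where h: "a \<in> S" "b \<in> S" "x = a - b" "c \<in> S" "d \<in> S" "y = c - d"
      using \<open>x \<in> _\<close> \<open>y \<in> _\<close> unfolding diffs_def by blast
    have "x + y = (a + c) - (b + d)" using h by simp
    moreover have "a + c \<in> S" "b + d \<in> S" using assms h by (auto simp: submonoid_def)
    ultimately show ?thesis unfolding diffs_def by blast
  qed
  show sub: "S \<subseteq> diffs S"
  proof
    fix x assume "x \<in> S"
    moreover have "x = x - 0" by simp
    ultimately show "x \<in> diffs S" using assms unfolding diffs_def submonoid_def by blast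
  qed
  show "submonoid (diffs S)" using add sub assms by (auto simp: submonoid_def)
  show "- q \<in> diffs S" if q: "q \<in> diffs S"
  proof -
    obtain a b where "a \<in> S" "b \<in> S" "q = a - b" using q unfolding diffs_def by blast
    moreover have "- (a - b) = b - a" by simp
    ultimately show ?thesis unfolding diffs_def by blast
  qed
qed

lemma diffs_closed_diff:
  assumes "submonoid S" "x \<in> diffs S" "y \<in> diffs S" shows "x - y \<in> diffs S" "x + y \<in> diffs S"
proof -
  note D = diffs_submonoid[OF assms(1)]
  show "x + y \<in> diffs S" using D(1) assms by (auto simp: submonoid_def)
  have "x + (- y) \<in> diffs S" using D(1) D(2)[OF assms(3)] assms unfolding submonoid_def by blast
  then show "x - y \<in> diffs S" by simp
qed

text \<open>Each \<open>k\<close> is a difference \<open>p - q\<close> in \<open>S\<close>; the sum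
  of all the subtracted \<open>q\<close> works for every \<open>k\<close>.\<close>

lemma common_denominator:
  assumes S: "submonoid S" and K: "finite K" "K \<subseteq> diffs S"
  shows "\<exists>h\<in>S. \<forall>k\<in>K. h + k \<in> S"
  using K
proof (induction K)
  case empty
  then show ?case using S by (auto simp: submonoid_def)
next
  case (insert k K)
  then obtain h where h: "h \<in> S" "\<forall>k\<in>K. h + k \<in> S" by auto
  obtain p q where pq: "p \<in> S" "q \<in> S" "k = p - q" using insert.prems unfolding diffs_def by blast
  have "q + h + k \<in> S" using pq h S by (simp add: submonoid_def)
  moreover have "q + h + k' \<in> S" if "k' \<in> K" for k'
    using pq h S that by (simp add: submonoid_def add.assoc)
  moreover have "q + h \<in> S" using pq h S by (simp add: submonoid_def)
  ultimately show ?case by blast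
qed

lemma clear_denominator:
  fixes f :: "'b::ab_group_add \<Rightarrow>\<^sub>0 'k::comm_ring_1"
  assumes "submonoid S" "f \<in> mring (diffs S)" shows "\<exists>h\<in>S. mon h * f \<in> mring S"
  using common_denominator[OF assms(1), of "keys f"] assms(2)
  by (auto simp: mring_def keys_mon_mult)

lemma prime_in_restrict:
  assumes B: "is_subring B" "B \<subseteq> A" and P: "prime_in A P"
  shows "prime_in B (P \<inter> B)"
  unfolding prime_in_def
proof (intro conjI ballI impI)
  note d = is_subringD[OF B(1)] and p = prime_inD[OF P]
  show "P \<inter> B \<subseteq> B" "0 \<in> P \<inter> B" "1 \<notin> P \<inter> B" using d(2) p(2,6) by auto
  show "x + y \<in> P \<inter> B" if "x \<in> P \<inter> B" "y \<in> P \<inter> B" for x y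
    using that d(6)[of x y] p(3)[of x y] by blast
  show "a * x \<in> P \<inter> B" if "a \<in> B" "x \<in> P \<inter> B" for a x
    using that d(4)[of a x] p(4)[of a x] B(2) by blast
  show "a \<in> P \<inter> B \<or> b \<in> P \<inter> B" if "a \<in> B" "b \<in> B" "a * b \<in> P \<inter> B" for a b
    using that p(7)[of a b] B(2) by blast
qed

text \<open>Monomials are outside \<open>P\<close>, so they may be inverted without changing the
  localization at \<open>P\<close>. The extension \<open>Pe\<close> still has height one, and the
  equations from \<open>laurent_dvr\<close> are cleared of negative exponents by further
  monomials.\<close>

lemma dvr_no_monomials:
  fixes P :: "'k::field laurent set"
  assumes Q: "submonoid Q"
    and fin: "\<And>q. q \<in> Q \<Longrightarrow> keys q \<subseteq> {..<n}"
    and P: "prime_in (mring Q) P" "P \<noteq> {0}"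
    and nomon: "\<And>q. q \<in> Q \<Longrightarrow> mon q \<notin> P"
    and ht: "\<And>I. prime_in (mring Q) I \<Longrightarrow> I \<subseteq> P \<Longrightarrow> I \<noteq> {0} \<Longrightarrow> I = P"
  shows "\<exists>p\<in>P. p \<noteq> 0 \<and>
    (\<forall>f\<in>mring Q. f \<noteq> 0 \<longrightarrow> (\<exists>m. \<exists>s\<in>mring Q - P. \<exists>u\<in>mring Q - P. s * f = u * p ^ m))"
proof -
  let ?M = "diffs Q"
  note pD = prime_inD[OF P(1)]
  have Q0: "0 \<in> Q" and Qadd: "\<And>x y. x \<in> Q \<Longrightarrow> y \<in> Q \<Longrightarrow> x + y \<in> Q" using Q by (auto simp: submonoid_def)
  note M = diffs_submonoid[OF Q]
  note sQ = is_subringD[OF is_subring_mring[OF Q]]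
  note sM = is_subringD[OF is_subring_mring[OF M(1)]]
  have QM: "mring Q \<subseteq> mring ?M" using M(3) by (auto simp: mring_def)
  have cancel: "f \<in> P" if "mon q * f \<in> P" "q \<in> Q" "f \<in> mring Q" for q f
    using pD(7)[of "mon q" f] that nomon by auto
  define Pe where "Pe = {g \<in> mring ?M. \<exists>q\<in>Q. mon q * g \<in> P}"
  have Pe_iff: "f \<in> Pe \<longleftrightarrow> f \<in> P" if "f \<in> mring Q" for f
  proof
    assume "f \<in> P"
    then have "mon 0 * f \<in> P" by simp
    then show "f \<in> Pe" using that QM Q0 unfolding Pe_def by blast
  qed (use that cancel in \<open>auto simp: Pe_def\<close>)
  have Pe_shift: "mon q * g \<in> Pe \<longleftrightarrow> g \<in> Pe" if "q \<in> Q" "g \<in> mring ?M" for q g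
  proof
    assume "mon q * g \<in> Pe"
    then obtain r where r: "r \<in> Q" "mon r * (mon q * g) \<in> P" by (auto simp: Pe_def)
    then have "mon (r + q) * g \<in> P" by (simp add: mon_mon_mult)
    then show "g \<in> Pe" using that Qadd[OF r(1) that(1)] unfolding Pe_def by blast
  next
    assume "g \<in> Pe"
    then obtain r where r: "r \<in> Q" "mon r * g \<in> P" by (auto simp: Pe_def)
    have "mon r * (mon q * g) = mon q * (mon r * g)" by (simp add: ac_simps)
    also have "\<dots> \<in> P" using pD(4)[of "mon q" "mon r * g"] r that by simp
    finally show "mon q * g \<in> Pe" using r that M(3) sM(4)[of "mon q" g] by (auto simp: Pe_def)
  qed
  have clear: "\<exists>q\<in>Q. mon q * g \<in> mring Q" if "g \<in> mring ?M" for g :: "'k laurent"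
    by (rule clear_denominator[OF Q that])
  have clear2: "\<exists>q\<in>Q. mon q * g \<in> mring Q \<and> mon q * h \<in> mring Q" if gh: "g \<in> mring ?M" "h \<in> mring ?M"
    for g h :: "'k laurent"
  proof -
    obtain q r where qr: "q \<in> Q" "mon q * g \<in> mring Q" "r \<in> Q" "mon r * h \<in> mring Q"
      using clear gh by meson
    have "mon (r + q) * g \<in> mring Q"
      using sQ(4)[of "mon r" "mon q * g"] qr by (simp only: mon_mon_mult mon_in_mring simp_thms)
    moreover have "mon (r + q) * h \<in> mring Q"
      using sQ(4)[of "mon q" "mon r * h"] qr by (simp only: mon_mon_mult mon_in_mring simp_thms add.commute)
    ultimately show ?thesis using Qadd qr by blast
  qed
  have prime: "prime_in (mring ?M) Pe"
    unfolding prime_in_def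
  proof (intro conjI ballI impI)
    show "Pe \<subseteq> mring ?M" by (auto simp: Pe_def)
    show "0 \<in> Pe" using pD(2) sM(2) Q0 by (auto simp: Pe_def)
    show "1 \<notin> Pe" using Pe_iff[OF sQ(1)] pD(6) by simp
    fix x y assume xy: "x \<in> Pe" "y \<in> Pe"
    then obtain q r where qr: "q \<in> Q" "mon q * x \<in> P" "r \<in> Q" "mon r * y \<in> P" by (auto simp: Pe_def)
    have "mon (q + r) * (x + y) = mon r * (mon q * x) + mon q * (mon r * y)"
      by (simp add: distrib_left mon_mon_mult add.commute)
    also have "\<dots> \<in> P" using pD(3)[OF pD(4)[of "mon r" "mon q * x"] pD(4)[of "mon q" "mon r * y"]] qr by simp
    finally show "x + y \<in> Pe" using xy qr Qadd sM(6) by (auto simp: Pe_def)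
  next
    fix a x :: "'k laurent" assume ax: "a \<in> mring ?M" "x \<in> Pe"
    then obtain q r where qr: "q \<in> Q" "mon q * a \<in> mring Q" "r \<in> Q" "mon r * x \<in> P"
      using clear[OF ax(1)] unfolding Pe_def by blast
    have "(mon (q + r) :: 'k laurent) = mon q * mon r" by (simp add: mult_single)
    then have "mon (q + r) * (a * x) = (mon q * a) * (mon r * x)" by (simp only: ac_simps)
    also have "\<dots> \<in> P" using pD(4)[of "mon q * a" "mon r * x"] qr by simp
    finally show "a * x \<in> Pe" using ax qr Qadd sM(4) by (auto simp: Pe_def)
  next
    fix a b :: "'k laurent" assume ab: "a \<in> mring ?M" "b \<in> mring ?M" "a * b \<in> Pe"
    then obtain q where q: "q \<in> Q" "mon q * a \<in> mring Q" "mon q * b \<in> mring Q" using clear2 by blast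
    have abM: "a * b \<in> mring ?M" by (rule sM(4)[OF ab(1,2)])
    have "mon q * (mon q * (a * b)) \<in> Pe"
      using Pe_shift[OF q(1) abM] Pe_shift[OF q(1) sM(4)[OF _ abM], of "mon q"] ab(3) q(1) M(3) by auto
    moreover have "mon q * (mon q * (a * b)) = (mon q * a) * (mon q * b)" by (simp only: ac_simps)
    ultimately have "(mon q * a) * (mon q * b) \<in> Pe" by simp
    then have "(mon q * a) * (mon q * b) \<in> P" using Pe_iff q sQ(4) by blast
    then have "mon q * a \<in> P \<or> mon q * b \<in> P" using pD(7) q by blast
    then show "a \<in> Pe \<or> b \<in> Pe" using q ab by (auto simp: Pe_def)
  qed
  have "P \<subseteq> Pe" using Pe_iff pD(1) by blast
  then have "Pe \<noteq> {0}" using P(2) pD(2) by blast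
  \<comment> \<open>Height one passes to \<open>Pe\<close>: every element enters
    \<open>mring Q\<close> after multiplication by a monomial, so a nonzero prime inside
    \<open>Pe\<close> contracts to a nonzero prime inside \<open>P\<close>.\<close>
  moreover have "I = Pe" if I: "prime_in (mring ?M) I" "I \<subseteq> Pe" "I \<noteq> {0}" for I
  proof -
    note iD = prime_inD[OF I(1)]
    have unit: "g \<in> I" if "mon q * g \<in> I" "q \<in> Q" "g \<in> mring ?M" for q g
      using iD(4)[of "mon (- q)" "mon q * g"] that(1,2) M(2,3) by (auto simp: mon_mon_mult)
    have "prime_in (mring Q) (I \<inter> mring Q)"
      by (rule prime_in_restrict[OF is_subring_mring[OF Q] QM I(1)])
    moreover have "I \<inter> mring Q \<subseteq> P" using I(2) Pe_iff by blast
    moreover have "I \<inter> mring Q \<noteq> {0}"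
    proof -
      obtain g where g: "g \<in> I" "g \<noteq> 0" using I(3) iD(2) by blast
      then obtain q where q: "q \<in> Q" "mon q * g \<in> mring Q" using clear iD(1) by blast
      moreover have "mon q * g \<in> I" using g q M(3) by (intro iD(4)) auto
      moreover have "mon q * g \<noteq> 0" using g by simp
      ultimately show ?thesis by blast
    qed
    ultimately have e: "I \<inter> mring Q = P" by (rule ht)
    have "Pe \<subseteq> I"
    proof
      fix g assume g: "g \<in> Pe"
      then obtain q where "q \<in> Q" "mon q * g \<in> P" by (auto simp: Pe_def)
      then show "g \<in> I" using e unit[of q g] g by (auto simp: Pe_def)
    qed
    then show ?thesis using I(2) by blast
  qed
  moreover have "keys q \<subseteq> {..<n}" if "q \<in> ?M" for q
  proof -
    obtain a b where "a \<in> Q" "b \<in> Q" "q = a - b" using \<open>q \<in> ?M\<close> unfolding diffs_def by blast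
    then show ?thesis using fin[of a] fin[of b] keys_minus_elim[of _ a b] by blast
  qed
  ultimately obtain p where p: "p \<in> Pe" "p \<noteq> 0"
    and D: "\<And>f. f \<in> mring ?M \<Longrightarrow> f \<noteq> 0 \<Longrightarrow> \<exists>m. \<exists>s\<in>mring ?M - Pe. \<exists>u\<in>mring ?M - Pe. s * f = u * p ^ m"
    using laurent_dvr[OF M(1,2) _ prime, of n] by blast
  obtain r where r: "r \<in> Q" "mon r * p \<in> P" using p(1) by (auto simp: Pe_def)
  have pM: "p \<in> mring ?M" using p(1) by (auto simp: Pe_def)
  have "\<exists>m. \<exists>s\<in>mring Q - P. \<exists>u\<in>mring Q - P. s * f = u * (mon r * p) ^ m" if f: "f \<in> mring Q" "f \<noteq> 0" for f
  proof -
    obtain m s u where h: "s \<in> mring ?M - Pe" "u \<in> mring ?M - Pe" "s * f = u * p ^ m"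
      using D[OF _ f(2)] f(1) QM by blast
    obtain q where q: "q \<in> Q" "mon q * s \<in> mring Q" "mon q * u \<in> mring Q" using clear2 h by blast
    \<comment> \<open>Replacing \<open>p\<close> by \<open>mon r * p\<close> adds the factor
      \<open>mon r ^ m\<close> on the right; \<open>c\<close> adds it on the left and is outside
      \<open>P\<close>.\<close>
    define c :: "'k laurent" where "c = mon r ^ m"
    have "mon q * s \<in> mring Q - P" "mon q * u \<in> mring Q - P"
      using q h Pe_iff Pe_shift by auto
    moreover have "c \<in> mring Q" unfolding c_def using r(1) by (intro sQ(7)) simp
    moreover have "c \<notin> P" unfolding c_def
      using prime_in_power[OF is_subring_mring[OF Q] P(1), of "mon r" m] nomon r(1) by auto
    ultimately have "c * (mon q * s) \<in> mring Q - P" "mon q * u \<in> mring Q - P"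
      using sQ(4) pD(7)[of c "mon q * s"] by auto
    moreover have "(c * (mon q * s)) * f = (mon q * u) * (mon r * p) ^ m"
    proof -
      have "(c * (mon q * s)) * f = c * mon q * (s * f)" by (simp only: ac_simps)
      also have "\<dots> = c * mon q * (u * p ^ m)" by (simp only: h(3))
      also have "\<dots> = (mon q * u) * (mon r * p) ^ m"
        by (simp only: c_def power_mult_distrib ac_simps)
      finally show ?thesis .
    qed
    ultimately show ?thesis by blast
  qed
  then show ?thesis using r p(2) by (intro bexI[of _ "mon r * p"]) auto
qed

subsection \<open>Farkas' lemma\<close>

definition dot :: "'a set \<Rightarrow> ('a \<Rightarrow> rat) \<Rightarrow> ('a \<Rightarrow> rat) \<Rightarrow> rat" where
  "dot V x y = (\<Sum>i\<in>V. x i * y i)"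

lemma dot_linear:
  "dot V (\<lambda>i. a * x i + b * y i) z = a * dot V x z + b * dot V y z"
  "dot V z (\<lambda>i. a * x i + b * y i) = a * dot V z x + b * dot V z y"
  by (simp_all add: dot_def sum.distrib sum_distrib_left algebra_simps)

text \<open>
  When a functional separates \<open>c\<close> from all vectors but the last vector \<open>w\<close>, project along \<open>w\<close>
  onto its kernel and apply the induction hypothesis again.
\<close>

lemma farkas_list:
  fixes vs :: "('a \<Rightarrow> rat) list"
  assumes "finite V"
  shows "(\<exists>y. (\<forall>v\<in>set vs. 0 \<le> dot V y v) \<and> dot V y c < 0) \<or>
    (\<exists>a. (\<forall>k<length vs. 0 \<le> a k) \<and> (\<forall>i\<in>V. c i = (\<Sum>k<length vs. a k * (vs ! k) i)))"
proof (induction "length vs" arbitrary: vs c)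
  case 0
  then show ?case
  proof (cases "\<forall>i\<in>V. c i = 0")
    case False
    then obtain i where i: "i \<in> V" "c i \<noteq> 0" by blast
    have "0 < (\<Sum>i\<in>V. c i * c i)"
      using i \<open>finite V\<close> by (intro sum_pos2[of V i]) (auto simp: zero_less_mult_iff)
    then have "dot V (\<lambda>i. - c i) c < 0" by (simp add: dot_def sum_negf)
    then show ?thesis using 0 by auto
  qed simp
next
  case (Suc n ws)
  then obtain vs w where ws: "ws = vs @ [w]" "n = length vs"
    by (cases ws rule: rev_cases) auto
  note IH = Suc.hyps(1)[unfolded ws(2)]
  let ?cone = "\<lambda>us (c :: 'a \<Rightarrow> rat). \<exists>a. (\<forall>k<length us. 0 \<le> a k) \<and> (\<forall>i\<in>V. c i = (\<Sum>k<length us. a k * (us ! k) i))"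
  have snoc: "?cone (vs @ [w]) c"
    if "\<forall>k<length vs. 0 \<le> a k" "0 \<le> b" "\<And>i. i \<in> V \<Longrightarrow> c i = (\<Sum>k<length vs. a k * (vs ! k) i) + b * w i"
    for a and b :: rat and c
    by (rule exI[of _ "a(length vs := b)"]) (use that in \<open>auto simp: nth_append less_Suc_eq\<close>)
  have "(\<exists>y. (\<forall>v\<in>set (vs @ [w]). 0 \<le> dot V y v) \<and> dot V y c < 0) \<or> ?cone (vs @ [w]) c"
  proof (cases "?cone vs c")
    case True
    then obtain a :: "nat \<Rightarrow> rat" where a: "\<forall>k<length vs. 0 \<le> a k" "\<forall>i\<in>V. c i = (\<Sum>k<length vs. a k * (vs ! k) i)" by blast
    have "?cone (vs @ [w]) c"
      using snoc[of a 0 c] a by simp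
    then show ?thesis by blast
  next
    case nc: False
    obtain y where y: "\<forall>v\<in>set vs. 0 \<le> dot V y v" "dot V y c < 0" using IH[of vs c] nc by blast
    show ?thesis
    proof (cases "0 \<le> dot V y w")
      case True
      then show ?thesis using y by auto
    next
      case False
      then have yw: "dot V y w < 0" by simp
      \<comment> \<open>\<open>r v\<close> is chosen so that \<open>v - r v * w\<close> lies in the
        kernel of \<open>y\<close>. The signs \<open>r v \<le> 0\<close> on the list and
        \<open>r c > 0\<close> are what make the first case below work.\<close>
      define r where "r = (\<lambda>v. dot V y v / dot V y w)"
      define vs' where "vs' = map (\<lambda>v i. v i - r v * w i) vs"
      define c' where "c' = (\<lambda>i. c i - r c * w i)"
      have len: "length vs' = length vs" by (simp add: vs'_def)
      have rv: "r v \<le> 0" if "v \<in> set vs" for v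
        using y(1) yw that by (simp add: r_def divide_nonneg_neg)
      have rc: "0 < r c" using y(2) yw by (simp add: r_def divide_neg_neg)
      consider (cone) "?cone vs' c'" | (func) z where "\<forall>v\<in>set vs'. 0 \<le> dot V z v" "dot V z c' < 0"
      proof -
        have "(\<exists>y. (\<forall>v\<in>set vs'. 0 \<le> dot V y v) \<and> dot V y c' < 0) \<or> ?cone vs' c'"
          by (rule IH) (simp add: vs'_def)
        then show thesis using that by blast
      qed
      then show ?thesis
      proof cases
        case cone
        then obtain a :: "nat \<Rightarrow> rat" where a: "\<forall>k<length vs. 0 \<le> a k" "\<forall>i\<in>V. c' i = (\<Sum>k<length vs. a k * (vs' ! k) i)"
          unfolding len by blast
        \<comment> \<open>The total coefficient that \<open>w\<close> receives when the projections
          are undone.\<close>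
        define b where "b = r c - (\<Sum>k<length vs. a k * r (vs ! k))"
        have "b \<ge> 0" unfolding b_def
        proof -
          have "(\<Sum>k<length vs. a k * r (vs ! k)) \<le> 0"
            using a(1) rv by (intro sum_nonpos mult_nonneg_nonpos) auto
          then show "0 \<le> r c - (\<Sum>k<length vs. a k * r (vs ! k))" using rc by linarith
        qed
        moreover have "c i = (\<Sum>k<length vs. a k * (vs ! k) i) + b * w i" if "i \<in> V" for i
        proof -
          have "c i = c' i + r c * w i" by (simp add: c'_def)
          also have "c' i = (\<Sum>k<length vs. a k * ((vs ! k) i - r (vs ! k) * w i))"
            using a(2) that by (simp add: vs'_def)
          also have "\<dots> = (\<Sum>k<length vs. a k * (vs ! k) i) - (\<Sum>k<length vs. a k * r (vs ! k)) * w i"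
            by (simp add: right_diff_distrib sum_subtractf sum_distrib_right mult.assoc)
          finally show ?thesis by (simp add: b_def algebra_simps)
        qed
        ultimately have "?cone (vs @ [w]) c"
          using snoc[of a b c] a by blast
        then show ?thesis by blast
      next
        case func
        \<comment> \<open>With this \<open>t\<close> the functional \<open>z'\<close> kills
          \<open>w\<close>, and on any vector it takes the value of \<open>z\<close> at the
          projection.\<close>
        define t where "t = dot V z w / dot V y w"
        define z' where "z' = (\<lambda>i. 1 * z i + (- t) * y i)"
        have z': "dot V z' v = dot V z (\<lambda>i. v i - r v * w i)" for v
        proof -
          have "dot V z (\<lambda>i. 1 * v i + (- r v) * w i) = dot V z v - r v * dot V z w"
            by (subst dot_linear) simp
          moreover have "dot V z' v = dot V z v - t * dot V y v"
            unfolding z'_def by (subst dot_linear) simp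
          moreover have "r v * dot V z w = t * dot V y v" by (simp add: r_def t_def)
          ultimately show ?thesis by simp
        qed
        have "dot V z' w = 0" unfolding z' using yw by (simp add: r_def dot_def)
        then have "\<forall>v\<in>set (vs @ [w]). 0 \<le> dot V z' v" using func(1) by (auto simp: z' vs'_def)
        moreover have "dot V z' c < 0" using func(2) by (simp add: z' c'_def)
        ultimately show ?thesis by blast
      qed
    qed
  qed
  then show ?case by (simp only: ws(1))
qed

subsection \<open>The lattice spanned by a subgraph\<close>

definition comp_edges :: "nat set set \<Rightarrow> nat set \<Rightarrow> nat set set" where
  "comp_edges F C = {e \<in> F. e \<subseteq> C}"

definition reach :: "nat \<Rightarrow> nat set set \<Rightarrow> nat \<Rightarrow> nat set" where
  "reach n F u = {v \<in> {1..n}. (adj F)\<^sup>*\<^sup>* u v}"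

lemma adj_sym: "adj F u v \<Longrightarrow> adj F v u"
  by (simp add: adj_def insert_commute)

lemma adj_step: "{a, b} \<in> F \<Longrightarrow> (adj F)\<^sup>*\<^sup>* r a \<Longrightarrow> (adj F)\<^sup>*\<^sup>* r b"
  by (erule rtranclp.rtrancl_into_rtrancl) (simp add: adj_def)

lemma adj_rtranclp_sym: "(adj F)\<^sup>*\<^sup>* u v \<Longrightarrow> (adj F)\<^sup>*\<^sup>* v u"
  by (induction rule: rtranclp_induct) (auto intro: adj_sym converse_rtranclp_into_rtranclp)

lemma vcomps_eq: "vcomps n F = reach n F ` {1..n}"
  by (auto simp: vcomps_def quotient_def reach_def)

lemma reach_eq:
  assumes "v \<in> reach n F u" shows "reach n F v = reach n F u"
  using assms adj_rtranclp_sym unfolding reach_def by (auto intro: rtranclp_trans)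

lemma vcomps_eqI:
  assumes "C \<in> vcomps n F" "D \<in> vcomps n F" "v \<in> C" "v \<in> D" shows "C = D"
  using assms reach_eq unfolding vcomps_eq by blast

lemma vcomps_reach: "C \<in> vcomps n F \<Longrightarrow> v \<in> C \<Longrightarrow> C = reach n F v"
  using reach_eq unfolding vcomps_eq by blast

lemma vcomps_sub: "C \<in> vcomps n F \<Longrightarrow> C \<subseteq> {1..n}"
  by (auto simp: vcomps_eq reach_def)

lemma vcomps_nonempty: "C \<in> vcomps n F \<Longrightarrow> \<exists>v. v \<in> C"
  by (auto simp: vcomps_eq reach_def intro: rtranclp.rtrancl_refl)

lemma mem_reach_self: "v \<in> {1..n} \<Longrightarrow> v \<in> reach n F v"
  by (simp add: reach_def)

lemma finite_vcomps: "finite (vcomps n F)"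
  by (simp add: vcomps_eq)

lemma components_eq: "components n F = (\<lambda>C. (C, comp_edges F C)) ` vcomps n F"
  by (auto simp: components_def comp_edges_def)

lemma ncomp_eq: "ncomp n F = card (vcomps n F)"
  unfolding ncomp_def components_eq by (rule card_image) (simp add: inj_on_def)

lemma bicomp_eq: "bicomp n F = card {C \<in> vcomps n F. bipartite (C, comp_edges F C)}"
proof -
  have "{X \<in> components n F. bipartite X} = (\<lambda>C. (C, comp_edges F C)) ` {C \<in> vcomps n F. bipartite (C, comp_edges F C)}"
    by (auto simp: components_eq)
  then show ?thesis unfolding bicomp_def by (simp add: card_image inj_on_def)
qed

lemma vcomps_induct:
  assumes C: "C \<in> vcomps n F" and r: "r \<in> C" and v: "v \<in> C"
    and F: "\<And>e. e \<in> F \<Longrightarrow> e \<subseteq> {1..n}"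
    and base: "P r" and step: "\<And>a b. a \<in> C \<Longrightarrow> b \<in> C \<Longrightarrow> {a, b} \<in> F \<Longrightarrow> P a \<Longrightarrow> P b"
  shows "P v"
proof -
  have "(adj F)\<^sup>*\<^sup>* r v" using v vcomps_reach[OF C r] by (simp add: reach_def)
  then have "P v \<and> v \<in> C"
  proof (induction rule: rtranclp_induct)
    case base
    then show ?case using assms by simp
  next
    case (step a b)
    have e: "{a, b} \<in> F" using step.hyps by (simp add: adj_def)
    then have "b \<in> reach n F a" using F[OF e] by (auto simp: reach_def adj_def)
    then have "b \<in> C" using vcomps_reach[OF C, of a] step.IH by simp
    then show ?case using step.IH e assms(6)[of a b] by simp
  qed
  then show ?thesis ..
qed

text \<open>The coefficient ring is left open: rational functionals come from Farkas' lemma,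
  integral ones give signs and parities.\<close>

definition val :: "nat \<Rightarrow> (nat \<Rightarrow> 'c::comm_ring_1) \<Rightarrow> (nat \<Rightarrow>\<^sub>0 int) \<Rightarrow> 'c" where
  "val n y q = (\<Sum>i\<in>{1..n}. y i * of_int (lookup q i))"

lemma additive_val: "additive_fun (val n y)"
  by (simp add: additive_fun_def val_def lookup_add algebra_simps sum.distrib)

lemma val_of_int: "val n (\<lambda>i. of_int (y i)) q = of_int (val n y q)"
  by (simp add: val_def)

lemma val_add: "val n (\<lambda>i. a * y i + b * z i) q = a * val n y q + b * val n z q"
  by (simp add: val_def sum.distrib sum_distrib_left algebra_simps)

lemma val_uminus: "val n (\<lambda>i. - y i) q = - val n y q"
  by (simp add: val_def sum_negf)

text \<open>For a connected bipartite graph with sides \<open>L\<close> and \<open>R\<close> this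
  spans the functionals on its vertices that vanish on every edge.\<close>

definition side_sign :: "nat set \<Rightarrow> nat set \<Rightarrow> nat \<Rightarrow> int" where
  "side_sign L R i = (if i \<in> L then 1 else if i \<in> R then - 1 else 0)"

abbreviation par :: "nat \<Rightarrow> nat set \<Rightarrow> (nat \<Rightarrow>\<^sub>0 int) \<Rightarrow> int" where
  "par n C \<equiv> val n (\<lambda>i. if i \<in> C then 1 else 0)"

text \<open>Exponent vectors are elements of a free abelian group, so \<open>frag_cmul\<close>
  serves as integer scalar multiplication and \<open>frag_of\<close> as the unit vector of a
  vertex.\<close>

lemma val_frag_cmul: "val n y (frag_cmul c q) = of_int c * val n y q"
  by (simp add: val_def sum_distrib_left algebra_simps)

lemma submonoid_gen: "submonoid (gen_monoid A)"
proof -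
  have "x + y \<in> gen_monoid A" if "x \<in> gen_monoid A" "y \<in> gen_monoid A" for x y
    using that by (induction x rule: gen_monoid.induct) (auto simp: add.assoc intro: gen_monoid.intros)
  then show ?thesis by (auto simp: submonoid_def intro: gen_monoid.intros)
qed

lemma gen_monoid_base: "a \<in> A \<Longrightarrow> a \<in> gen_monoid A"
  using gen_monoid.add[OF _ gen_monoid.zero, of a A] by simp

lemma gen_monoid_mono: "A \<subseteq> B \<Longrightarrow> gen_monoid A \<subseteq> gen_monoid B"
proof
  fix x assume AB: "A \<subseteq> B" and "x \<in> gen_monoid A"
  from this(2) show "x \<in> gen_monoid B"
    by (induction rule: gen_monoid.induct) (use AB in \<open>auto intro: gen_monoid.intros\<close>)
qed

locale sgraph =
  fixes n :: nat and E :: "nat set set" and sg :: "nat set \<Rightarrow> int"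
  assumes sgr: "signed_graph n E sg"
begin

text \<open>Allowing \<open>u = v\<close> for loops merges the two cases of \<open>rho\<close> into
  one formula.\<close>

lemma edge_cases:
  assumes "e \<in> E"
  obtains u v where "e = {u, v}" "u \<in> {1..n}" "v \<in> {1..n}" "sg e = 1 \<or> sg e = -1"
    "rho sg e = Poly_Mapping.single u (sg e) + Poly_Mapping.single v (sg e)"
    "\<And>y :: nat \<Rightarrow> 'c::comm_ring_1. val n y (rho sg e) = of_int (sg e) * (y u + y v)"
proof -
  have e: "e \<subseteq> {1..n}" "e \<noteq> {}" "card e \<le> 2" "sg e = 1 \<or> sg e = -1"
    using sgr assms unfolding signed_graph_def by blast+
  have fin: "finite e" using e(1) by (rule finite_subset) simp
  then have "card e = 1 \<or> card e = 2" using e(2,3) by (metis card_0_eq le_SucE le_zero_eq numeral_2_eq_2 One_nat_def)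
  then obtain u v where uv: "e = {u, v}" by (metis card_1_singletonE card_2_iff insert_absorb2)
  have rho: "rho sg e = Poly_Mapping.single u (sg e) + Poly_Mapping.single v (sg e)"
  proof (cases "u = v")
    case True
    then show ?thesis by (simp add: rho_def uv mult.commute flip: single_add)
  next
    case False
    then show ?thesis by (simp add: rho_def uv)
  qed
  have s: "val n y (Poly_Mapping.single i c) = of_int c * y i" if "i \<in> {1..n}" for i c and y :: "nat \<Rightarrow> 'c"
  proof -
    have "val n y (Poly_Mapping.single i c) = (\<Sum>j\<in>{1..n}. if i = j then of_int c * y i else 0)"
      unfolding val_def by (rule sum.cong) (auto simp: lookup_single when_def)
    then show ?thesis using that by simp
  qed
  have "val n y (rho sg e) = of_int (sg e) * (y u + y v)" for y :: "nat \<Rightarrow> 'c"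
    unfolding rho additive_funD(1)[OF additive_val] using s[of u] s[of v] e(1) uv by (simp add: distrib_left)
  then show ?thesis using that uv e rho by blast
qed

lemma edge_pair:
  assumes "e \<in> E" shows "\<exists>u v. e = {u, v}"
  by (rule edge_cases[OF assms, where 'c = int]) blast

lemma edge_val:
  assumes "e \<in> E"
  shows "\<exists>u v. e = {u, v} \<and> u \<in> {1..n} \<and> v \<in> {1..n} \<and>
    val n (y :: nat \<Rightarrow> 'c::comm_ring_1) (rho sg e) = of_int (sg e) * (y u + y v)"
  by (rule edge_cases[OF assms, where 'c = 'c]) blast

lemma edge_sign: "e \<in> E \<Longrightarrow> sg e = 1 \<or> sg e = -1"
  using sgr unfolding signed_graph_def by blast

lemma edge_sub: "e \<in> E \<Longrightarrow> e \<subseteq> {1..n}"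
  using sgr unfolding signed_graph_def by blast

lemma edge_touch_comp:
  assumes "F \<subseteq> E" "C \<in> vcomps n F" "e \<in> F" "e \<inter> C \<noteq> {}" shows "e \<subseteq> C"
proof
  fix b assume b: "b \<in> e"
  obtain a where a: "a \<in> e" "a \<in> C" using assms(4) by blast
  have eE: "e \<in> E" using assms by blast
  obtain u v where uv: "e = {u, v}" using edge_pair[OF eE] by blast
  have "a = b \<or> {a, b} = e" using a b uv by auto
  then show "b \<in> C"
  proof
    assume "{a, b} = e"
    moreover have "b \<in> {1..n}" using b edge_sub[OF eE] by blast
    ultimately have "b \<in> reach n F a" using assms(3) by (auto simp: reach_def adj_def)
    then show ?thesis using vcomps_reach[OF assms(2) a(2)] by simp
  qed (use a in simp)
qed

lemma bipartition_edge:
  assumes "bipartition (C, comp_edges F C) L R" "{u, v} \<in> F" "u \<in> C" "v \<in> C"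
  shows "u \<noteq> v" "u \<in> L \<longleftrightarrow> v \<in> R" "u \<in> R \<longleftrightarrow> v \<in> L" "side_sign L R u = - side_sign L R v"
proof -
  have LR: "L \<union> R = C" "L \<inter> R = {}" using assms(1) by (auto simp: bipartition_def)
  have "{u, v} \<in> comp_edges F C" using assms by (simp add: comp_edges_def)
  then have c: "card ({u, v} \<inter> L) = 1" "card ({u, v} \<inter> R) = 1" using assms(1) by (auto simp: bipartition_def)
  have uv: "u \<in> L \<longleftrightarrow> u \<notin> R" "v \<in> L \<longleftrightarrow> v \<notin> R" using LR assms(3,4) by blast+
  show ne: "u \<noteq> v"
  proof
    assume "u = v"
    then show False using c uv(1) by (cases "u \<in> L") simp_all
  qed
  have "u \<in> L \<longleftrightarrow> v \<notin> L" using c(1) ne by (cases "u \<in> L"; cases "v \<in> L") simp_all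
  then show "u \<in> L \<longleftrightarrow> v \<in> R" "u \<in> R \<longleftrightarrow> v \<in> L" using uv by blast+
  then show "side_sign L R u = - side_sign L R v" using LR assms(3,4) by (auto simp: side_sign_def)
qed

lemma bipartitionI:
  assumes "F \<subseteq> E" "L \<union> R = C" "L \<inter> R = {}"
    "\<And>u v. {u, v} \<in> F \<Longrightarrow> u \<in> C \<Longrightarrow> v \<in> C \<Longrightarrow> (u \<in> L \<longrightarrow> v \<in> R) \<and> (u \<in> R \<longrightarrow> v \<in> L)"
  shows "bipartition (C, comp_edges F C) L R"
  unfolding bipartition_def
proof (intro conjI ballI)
  fix e assume "e \<in> snd (C, comp_edges F C)"
  then have e: "e \<in> F" "e \<subseteq> C" by (auto simp: comp_edges_def)
  have "e \<in> E" using e assms(1) by blast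
  then obtain u v where uv: "e = {u, v}" using edge_pair by blast
  have "{v, u} \<in> F" using e(1) uv by (simp add: insert_commute)
  then have "(u \<in> L \<and> u \<notin> R \<and> v \<notin> L \<and> v \<in> R) \<or> (u \<in> R \<and> u \<notin> L \<and> v \<in> L \<and> v \<notin> R)"
    using assms(2,3) assms(4)[of u v] assms(4)[of v u] e uv by blast
  then have "e \<inter> L = {u} \<and> e \<inter> R = {v} \<or> e \<inter> L = {v} \<and> e \<inter> R = {u}" unfolding uv by blast
  then show "card (e \<inter> L) = 1" "card (e \<inter> R) = 1" by auto
qed (use assms in auto)

lemma side_sign_cases:
  assumes "bipartition (C, comp_edges F C) L R"
  shows "v \<in> C \<Longrightarrow> side_sign L R v = 1 \<or> side_sign L R v = -1" "v \<notin> C \<Longrightarrow> side_sign L R v = 0"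
  using assms by (auto simp: bipartition_def side_sign_def)

lemma val_side_sign_zero:
  assumes "F \<subseteq> E" "C \<in> vcomps n F" "bipartition (C, comp_edges F C) L R" "e \<in> F"
  shows "val n (side_sign L R) (rho sg e) = 0"
proof -
  obtain u v where uv: "e = {u, v}" "val n (side_sign L R) (rho sg e) = of_int (sg e) * (side_sign L R u + side_sign L R v)"
    using edge_val[of e] assms by blast
  show ?thesis
  proof (cases "e \<inter> C = {}")
    case True
    then show ?thesis using uv side_sign_cases(2)[OF assms(3)] by auto
  next
    case False
    then have "e \<subseteq> C" using edge_touch_comp assms by blast
    then show ?thesis using uv bipartition_edge(4)[OF assms(3), of u v] assms(4) by auto
  qed
qed

lemma par_even:
  assumes "F \<subseteq> E" "C \<in> vcomps n F" "e \<in> F" shows "even (par n C (rho sg e))"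
proof -
  obtain u v where uv: "e = {u, v}"
    "par n C (rho sg e) = of_int (sg e) * ((if u \<in> C then 1 else 0) + (if v \<in> C then 1 else 0))"
    using edge_val[of e] assms by blast
  then show ?thesis using edge_touch_comp[OF assms(1-3)] by auto
qed

lemma val_gen_zero:
  assumes "\<And>e. e \<in> F \<Longrightarrow> val n y (rho sg e) = 0" "q \<in> diffs (gen_monoid (rho sg ` F))"
  shows "val n y q = 0"
proof -
  have "val n y x = 0" if "x \<in> gen_monoid (rho sg ` F)" for x
    using that by (induction rule: gen_monoid.induct) (auto simp: assms(1) additive_funD[OF additive_val])
  then show ?thesis using assms(2) by (auto simp: diffs_def additive_funD[OF additive_val])
qed

lemma val_gen_even:
  assumes "\<And>e. e \<in> F \<Longrightarrow> even (val n y (rho sg e) :: int)" "q \<in> diffs (gen_monoid (rho sg ` F))"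
  shows "even (val n y q)"
proof -
  have "even (val n y x)" if "x \<in> gen_monoid (rho sg ` F)" for x
    using that by (induction rule: gen_monoid.induct) (auto simp: assms(1) additive_funD[OF additive_val])
  then show ?thesis using assms(2) by (auto simp: diffs_def additive_funD[OF additive_val])
qed

lemma keys_rho: "e \<in> E \<Longrightarrow> keys (rho sg e) \<subseteq> {1..n}"
proof -
  assume "e \<in> E"
  then obtain u v where "u \<in> {1..n}" "v \<in> {1..n}"
    "rho sg e = Poly_Mapping.single u (sg e) + Poly_Mapping.single v (sg e)"
    by (rule edge_cases[where 'c = int])
  then show ?thesis using keys_add[of "Poly_Mapping.single u (sg e)" "Poly_Mapping.single v (sg e)"]
    by (auto split: if_splits)
qed

text \<open>
  Modulo the lattice an edge identifies one endpoint with the negative of the other, so each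
  component contributes a multiple of a single vertex vector; twice this vector vanishes unless
  the component is bipartite.
\<close>

lemma edge_lattice:
  assumes F: "F \<subseteq> E" and g: "keys g \<subseteq> {1..n}"
    and bip: "\<And>C. C \<in> vcomps n F \<Longrightarrow> bipartite (C, comp_edges F C) \<Longrightarrow>
        \<exists>L R. bipartition (C, comp_edges F C) L R \<and> val n (side_sign L R) g = 0"
    and nonbip: "\<And>C. C \<in> vcomps n F \<Longrightarrow> \<not> bipartite (C, comp_edges F C) \<Longrightarrow> even (par n C g)"
  shows "g \<in> diffs (gen_monoid (rho sg ` F))"
proof -
  let ?D = "diffs (gen_monoid (rho sg ` F))"
  let ?e = "frag_of :: nat \<Rightarrow> _"
  have Fsub: "\<And>e. e \<in> F \<Longrightarrow> e \<subseteq> {1..n}" using F edge_sub by blast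
  note S = diffs_submonoid[OF submonoid_gen[of "rho sg ` F"]]
  note closed = diffs_closed_diff[OF submonoid_gen[of "rho sg ` F"]]
  have zero: "0 \<in> ?D" using S(1) by (simp add: submonoid_def)
  have nmul: "frag_cmul (int m) q \<in> ?D" if "q \<in> ?D" for m q
  proof (induction m)
    case (Suc m)
    have "frag_cmul (int (Suc m)) q = q + frag_cmul (int m) q" by (simp add: frag_cmul_distrib)
    then show ?case using closed(2)[OF that Suc] by simp
  qed (simp add: zero)
  have cmul: "frag_cmul c q \<in> ?D" if "q \<in> ?D" for c q
  proof (cases c rule: int_cases2)
    case (nonneg m)
    then show ?thesis using nmul[OF that] by simp
  next
    case (nonpos m)
    then have "frag_cmul c q = - frag_cmul (int m) q" by simp
    then show ?thesis using S(2)[OF nmul[OF that, of m]] by simp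
  qed
  have sums: "(\<Sum>i\<in>I. f i) \<in> ?D" if "\<And>i. i \<in> I \<Longrightarrow> f i \<in> ?D" for f and I :: "'i set"
    using that by (induction I rule: infinite_finite_induct) (auto simp: zero closed)
  have edge: "?e u + ?e v \<in> ?D" if "{u, v} \<in> F" for u v
  proof -
    have "{u, v} \<in> E" using that F by blast
    then obtain a b where ab: "{u, v} = {a, b}" "sg {u, v} = 1 \<or> sg {u, v} = -1"
      "rho sg {u, v} = Poly_Mapping.single a (sg {u, v}) + Poly_Mapping.single b (sg {u, v})"
      by (rule edge_cases[where 'c = int])
    have "rho sg {u, v} = frag_cmul (sg {u, v}) (?e u + ?e v)"
      using ab by (intro poly_mapping_eqI) (auto simp: lookup_add lookup_single doubleton_eq_iff when_def)
    then have "?e u + ?e v = frag_cmul (sg {u, v}) (rho sg {u, v})" using ab(2) by auto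
    moreover have "rho sg {u, v} \<in> ?D" using S(3) gen_monoid_base that by blast
    ultimately show ?thesis using cmul by simp
  qed
  have comp: "(\<Sum>v\<in>C. frag_cmul (lookup g v) (?e v)) \<in> ?D" if C: "C \<in> vcomps n F" for C
  proof -
    have fC: "finite C" and CV: "C \<subseteq> {1..n}" using vcomps_sub[OF C] finite_subset by auto
    obtain r where r: "r \<in> C" using vcomps_nonempty[OF C] by blast
    \<comment> \<open>Modulo the lattice every vertex vector is replaced by \<open>k v\<close> times
      the root vector, which leaves a single multiple of the root vector to be checked.\<close>
    have main: "(\<Sum>v\<in>C. frag_cmul (lookup g v) (?e v)) \<in> ?D"
      if k: "\<And>v. v \<in> C \<Longrightarrow> ?e v - frag_cmul (k v) (?e r) \<in> ?D"
        and s: "frag_cmul (\<Sum>v\<in>C. lookup g v * k v) (?e r) \<in> ?D" for k :: "nat \<Rightarrow> int"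
    proof -
      have "(\<Sum>v\<in>C. frag_cmul (lookup g v) (?e v - frag_cmul (k v) (?e r))) \<in> ?D"
        using k cmul by (intro sums) blast
      moreover have "(\<Sum>v\<in>C. frag_cmul (lookup g v) (?e v)) =
          (\<Sum>v\<in>C. frag_cmul (lookup g v) (?e v - frag_cmul (k v) (?e r)))
          + frag_cmul (\<Sum>v\<in>C. lookup g v * k v) (?e r)"
        by (rule poly_mapping_eqI) (simp add: lookup_add lookup_sum lookup_minus algebra_simps sum_subtractf sum_distrib_right)
      ultimately show ?thesis using s closed by simp
    qed
    show ?thesis
    proof (cases "bipartite (C, comp_edges F C)")
      case True
      then obtain L R where LR: "bipartition (C, comp_edges F C) L R" "val n (side_sign L R) g = 0" using bip[OF C] by blast
      let ?s = "side_sign L R"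
      have sq: "?s v * ?s v = 1" if "v \<in> C" for v using side_sign_cases(1)[OF LR(1) that] by auto
      have "?e v - frag_cmul (?s v * ?s r) (?e r) \<in> ?D" if v: "v \<in> C" for v
      proof (rule vcomps_induct[OF C r v Fsub])
        show "?e r - frag_cmul (?s r * ?s r) (?e r) \<in> ?D" using sq[OF r] zero by simp
        fix a b assume ab: "a \<in> C" "b \<in> C" "{a, b} \<in> F" "?e a - frag_cmul (?s a * ?s r) (?e r) \<in> ?D"
        have "?s b = - ?s a" using bipartition_edge(4)[OF LR(1) ab(3,1,2)] by simp
        then have "?e b - frag_cmul (?s b * ?s r) (?e r) = (?e a + ?e b) - (?e a - frag_cmul (?s a * ?s r) (?e r))"
          by (intro poly_mapping_eqI) (simp add: lookup_add lookup_minus)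
        then show "?e b - frag_cmul (?s b * ?s r) (?e r) \<in> ?D" using closed(1)[OF edge[OF ab(3)] ab(4)] by (simp only:)
      qed
      moreover have "(\<Sum>v\<in>C. lookup g v * (?s v * ?s r)) = 0"
      proof -
        have "val n ?s g = (\<Sum>v\<in>C. ?s v * lookup g v)"
          unfolding val_def using CV side_sign_cases(2)[OF LR(1)]
          by (intro sum.mono_neutral_cong_right) auto
        then have z: "(\<Sum>v\<in>C. ?s v * lookup g v) = 0" using LR(2) by simp
        have "(\<Sum>v\<in>C. lookup g v * (?s v * ?s r)) = (\<Sum>v\<in>C. ?s v * lookup g v) * ?s r"
          unfolding sum_distrib_right by (rule sum.cong) (simp_all add: ac_simps)
        then show ?thesis unfolding z by simp
      qed
      ultimately show ?thesis using zero by (intro main[of "\<lambda>v. ?s v * ?s r"]) auto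
    next
      case False
      \<comment> \<open>If twice the root vector were not in the lattice, the vertices congruent to
        it and those congruent to its negative would be disjoint sets, and they would form a
        bipartition.\<close>
      have two: "?e r + ?e r \<in> ?D"
      proof (rule ccontr)
        assume n2: "\<not> ?thesis"
        let ?L = "{v \<in> C. ?e v - ?e r \<in> ?D}" and ?R = "{v \<in> C. ?e v + ?e r \<in> ?D}"
        have "?e v - ?e r \<in> ?D \<or> ?e v + ?e r \<in> ?D" if v: "v \<in> C" for v
        proof (rule vcomps_induct[OF C r v Fsub])
          show "?e r - ?e r \<in> ?D \<or> ?e r + ?e r \<in> ?D" using zero by simp
          fix a b assume ab: "{a, b} \<in> F" "?e a - ?e r \<in> ?D \<or> ?e a + ?e r \<in> ?D"
          have "?e b + ?e r = (?e a + ?e b) - (?e a - ?e r)" "?e b - ?e r = (?e a + ?e b) - (?e a + ?e r)"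
            by simp_all
          then show "?e b - ?e r \<in> ?D \<or> ?e b + ?e r \<in> ?D"
            using ab(2) closed(1)[OF edge[OF ab(1)]] by metis
        qed
        then have un: "?L \<union> ?R = C" by blast
        have "?L \<inter> ?R = {}"
        proof -
          have "False" if "?e v - ?e r \<in> ?D" "?e v + ?e r \<in> ?D" for v
          proof -
            have "?e r + ?e r = (?e v + ?e r) - (?e v - ?e r)" by simp
            also have "\<dots> \<in> ?D" by (rule closed(1)[OF that(2,1)])
            finally show False using n2 by contradiction
          qed
          then show ?thesis by blast
        qed
        moreover have "(u \<in> ?L \<longrightarrow> v \<in> ?R) \<and> (u \<in> ?R \<longrightarrow> v \<in> ?L)"
          if uv: "{u, v} \<in> F" "u \<in> C" "v \<in> C" for u v
        proof -
          have eq: "(?e u + ?e v) - (?e u - ?e r) = ?e v + ?e r" "(?e u + ?e v) - (?e u + ?e r) = ?e v - ?e r"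
            by simp_all
          have "?e u - ?e r \<in> ?D \<Longrightarrow> ?e v + ?e r \<in> ?D" "?e u + ?e r \<in> ?D \<Longrightarrow> ?e v - ?e r \<in> ?D"
            using closed(1)[OF edge[OF uv(1)]] unfolding eq[symmetric] by blast+
          then show ?thesis using uv by blast
        qed
        ultimately have "bipartition (C, comp_edges F C) ?L ?R" using un by (intro bipartitionI[OF F]) auto
        then show False using False by (auto simp: bipartite_def)
      qed
      \<comment> \<open>Now signs are irrelevant modulo the lattice: every vertex vector is
        congruent to the root vector, and the parity of the coefficient sum decides.\<close>
      have "?e v - frag_cmul 1 (?e r) \<in> ?D" if v: "v \<in> C" for v
      proof (rule vcomps_induct[OF C r v Fsub])
        show "?e r - frag_cmul 1 (?e r) \<in> ?D" using zero by simp
        fix a b assume ab: "{a, b} \<in> F" "?e a - frag_cmul 1 (?e r) \<in> ?D"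
        have "?e b - frag_cmul 1 (?e r) = (?e a + ?e b) - (?e a - frag_cmul 1 (?e r)) - (?e r + ?e r)"
          by simp
        then show "?e b - frag_cmul 1 (?e r) \<in> ?D"
          using closed(1)[OF closed(1)[OF edge[OF ab(1)] ab(2)] two] by (simp only:)
      qed
      moreover have "par n C g = (\<Sum>v\<in>C. lookup g v * 1)"
        unfolding val_def using CV by (intro sum.mono_neutral_cong_right) auto
      then obtain m where "(\<Sum>v\<in>C. lookup g v * 1) = 2 * m" using nonbip[OF C False] by (auto elim: evenE)
      then have "frag_cmul (\<Sum>v\<in>C. lookup g v * 1) (?e r) = frag_cmul m (?e r + ?e r)"
        by (intro poly_mapping_eqI) (simp only: lookup_frag_cmul lookup_add distrib_left distrib_right mult_2)
      ultimately show ?thesis using cmul[OF two, of m] by (intro main[of "\<lambda>_. 1"]) auto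
    qed
  qed
  have g_sum: "g = (\<Sum>v\<in>{1..n}. frag_cmul (lookup g v) (?e v))"
  proof (rule poly_mapping_eqI)
    fix i
    have "(\<Sum>v\<in>{1..n}. lookup g v * lookup (?e v) i) =
      (\<Sum>v\<in>{1..n}. if v = i then lookup g i else 0)"
      by (rule sum.cong) (auto simp: lookup_single when_def)
    then show "lookup g i = lookup (\<Sum>v\<in>{1..n}. frag_cmul (lookup g v) (?e v)) i"
      using g by (auto simp: lookup_sum in_keys_iff)
  qed
  have cover: "{1..n} = \<Union>(vcomps n F)"
    using mem_reach_self vcomps_sub unfolding vcomps_eq by (auto simp: reach_def)
  have "(\<Sum>v\<in>\<Union>(vcomps n F). frag_cmul (lookup g v) (?e v))
      = (\<Sum>C\<in>vcomps n F. \<Sum>v\<in>C. frag_cmul (lookup g v) (?e v))"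
  proof -
    have "\<forall>C\<in>vcomps n F. finite C" by (rule ballI, rule finite_subset[OF vcomps_sub]) auto
    moreover have "\<forall>C\<in>vcomps n F. \<forall>D\<in>vcomps n F. C \<noteq> D \<longrightarrow> C \<inter> D = {}"
    proof (intro ballI impI)
      fix C D assume CD: "C \<in> vcomps n F" "D \<in> vcomps n F" "C \<noteq> D"
      show "C \<inter> D = {}" using vcomps_eqI[OF CD(1,2)] CD(3) by blast
    qed
    ultimately show ?thesis using sum.Union_disjoint[of "vcomps n F" "\<lambda>v. frag_cmul (lookup g v) (?e v)"]
      by (simp only: comp_def)
  qed
  also have "\<dots> \<in> ?D" using comp by (rule sums)
  finally show ?thesis using g_sum unfolding cover[symmetric] by simp
qed

end

subsection \<open>Facet subgraphs\<close>

locale ssubgraph = sgraph +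
  fixes F :: "nat set set"
  assumes FE: "F \<subseteq> E"
begin

lemma F_sub: "e \<in> F \<Longrightarrow> e \<subseteq> {1..n}"
  using FE edge_sub by blast

lemma ex_vcomp: "v \<in> {1..n} \<Longrightarrow> \<exists>C\<in>vcomps n F. v \<in> C"
  using mem_reach_self unfolding vcomps_eq by blast

lemma untouched_comp:
  assumes C: "C \<in> vcomps n F" and un: "\<And>e. e \<in> E - F \<Longrightarrow> e \<inter> C = {}"
  shows "C \<in> vcomps n E" "comp_edges E C = comp_edges F C"
proof -
  show "comp_edges E C = comp_edges F C"
  proof
    show "comp_edges E C \<subseteq> comp_edges F C"
    proof
      fix e assume e: "e \<in> comp_edges E C"
      then have "e \<noteq> {}" using edge_pair[of e] by (auto simp: comp_edges_def)
      then have "e \<inter> C \<noteq> {}" using e by (auto simp: comp_edges_def)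
      then show "e \<in> comp_edges F C" using un[of e] e by (auto simp: comp_edges_def)
    qed
  qed (use FE in \<open>auto simp: comp_edges_def\<close>)
  obtain r where r: "r \<in> C" using vcomps_nonempty[OF C] by blast
  have rn: "r \<in> {1..n}" using r vcomps_sub[OF C] by blast
  have "reach n E r = C"
  proof
    show "reach n E r \<subseteq> C"
    proof
      fix v assume "v \<in> reach n E r"
      then have "(adj E)\<^sup>*\<^sup>* r v" by (simp add: reach_def)
      then show "v \<in> C"
      proof (induction rule: rtranclp_induct)
        case (step a b)
        have e: "{a, b} \<in> E" using step.hyps by (simp add: adj_def)
        then have "{a, b} \<in> F" using un[of "{a, b}"] step.IH by blast
        then show ?case using edge_touch_comp[OF FE C, of "{a, b}"] step.IH by blast
      qed (use r in simp)
    qed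
    show "C \<subseteq> reach n E r"
    proof
      fix v assume v: "v \<in> C"
      show "v \<in> reach n E r"
      proof (rule vcomps_induct[OF C r v F_sub])
        show "r \<in> reach n E r" using mem_reach_self[OF rn] .
        fix a b assume ab: "a \<in> C" "b \<in> C" "{a, b} \<in> F" "a \<in> reach n E r"
        then show "b \<in> reach n E r" using vcomps_sub[OF C] FE adj_step[of a b E r]
          by (auto simp: reach_def)
      qed
    qed
  qed
  then show "C \<in> vcomps n E" using rn unfolding vcomps_eq by blast
qed

lemma comp_untouched:
  assumes "C \<in> vcomps n F" "(C, comp_edges F C) \<in> components n E" "e \<in> E - F"
  shows "e \<inter> C = {}"
proof (rule ccontr)
  assume t: "\<not> ?thesis"
  have CE: "C \<in> vcomps n E" "comp_edges F C = comp_edges E C" using assms(2) by (auto simp: components_eq)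
  have "e \<subseteq> C" using edge_touch_comp[OF order_refl CE(1)] t assms(3) by blast
  then have "e \<in> comp_edges E C" using assms(3) by (simp add: comp_edges_def)
  then show False using CE(2) assms(3) by (auto simp: comp_edges_def)
qed

text \<open>Turns the clause of \<open>facet_subgraph\<close> about components of \<open>G\<close>
  into a condition on the edges outside \<open>F\<close>.\<close>

lemma untouched_iff:
  assumes "C \<in> vcomps n F"
  shows "(C, comp_edges F C) \<in> components n E \<longleftrightarrow> (\<forall>e\<in>E - F. e \<inter> C = {})"
  using comp_untouched[OF assms] untouched_comp[OF assms] by (auto simp: components_eq)

definition touched :: "nat set \<Rightarrow> nat set set" where
  "touched C = {D \<in> vcomps n F. D \<noteq> C \<and> (\<exists>e\<in>E - F. e \<inter> D \<noteq> {})}"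

text \<open>Each edge outside \<open>F\<close> has an endpoint in \<open>C\<close>, so it can only
  glue a component to \<open>C\<close>; no two other components are joined directly.\<close>

lemma vcomps_merge:
  assumes C: "C \<in> vcomps n F" and ne: "E - F \<noteq> {}" and all: "\<And>e. e \<in> E - F \<Longrightarrow> e \<inter> C \<noteq> {}"
  defines "W \<equiv> C \<union> \<Union>(touched C)"
  shows "vcomps n E = (vcomps n F - insert C (touched C)) \<union> {W}" (is ?thesis1)
    and "W \<notin> vcomps n F - insert C (touched C)" (is ?thesis2)
    and "\<And>e. e \<in> E - F \<Longrightarrow> e \<subseteq> W"
proof -
  have tv: "touched C \<subseteq> vcomps n F" by (auto simp: touched_def)
  have Wn: "W \<subseteq> {1..n}" unfolding W_def using vcomps_sub C tv by blast
  show eW: "e \<subseteq> W" if e: "e \<in> E - F" for e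
  proof
    fix v assume v: "v \<in> e"
    then have "v \<in> {1..n}" using edge_sub e by blast
    then obtain D where D: "D \<in> vcomps n F" "v \<in> D" using ex_vcomp by blast
    then have "D = C \<or> D \<in> touched C" using v e by (auto simp: touched_def)
    then show "v \<in> W" using D by (auto simp: W_def)
  qed
  have sep: "D \<inter> W = {}" if "D \<in> vcomps n F" "D \<notin> insert C (touched C)" for D
    using that vcomps_eqI[of D n F] C tv unfolding W_def by blast
  obtain r where r: "r \<in> C" using vcomps_nonempty[OF C] by blast
  have rn: "r \<in> {1..n}" using r vcomps_sub[OF C] by blast
  have FEr: "(adj E)\<^sup>*\<^sup>* a b" if "D \<in> vcomps n F" "a \<in> D" "b \<in> D" for D a b
  proof (rule vcomps_induct[OF that F_sub])
    fix x y assume "{x, y} \<in> F" "(adj E)\<^sup>*\<^sup>* a x"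
    then show "(adj E)\<^sup>*\<^sup>* a y" using FE adj_step[of x y E a] by blast
  qed simp_all
  have "W \<subseteq> reach n E r"
  proof
    fix v assume v: "v \<in> W"
    have "(adj E)\<^sup>*\<^sup>* r v"
    proof (cases "v \<in> C")
      case True
      then show ?thesis using FEr C r by blast
    next
      case False
      then obtain D e where D: "D \<in> vcomps n F" "v \<in> D" "D \<noteq> C" "e \<in> E - F" "e \<inter> D \<noteq> {}"
        using v by (auto simp: W_def touched_def)
      obtain a b where ab: "a \<in> e" "a \<in> C" "b \<in> e" "b \<in> D" using D all[OF D(4)] by blast
      have "a \<noteq> b" using vcomps_eqI[OF C D(1)] ab D(3) by blast
      then have "e = {a, b}" using edge_pair[of e] ab D(4) by auto
      then have "adj E a b" using D(4) by (simp add: adj_def)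
      then show ?thesis using FEr[OF C r ab(2)] FEr[OF D(1) ab(4) D(2)]
        by (meson rtranclp.rtrancl_into_rtrancl rtranclp_trans)
    qed
    then show "v \<in> reach n E r" using v Wn by (auto simp: reach_def)
  qed
  moreover have "reach n E r \<subseteq> W"
  proof
    fix v assume "v \<in> reach n E r"
    then have "(adj E)\<^sup>*\<^sup>* r v" by (simp add: reach_def)
    then show "v \<in> W"
    proof (induction rule: rtranclp_induct)
      case (step a b)
      have e: "{a, b} \<in> E" using step.hyps by (simp add: adj_def)
      show ?case
      proof (cases "{a, b} \<in> F")
        case True
        obtain D where D: "a \<in> D" "D \<in> insert C (touched C)" using step.IH by (auto simp: W_def)
        then have "D \<in> vcomps n F" using C tv by blast
        then have "{a, b} \<subseteq> D" using edge_touch_comp[OF FE _ True] D by blast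
        then show ?thesis using D by (auto simp: W_def)
      next
        case False
        then show ?thesis using eW[of "{a, b}"] e by blast
      qed
    qed (use r in \<open>simp add: W_def\<close>)
  qed
  ultimately have clW: "reach n E r = W" by blast
  have WE: "W \<in> vcomps n E" using clW rn unfolding vcomps_eq by blast
  have rest: "D \<in> vcomps n E" if "D \<in> vcomps n F" "D \<notin> insert C (touched C)" for D
    by (rule untouched_comp(1)[OF that(1)]) (use that in \<open>auto simp: touched_def\<close>)
  have "D \<in> (vcomps n F - insert C (touched C)) \<union> {W}" if D: "D \<in> vcomps n E" for D
  proof -
    obtain v where v: "v \<in> D" using vcomps_nonempty[OF D] by blast
    then obtain D' where D': "D' \<in> vcomps n F" "v \<in> D'" using ex_vcomp vcomps_sub[OF D] by blast
    show ?thesis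
    proof (cases "D' \<in> insert C (touched C)")
      case True
      then have "v \<in> W" using D' by (auto simp: W_def)
      then show ?thesis using vcomps_eqI[OF D WE v] by blast
    next
      case False
      then have "D = D'" using vcomps_eqI[OF D rest[OF D'(1) False] v D'(2)] by blast
      then show ?thesis using False D' by blast
    qed
  qed
  then show ?thesis1 using rest WE by blast
  show ?thesis2 using sep[of W] r by (auto simp: W_def)
qed

lemma ncomp_merge:
  assumes C: "C \<in> vcomps n F" and ne: "E - F \<noteq> {}" and all: "\<And>e. e \<in> E - F \<Longrightarrow> e \<inter> C \<noteq> {}"
  shows "ncomp n F = ncomp n E + card (touched C)"
proof -
  have sub: "insert C (touched C) \<subseteq> vcomps n F" using C by (auto simp: touched_def)
  then have fin: "finite (insert C (touched C))" by (rule finite_subset[OF _ finite_vcomps])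
  let ?W = "C \<union> \<Union>(touched C)"
  have "vcomps n E = insert ?W (vcomps n F - insert C (touched C))"
    using vcomps_merge(1)[OF C ne all] by simp
  moreover have "?W \<notin> vcomps n F - insert C (touched C)" by (rule vcomps_merge(2)[OF C ne all])
  ultimately have "card (vcomps n E) = Suc (card (vcomps n F - insert C (touched C)))"
    using finite_vcomps by (metis card_insert_disjoint finite_Diff)
  moreover have "card (vcomps n F - insert C (touched C)) = card (vcomps n F) - Suc (card (touched C))"
    using card_Diff_subset[OF fin sub] fin by (simp add: touched_def)
  moreover have "Suc (card (touched C)) \<le> card (vcomps n F)"
    using card_mono[OF finite_vcomps sub] fin by (simp add: touched_def)
  ultimately show ?thesis by (simp add: ncomp_eq)
qed

text \<open>An edge has at most two endpoints. If each outside edge spends one in \<open>C\<close>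
  and one in \<open>D\<close>, none is left for a third component.\<close>

lemma touched_unique:
  assumes C: "C \<in> vcomps n F" and all: "\<And>e. e \<in> E - F \<Longrightarrow> e \<inter> C \<noteq> {}"
    and D: "D \<in> touched C" and allD: "\<And>e. e \<in> E - F \<Longrightarrow> e \<inter> D \<noteq> {}"
  shows "touched C = {D}"
proof -
  have "D' = D" if D': "D' \<in> touched C" for D'
  proof -
    obtain e where e: "e \<in> E - F" "e \<inter> D' \<noteq> {}" using D' by (auto simp: touched_def)
    obtain a b c where abc: "a \<in> e" "a \<in> C" "b \<in> e" "b \<in> D" "c \<in> e" "c \<in> D'"
      using e all[OF e(1)] allD[OF e(1)] by blast
    have v: "D \<in> vcomps n F" "D' \<in> vcomps n F" "D \<noteq> C" "D' \<noteq> C" using D D' by (auto simp: touched_def)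
    have "a \<noteq> b" "a \<noteq> c" using vcomps_eqI C v abc by blast+
    then have "b = c" using edge_pair[of e] e abc by auto
    then show ?thesis using vcomps_eqI v abc by blast
  qed
  then show ?thesis using D by blast
qed

text \<open>
  The second condition on facet subgraphs; it states that the functional \<open>side_sign L R\<close> is
  positive on all edges outside \<open>F\<close>.
\<close>

definition oriented :: "nat set \<Rightarrow> nat set \<Rightarrow> nat set \<Rightarrow> bool" where
  "oriented C L R \<longleftrightarrow> C \<in> vcomps n F \<and> bipartition (C, comp_edges F C) L R \<and>
     (\<forall>e\<in>E - F. (sg e = 1 \<and> e \<inter> L \<noteq> {} \<and> e \<inter> R = {}) \<or> (sg e = -1 \<and> e \<inter> R \<noteq> {} \<and> e \<inter> L = {}))"

lemma orientedD:
  assumes "oriented C L R"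
  shows "C \<in> vcomps n F" "bipartition (C, comp_edges F C) L R" "bipartite (C, comp_edges F C)"
    "e \<in> E - F \<Longrightarrow> e \<inter> C \<noteq> {}"
proof -
  show C: "C \<in> vcomps n F" and b: "bipartition (C, comp_edges F C) L R" using assms unfolding oriented_def by simp_all
  show "bipartite (C, comp_edges F C)" using b unfolding bipartite_def by blast
  have "L \<union> R = C" using b by (simp add: bipartition_def)
  then have "L \<subseteq> C" "R \<subseteq> C" by blast+
  moreover assume "e \<in> E - F"
  then have "e \<inter> L \<noteq> {} \<or> e \<inter> R \<noteq> {}" using assms unfolding oriented_def by blast
  ultimately show "e \<inter> C \<noteq> {}" by blast
qed

text \<open>The orientation matches the sign of the edge, so nothing cancels and the value counts
  the endpoints in \<open>C\<close>, a loop counting twice.\<close>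

lemma oriented_val:
  assumes o: "oriented C L R" and e: "e \<in> E - F"
  shows "val n (side_sign L R) (rho sg e) = (if e \<subseteq> C then 2 else 1)"
proof -
  have LR: "L \<union> R = C" "L \<inter> R = {}" using orientedD(2)[OF o] by (auto simp: bipartition_def)
  obtain u v where uv: "e = {u, v}" "val n (side_sign L R) (rho sg e) = of_int (sg e) * (side_sign L R u + side_sign L R v)"
    using edge_val[of e] e by blast
  have "(sg e = 1 \<and> e \<inter> L \<noteq> {} \<and> e \<inter> R = {}) \<or> (sg e = -1 \<and> e \<inter> R \<noteq> {} \<and> e \<inter> L = {})"
    using o e by (auto simp: oriented_def)
  then show ?thesis
  proof
    assume h: "sg e = 1 \<and> e \<inter> L \<noteq> {} \<and> e \<inter> R = {}"
    then have "u \<in> L \<or> v \<in> L" "u \<notin> R" "v \<notin> R" unfolding uv(1) by blast+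
    moreover from this have "u \<in> C \<longleftrightarrow> u \<in> L" "v \<in> C \<longleftrightarrow> v \<in> L" using LR(1) by blast+
    ultimately show ?thesis using h uv by (auto simp: side_sign_def)
  next
    assume h: "sg e = -1 \<and> e \<inter> R \<noteq> {} \<and> e \<inter> L = {}"
    then have "u \<in> R \<or> v \<in> R" "u \<notin> L" "v \<notin> L" unfolding uv(1) by blast+
    moreover from this have "u \<in> C \<longleftrightarrow> u \<in> R" "v \<in> C \<longleftrightarrow> v \<in> R" using LR(1) by blast+
    ultimately show ?thesis using h uv by (auto simp: side_sign_def)
  qed
qed

lemma orientedI:
  assumes C: "C \<in> vcomps n F" and b: "bipartition (C, comp_edges F C) L R"
    and pos: "\<And>e. e \<in> E - F \<Longrightarrow> 0 < val n (side_sign L R) (rho sg e)"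
  shows "oriented C L R"
  unfolding oriented_def
proof (intro conjI ballI C b)
  fix e assume e: "e \<in> E - F"
  have LR: "L \<union> R = C" "L \<inter> R = {}" using b by (auto simp: bipartition_def)
  obtain u v where uv: "e = {u, v}" "val n (side_sign L R) (rho sg e) = of_int (sg e) * (side_sign L R u + side_sign L R v)"
    using edge_val[of e] e by blast
  have "sg e = 1 \<or> sg e = -1" using edge_sign e by blast
  then show "(sg e = 1 \<and> e \<inter> L \<noteq> {} \<and> e \<inter> R = {}) \<or> (sg e = -1 \<and> e \<inter> R \<noteq> {} \<and> e \<inter> L = {})"
    using pos[OF e] uv LR(2) by (auto simp: side_sign_def split: if_splits)
qed

lemma facet_iff:
  "facet_subgraph n E sg F \<longleftrightarrow> bicomp n F = bicomp n E + 1 \<and>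
    (\<forall>C\<in>vcomps n F. bipartite (C, comp_edges F C) \<and> (C, comp_edges F C) \<notin> components n E \<longrightarrow> (\<exists>L R. oriented C L R))"
  using FE unfolding facet_subgraph_def oriented_def components_eq[of n F] by auto

text \<open>Each edge outside \<open>F\<close> must run between \<open>C\<close> and
  \<open>D\<close>, so both functionals take the value 1 on it.\<close>

lemma two_oriented:
  assumes o: "oriented C L R" and o': "oriented D L' R'" and ne: "C \<noteq> D" and e: "e \<in> E"
  shows "val n (side_sign L' R') (rho sg e) = val n (side_sign L R) (rho sg e)"
proof (cases "e \<in> F")
  case True
  then show ?thesis using val_side_sign_zero FE orientedD(1,2)[OF o] orientedD(1,2)[OF o'] by simp
next
  case False
  then have e': "e \<in> E - F" using e by simp
  have "C \<inter> D = {}" using vcomps_eqI orientedD(1)[OF o] orientedD(1)[OF o'] ne by blast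
  then have "\<not> e \<subseteq> C" "\<not> e \<subseteq> D" using orientedD(4)[OF o e'] orientedD(4)[OF o' e'] by blast+
  then show ?thesis using oriented_val[OF o e'] oriented_val[OF o' e'] by simp
qed

text \<open>On the lattice of \<open>G\<close> the many conditions of \<open>edge_lattice\<close> at
  bipartite components shrink to one: components already present in \<open>G\<close> give
  functionals that vanish there, and all the new ones agree with that of \<open>C\<close> by
  \<open>two_oriented\<close>.\<close>

lemma edge_lattice_facet:
  assumes new: "\<And>C. C \<in> vcomps n F \<Longrightarrow> bipartite (C, comp_edges F C) \<Longrightarrow> (C, comp_edges F C) \<notin> components n E \<Longrightarrow> \<exists>L R. oriented C L R"
    and o: "oriented C L R" and q: "q \<in> diffs (gen_monoid (rho sg ` E))"
    and z: "val n (side_sign L R) q = 0"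
    and ev: "\<And>D. D \<in> vcomps n F \<Longrightarrow> \<not> bipartite (D, comp_edges F D) \<Longrightarrow> even (par n D q)"
  shows "q \<in> diffs (gen_monoid (rho sg ` F))"
proof (rule edge_lattice[OF FE])
  have k: "keys x \<subseteq> {1..n}" if "x \<in> gen_monoid (rho sg ` E)" for x
    using that
  proof (induction rule: gen_monoid.induct)
    case (add a x)
    then have "keys a \<subseteq> {1..n}" using keys_rho by blast
    then show ?case using add keys_add[of a x] by blast
  qed simp
  obtain a b where "a \<in> gen_monoid (rho sg ` E)" "b \<in> gen_monoid (rho sg ` E)" "q = a - b"
    using q unfolding diffs_def by blast
  then show "keys q \<subseteq> {1..n}" using k[of a] k[of b] keys_minus_elim[of _ a b] by blast
  fix D assume D: "D \<in> vcomps n F" "bipartite (D, comp_edges F D)"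
  show "\<exists>L R. bipartition (D, comp_edges F D) L R \<and> val n (side_sign L R) q = 0"
  proof (cases "(D, comp_edges F D) \<in> components n E")
    case True
    obtain L' R' where b: "bipartition (D, comp_edges F D) L' R'" using D(2) by (auto simp: bipartite_def)
    have "D \<in> vcomps n E" "comp_edges F D = comp_edges E D" using True by (auto simp: components_eq)
    then have "val n (side_sign L' R') (rho sg e) = 0" if "e \<in> E" for e
      using val_side_sign_zero[OF order_refl _ _ that] b by simp
    then have "val n (side_sign L' R') q = 0" using val_gen_zero[OF _ q] by blast
    then show ?thesis using b by blast
  next
    case False
    then obtain L' R' where o': "oriented D L' R'" using new D by blast
    show ?thesis
    proof (cases "D = C")
      case True
      then show ?thesis using z orientedD(2)[OF o] by blast
    next
      case False
      then have "val n (\<lambda>i. 1 * side_sign L' R' i + (-1) * side_sign L R i) (rho sg e) = 0" if "e \<in> E" for e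
        unfolding val_add using two_oriented[OF o o' _ that] by simp
      then have "val n (\<lambda>i. 1 * side_sign L' R' i + (-1) * side_sign L R i) q = 0" using val_gen_zero[OF _ q] by blast
      then have "val n (side_sign L' R') q = 0" unfolding val_add using z by simp
      then show ?thesis using orientedD(2)[OF o'] by blast
    qed
  qed
qed (use ev in blast)

text \<open>Otherwise every bipartite component of \<open>F\<close> would be one of
  \<open>G\<close>, against the count in the first condition.\<close>

lemma facet_oriented:
  assumes "facet_subgraph n E sg F" shows "\<exists>C L R. oriented C L R"
proof (rule ccontr)
  assume no: "\<not> ?thesis"
  have "{X \<in> components n F. bipartite X} \<subseteq> {X \<in> components n E. bipartite X}"
    using no assms unfolding facet_iff by (auto simp: components_eq[of n F])
  moreover have "finite {X \<in> components n E. bipartite X}" by (simp add: components_eq finite_vcomps)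
  ultimately have "bicomp n F \<le> bicomp n E" unfolding bicomp_def by (rule card_mono[rotated])
  then show False using assms unfolding facet_iff by simp
qed

lemma facet_nonempty: "facet_subgraph n E sg F \<Longrightarrow> E - F \<noteq> {}"
  using FE unfolding facet_subgraph_def by (metis Diff_eq_empty_iff add_eq_self_zero subset_antisym zero_neq_one)

text \<open>The last clause asks for even parities at all components, bipartite or not. This is
  harmless because it is applied to vectors all of whose parities have been made even by doubling or
  conjugation.\<close>

lemma bad_facet_functional:
  assumes f: "facet_subgraph n E sg F" and bad: "\<not> ncomp n F \<le> ncomp n E + 1"
  shows "\<exists>y :: nat \<Rightarrow> int. (\<forall>e\<in>F. val n y (rho sg e) = 0) \<and>
    (\<forall>e\<in>E - F. val n y (rho sg e) \<in> {1, 2}) \<and>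
    (\<exists>e1\<in>E - F. \<exists>e2\<in>E - F. val n y (rho sg e1) = 1 \<and> val n y (rho sg e2) = 1 \<and>
       rho sg e1 - rho sg e2 \<notin> diffs (gen_monoid (rho sg ` F))) \<and>
    (\<forall>q\<in>diffs (gen_monoid (rho sg ` E)). val n y q = 0 \<longrightarrow> (\<forall>D\<in>vcomps n F. even (par n D q)) \<longrightarrow>
       q \<in> diffs (gen_monoid (rho sg ` F)))"
proof -
  have new: "\<exists>L R. oriented C L R" if "C \<in> vcomps n F" "bipartite (C, comp_edges F C)" "(C, comp_edges F C) \<notin> components n E" for C
    using f that unfolding facet_iff by blast
  obtain C L R where o: "oriented C L R" using facet_oriented[OF f] by blast
  note oD = orientedD[OF o]
  have "card (touched C) > 1" using ncomp_merge[OF oD(1) facet_nonempty[OF f] oD(4)] bad by simp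
  then obtain C1 C2 where C12: "C1 \<in> touched C" "C2 \<in> touched C" "C1 \<noteq> C2"
    by (metis One_nat_def card_le_Suc0_iff_eq card.infinite leD not_less_zero)
  have v: "C1 \<in> vcomps n F" "C2 \<in> vcomps n F" "C1 \<noteq> C" "C2 \<noteq> C" using C12 by (auto simp: touched_def)
  obtain e1 e2 where e: "e1 \<in> E - F" "e1 \<inter> C1 \<noteq> {}" "e2 \<in> E - F" "e2 \<inter> C2 \<noteq> {}"
    using C12 by (auto simp: touched_def)
  have disj: "C1 \<inter> C = {}" "C2 \<inter> C = {}" "C1 \<inter> C2 = {}"
    using vcomps_eqI v oD(1) C12(3) by blast+
  have one: "val n (side_sign L R) (rho sg e1) = 1" "val n (side_sign L R) (rho sg e2) = 1"
    using oriented_val[OF o] e disj by auto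
  have "rho sg e1 - rho sg e2 \<notin> diffs (gen_monoid (rho sg ` F))"
  proof
    assume "rho sg e1 - rho sg e2 \<in> diffs (gen_monoid (rho sg ` F))"
    then have "even (par n C1 (rho sg e1 - rho sg e2))"
      using val_gen_even[of F] par_even[OF FE v(1)] by blast
    moreover have "par n C1 (rho sg e1) = 1 \<or> par n C1 (rho sg e1) = -1"
    proof -
      obtain u w where uw: "e1 = {u, w}"
        "par n C1 (rho sg e1) = of_int (sg e1) * ((if u \<in> C1 then 1 else 0) + (if w \<in> C1 then 1 else 0))"
        using edge_val[of e1] e by blast
      have "u \<in> C1 \<and> w \<in> C \<or> w \<in> C1 \<and> u \<in> C" using uw e(2) oD(4)[OF e(1)] disj by auto
      then have "u \<in> C1 \<and> w \<notin> C1 \<or> w \<in> C1 \<and> u \<notin> C1" using disj by blast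
      then show ?thesis using uw edge_sign[of e1] e by auto
    qed
    moreover have "par n C1 (rho sg e2) = 0"
    proof -
      obtain u w where uw: "e2 = {u, w}"
        "par n C1 (rho sg e2) = of_int (sg e2) * ((if u \<in> C1 then 1 else 0) + (if w \<in> C1 then 1 else 0))"
        using edge_val[of e2] e by blast
      have "u \<in> C2 \<and> w \<in> C \<or> w \<in> C2 \<and> u \<in> C" using uw e(4) oD(4)[OF e(3)] disj by auto
      then have "u \<notin> C1 \<and> w \<notin> C1" using disj by blast
      then show ?thesis using uw by simp
    qed
    ultimately show False by (auto simp: additive_funD[OF additive_val])
  qed
  then show ?thesis
    using e one val_side_sign_zero[OF FE oD(1,2)] oriented_val[OF o] edge_lattice_facet[OF new o]
    by (intro exI[of _ "side_sign L R"] conjI ballI bexI[of _ e1] bexI[of _ e2]) auto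
qed

end

section \<open>From a supporting functional to a facet subgraph, and reduction to one edge\<close>

context ssubgraph
begin

lemma edge_val_zero:
  assumes "{a, b} \<in> E" "val n (y :: nat \<Rightarrow> rat) (rho sg {a, b}) = 0" shows "y a + y b = 0"
proof -
  obtain u v where uv: "{a, b} = {u, v}" "val n y (rho sg {a, b}) = of_int (sg {a, b}) * (y u + y v)"
    using edge_val[OF assms(1), of y] by blast
  have "y u + y v = 0" using uv(2) assms(2) edge_sign[OF assms(1)] by auto
  then show ?thesis using uv(1) by (auto simp: doubleton_eq_iff add.commute)
qed

lemma vanish_bip:
  assumes y: "\<And>e. e \<in> F \<Longrightarrow> val n (y :: nat \<Rightarrow> rat) (rho sg e) = 0"
    and C: "C \<in> vcomps n F" and b: "bipartition (C, comp_edges F C) L R"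
  shows "\<exists>k. \<forall>v\<in>C. y v = k * of_int (side_sign L R v)"
proof -
  obtain r where r: "r \<in> C" using vcomps_nonempty[OF C] by blast
  let ?k = "y r * of_int (side_sign L R r)"
  have "y v = ?k * of_int (side_sign L R v)" if v: "v \<in> C" for v
  proof (rule vcomps_induct[OF C r v F_sub])
    show "y r = ?k * of_int (side_sign L R r)" using side_sign_cases(1)[OF b r] by auto
    fix p q assume pq: "p \<in> C" "q \<in> C" "{p, q} \<in> F" "y p = ?k * of_int (side_sign L R p)"
    have "y q = - y p" using edge_val_zero[of p q y] y[OF pq(3)] pq(3) FE by auto
    moreover have "side_sign L R q = - side_sign L R p" using bipartition_edge(4)[OF b pq(3,1,2)] by simp
    ultimately show "y q = ?k * of_int (side_sign L R q)" using pq(4) by simp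
  qed
  then show ?thesis by blast
qed

text \<open>The functional changes sign along every edge of \<open>F\<close>, so a nonzero value
  would two-colour the component.\<close>

lemma vanish_nonbip:
  assumes y: "\<And>e. e \<in> F \<Longrightarrow> val n (y :: nat \<Rightarrow> rat) (rho sg e) = 0"
    and C: "C \<in> vcomps n F" and b: "\<not> bipartite (C, comp_edges F C)" and v: "v \<in> C"
  shows "y v = 0"
proof (rule ccontr)
  assume nz: "y v \<noteq> 0"
  let ?L = "{u \<in> C. y u = y v}" and ?R = "{u \<in> C. y u = - y v}"
  have flip: "y q = - y p" if "{p, q} \<in> F" for p q
    using edge_val_zero[of p q y] y[OF that] that FE by auto
  have "y u = y v \<or> y u = - y v" if u: "u \<in> C" for u
  proof (rule vcomps_induct[OF C v u F_sub])
    fix p q assume "{p, q} \<in> F" "y p = y v \<or> y p = - y v"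
    then show "y q = y v \<or> y q = - y v" using flip[of p q] by auto
  qed simp_all
  then have "?L \<union> ?R = C" by blast
  moreover have "?L \<inter> ?R = {}" using nz by auto
  ultimately have "bipartition (C, comp_edges F C) ?L ?R"
    using flip by (intro bipartitionI[OF FE]) auto
  then show False using b by (auto simp: bipartite_def)
qed

lemma side_sign_swap: "L \<inter> R = {} \<Longrightarrow> side_sign R L = (\<lambda>i. - side_sign L R i)"
  by (auto simp: side_sign_def fun_eq_iff)

lemma bipartition_swap: "bipartition X L R \<Longrightarrow> bipartition X R L"
  by (auto simp: bipartition_def)

text \<open>Only \<open>C\<close> and the components it touches change; the indicator terms stand on
  both sides to avoid subtraction of natural numbers.\<close>

lemma bicomp_merge:
  assumes C: "C \<in> vcomps n F" and ne: "E - F \<noteq> {}" and all: "\<And>e. e \<in> E - F \<Longrightarrow> e \<inter> C \<noteq> {}"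
  shows "bicomp n F + (if bipartite (C \<union> \<Union>(touched C), comp_edges E (C \<union> \<Union>(touched C))) then 1 else 0) =
    bicomp n E + (if bipartite (C, comp_edges F C) then 1 else 0) + card {D \<in> touched C. bipartite (D, comp_edges F D)}"
proof -
  let ?W = "C \<union> \<Union>(touched C)" and ?T = "touched C"
  let ?rest = "{D \<in> vcomps n F - insert C ?T. bipartite (D, comp_edges F D)}"
  have tv: "?T \<subseteq> vcomps n F" and nC: "C \<notin> ?T" by (auto simp: touched_def)
  have fT: "finite ?T" using tv by (rule finite_subset[OF _ finite_vcomps])
  have fraction: "finite ?rest" using finite_vcomps by simp
  have card1: "card (S \<union> {D \<in> {X}. Q D}) = card S + (if Q X then 1 else 0)" if "finite S" "X \<notin> S"
    for S X and Q :: "nat set \<Rightarrow> bool"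
  proof -
    have "{D \<in> {X}. Q D} = (if Q X then {X} else {})" by auto
    then show ?thesis using that by simp
  qed
  have same: "comp_edges E D = comp_edges F D" if "D \<in> vcomps n F - insert C ?T" for D
    by (rule untouched_comp(2)) (use that in \<open>auto simp: touched_def\<close>)
  have "{D \<in> vcomps n E. bipartite (D, comp_edges E D)} = ?rest \<union> {D \<in> {?W}. bipartite (D, comp_edges E D)}"
  proof -
    have v: "vcomps n E = (vcomps n F - insert C ?T) \<union> {?W}" by (rule vcomps_merge(1)[OF C ne all])
    have "bipartite (D, comp_edges E D) \<longleftrightarrow> bipartite (D, comp_edges F D)" if "D \<in> vcomps n F - insert C ?T" for D
      using same[OF that] by (simp only:)
    then show ?thesis unfolding v by blast
  qed
  moreover have "?W \<notin> ?rest" using vcomps_merge(2)[OF C ne all] by blast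
  ultimately have e: "bicomp n E = card ?rest + (if bipartite (?W, comp_edges E ?W) then 1 else 0)"
    using card1[OF fraction] unfolding bicomp_eq[of n E] by (simp only:)
  have "{D \<in> vcomps n F. bipartite (D, comp_edges F D)} =
      ?rest \<union> ({D \<in> {C}. bipartite (D, comp_edges F D)} \<union> {D \<in> ?T. bipartite (D, comp_edges F D)})"
    using C tv by blast
  moreover have "card (?rest \<union> ({D \<in> {C}. bipartite (D, comp_edges F D)} \<union> {D \<in> ?T. bipartite (D, comp_edges F D)}))
      = card ?rest + card ({D \<in> {C}. bipartite (D, comp_edges F D)} \<union> {D \<in> ?T. bipartite (D, comp_edges F D)})"
    using fraction fT by (intro card_Un_disjoint) auto
  moreover have "card ({D \<in> {C}. bipartite (D, comp_edges F D)} \<union> {D \<in> ?T. bipartite (D, comp_edges F D)})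
      = card {D \<in> {C}. bipartite (D, comp_edges F D)} + card {D \<in> ?T. bipartite (D, comp_edges F D)}"
    using nC fT by (intro card_Un_disjoint) auto
  moreover have "card {D \<in> {C}. bipartite (D, comp_edges F D)} = (if bipartite (C, comp_edges F C) then 1 else 0)"
    using card1[of "{}" C "\<lambda>D. bipartite (D, comp_edges F D)"]
    by (simp only: Un_empty_left finite.emptyI empty_iff not_False_eq_True card.empty add_0 simp_thms)
  ultimately show ?thesis using e unfolding bicomp_eq[of n F] by simp
qed

text \<open>By \<open>one\<close> the functional of any bipartite component met by an outside edge
  is a multiple of \<open>w\<close>. The factor is nonzero, so after possibly exchanging the sides
  the component is oriented. The count holds because a second such component exists precisely when
  the merged component is bipartite.\<close>

lemma facet_of_functional:
  fixes w :: "nat \<Rightarrow> rat"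
  assumes ne: "E - F \<noteq> {}"
    and w0: "\<And>e. e \<in> F \<Longrightarrow> val n w (rho sg e) = 0"
    and wpos: "\<And>e. e \<in> E - F \<Longrightarrow> 0 < val n w (rho sg e)"
    and one: "\<And>z :: nat \<Rightarrow> rat. (\<And>e. e \<in> F \<Longrightarrow> val n z (rho sg e) = 0) \<Longrightarrow>
        \<exists>c. \<forall>e\<in>E. val n z (rho sg e) = c * val n w (rho sg e)"
  shows "facet_subgraph n E sg F"
proof -
  \<comment> \<open>If \<open>side_sign\<close> cancels on \<open>e\<close>, both endpoints are in
    \<open>C\<close> with opposite signs. On \<open>C\<close> the functional \<open>w\<close> is
    proportional to \<open>side_sign\<close>, so it would vanish on \<open>e\<close> too.\<close>
  have nonzero: False
    if C: "C \<in> vcomps n F" and b: "bipartition (C, comp_edges F C) L R" and e: "e \<in> E - F" "e \<inter> C \<noteq> {}"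
      and z: "val n (side_sign L R) (rho sg e) = 0" for C L R e
  proof -
    obtain k where k: "\<forall>v\<in>C. w v = k * of_int (side_sign L R v)" using vanish_bip[OF w0 C b] by blast
    have eE: "e \<in> E" using e by simp
    obtain u v where uv: "e = {u, v}" "val n (side_sign L R) (rho sg e) = of_int (sg e) * (side_sign L R u + side_sign L R v)"
      using edge_val[OF eE] by blast
    obtain u' v' where uv': "e = {u', v'}" "val n w (rho sg e) = of_int (sg e) * (w u' + w v')"
      using edge_val[OF eE] by blast
    have s: "side_sign L R u + side_sign L R v = 0" using uv(2) z edge_sign[OF eE] by auto
    have sC: "x \<in> C \<longleftrightarrow> side_sign L R x \<noteq> 0" for x
      using side_sign_cases(1)[OF b, of x] side_sign_cases(2)[OF b, of x] by (cases "x \<in> C") auto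
    have "u \<in> C \<or> v \<in> C" using e(2) uv(1) by blast
    then have "u \<in> C \<and> v \<in> C" using s unfolding sC by auto
    then have "w u + w v = k * of_int (side_sign L R u + side_sign L R v)" using k by (simp add: distrib_left)
    then have "w u + w v = 0" using s by simp
    moreover have "w u' + w v' = w u + w v" using uv(1) uv'(1) by (auto simp: doubleton_eq_iff add.commute)
    ultimately show False using wpos[OF e(1)] uv'(2) by simp
  qed
  have orient: "\<exists>L R. oriented C L R"
    if C: "C \<in> vcomps n F" and b: "bipartite (C, comp_edges F C)" and t: "\<exists>e\<in>E - F. e \<inter> C \<noteq> {}" for C
  proof -
    obtain L R where LR: "bipartition (C, comp_edges F C) L R" using b by (auto simp: bipartite_def)
    obtain e0 where e0: "e0 \<in> E - F" "e0 \<inter> C \<noteq> {}" using t by blast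
    have "val n (\<lambda>i. of_int (side_sign L R i) :: rat) (rho sg e) = 0" if "e \<in> F" for e
      unfolding val_of_int using val_side_sign_zero[OF FE C LR that] by simp
    then obtain c where c: "\<And>e. e \<in> E \<Longrightarrow> of_int (val n (side_sign L R) (rho sg e)) = c * val n w (rho sg e)"
      using one[of "\<lambda>i. of_int (side_sign L R i)"] unfolding val_of_int by blast
    have "c \<noteq> 0" using nonzero[OF C LR e0] c[of e0] e0(1) by auto
    then consider "c > 0" | "c < 0" by linarith
    then show ?thesis
    proof cases
      case 1
      have "0 < val n (side_sign L R) (rho sg e)" if "e \<in> E - F" for e
      proof -
        have "0 < (of_int (val n (side_sign L R) (rho sg e)) :: rat)" using c[of e] that wpos[OF that] 1 by simp
        then show ?thesis by simp
      qed
      then show ?thesis using orientedI[OF C LR] by blast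
    next
      case 2
      have d: "L \<inter> R = {}" using LR by (simp add: bipartition_def)
      have "0 < val n (side_sign R L) (rho sg e)" if "e \<in> E - F" for e
      proof -
        have "(of_int (val n (side_sign L R) (rho sg e)) :: rat) < 0"
          using c[of e] that wpos[OF that] 2 by (simp add: mult_neg_pos)
        then show ?thesis unfolding side_sign_swap[OF d] val_uminus by simp
      qed
      then show ?thesis using orientedI[OF C bipartition_swap[OF LR]] by blast
    qed
  qed
  \<comment> \<open>If no bipartite component met an outside edge, \<open>w\<close> would be 0 at
    both endpoints of such an edge, where its value must be positive.\<close>
  obtain C L R where o: "oriented C L R"
  proof (rule ccontr)
    assume no: "\<not> thesis"
    obtain e where e: "e \<in> E - F" using ne by blast
    have z: "w v = 0" if v: "v \<in> e" for v
    proof -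
      have "v \<in> {1..n}" using v e edge_sub by blast
      then obtain D where D: "D \<in> vcomps n F" "v \<in> D" using ex_vcomp by blast
      then have "\<not> bipartite (D, comp_edges F D)" using orient[OF D(1)] no that v e \<open>\<And>C L R. oriented C L R \<Longrightarrow> thesis\<close> by blast
      then show ?thesis using vanish_nonbip[OF w0 D(1) _ D(2)] by blast
    qed
    obtain u v where uv: "e = {u, v}" "val n w (rho sg e) = of_int (sg e) * (w u + w v)"
      using edge_val[of e] e by blast
    then show False using z[of u] z[of v] wpos[OF e] by simp
  qed
  note oD = orientedD[OF o]
  let ?T = "touched C" and ?W = "C \<union> \<Union>(touched C)"
  have LR: "L \<union> R = C" "L \<inter> R = {}" using oD(2) by (auto simp: bipartition_def)
  have tv: "D \<in> vcomps n F" "D \<noteq> C" "\<exists>e\<in>E - F. e \<inter> D \<noteq> {}" if "D \<in> ?T" for D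
    using that by (auto simp: touched_def)
  have T1: "?T = {D} \<and> (\<exists>L R. oriented D L R)" if D: "D \<in> ?T" "bipartite (D, comp_edges F D)" for D
  proof -
    obtain L' R' where o': "oriented D L' R'" using orient[OF tv(1)[OF D(1)] D(2) tv(3)[OF D(1)]] by blast
    show ?thesis using touched_unique[OF oD(1,4) D(1) orientedD(4)[OF o']] o' by blast
  qed
  have WE: "bipartite (?W, comp_edges E ?W)" if D: "D \<in> ?T" "bipartite (D, comp_edges F D)" for D
  proof -
    obtain L' R' where o': "oriented D L' R'" and T: "?T = {D}" using T1[OF D] by blast
    have W: "?W = C \<union> D" using T by simp
    have LR': "L' \<union> R' = D" "L' \<inter> R' = {}" using orientedD(2)[OF o'] by (auto simp: bipartition_def)
    have disj: "C \<inter> D = {}" using vcomps_eqI[OF oD(1) tv(1)[OF D(1)]] tv(2)[OF D(1)] by blast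
    \<comment> \<open>Outside edges join \<open>L\<close> to \<open>L'\<close> or \<open>R\<close>
      to \<open>R'\<close>, so the sides of \<open>D\<close> are exchanged.\<close>
    have "bipartition (C \<union> D, comp_edges E (C \<union> D)) (L \<union> R') (R \<union> L')"
    proof (rule bipartitionI[OF order_refl])
      show "(L \<union> R') \<union> (R \<union> L') = C \<union> D" using LR LR' by blast
      show "(L \<union> R') \<inter> (R \<union> L') = {}" using LR LR' disj by blast
      fix p q assume pq: "{p, q} \<in> E" "p \<in> C \<union> D" "q \<in> C \<union> D"
      show "(p \<in> L \<union> R' \<longrightarrow> q \<in> R \<union> L') \<and> (p \<in> R \<union> L' \<longrightarrow> q \<in> L \<union> R')"
      proof (cases "{p, q} \<in> F")
        case True
        consider "p \<in> C" | "p \<in> D" using pq by blast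
        then show ?thesis
        proof cases
          case 1
          then have q: "q \<in> C" using edge_touch_comp[OF FE oD(1) True] by blast
          have "p \<notin> L'" "p \<notin> R'" using 1 disj LR' by blast+
          then show ?thesis using bipartition_edge(2,3)[OF oD(2) True 1 q] by blast
        next
          case 2
          then have q: "q \<in> D" using edge_touch_comp[OF FE tv(1)[OF D(1)] True] by blast
          have "p \<notin> L" "p \<notin> R" using 2 disj LR by blast+
          then show ?thesis using bipartition_edge(2,3)[OF orientedD(2)[OF o'] True 2 q] by blast
        qed
      next
        case False
        then have e: "{p, q} \<in> E - F" using pq by simp
        have a: "{p, q} \<inter> C \<noteq> {}" "{p, q} \<inter> D \<noteq> {}" using oD(4)[OF e] orientedD(4)[OF o' e] by blast+
        have b: "(sg {p, q} = 1 \<and> {p, q} \<inter> L \<noteq> {} \<and> {p, q} \<inter> R = {}) \<or> (sg {p, q} = -1 \<and> {p, q} \<inter> R \<noteq> {} \<and> {p, q} \<inter> L = {})"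
          "(sg {p, q} = 1 \<and> {p, q} \<inter> L' \<noteq> {} \<and> {p, q} \<inter> R' = {}) \<or> (sg {p, q} = -1 \<and> {p, q} \<inter> R' \<noteq> {} \<and> {p, q} \<inter> L' = {})"
          using o[unfolded oriented_def, THEN conjunct2, THEN conjunct2, rule_format, OF e]
            o'[unfolded oriented_def, THEN conjunct2, THEN conjunct2, rule_format, OF e] .
        have pq': "p \<in> C \<and> q \<in> D \<or> q \<in> C \<and> p \<in> D" using a disj by blast
        have "({p, q} \<inter> R = {} \<and> {p, q} \<inter> R' = {}) \<or> ({p, q} \<inter> L = {} \<and> {p, q} \<inter> L' = {})"
          using b by (metis one_neq_neg_one)
        then show ?thesis using pq' LR LR' disj by blast
      qed
    qed
    then show ?thesis unfolding W bipartite_def by blast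
  qed
  \<comment> \<open>A bipartition of the merged component restricts to all its pieces. Some piece
    besides \<open>C\<close> exists: otherwise the same sides would give a functional on
    \<open>C\<close> that vanishes on the outside edges, contrary to \<open>nonzero\<close>.\<close>
  have TW: "\<exists>D\<in>?T. bipartite (D, comp_edges F D)" if W: "bipartite (?W, comp_edges E ?W)"
  proof -
    obtain L' R' where b: "bipartition (?W, comp_edges E ?W) L' R'" using W by (auto simp: bipartite_def)
    have sub: "bipartition (D, comp_edges F D) (L' \<inter> D) (R' \<inter> D)" if "D \<subseteq> ?W" for D
    proof -
      have "L' \<union> R' = ?W" "L' \<inter> R' = {}" using b by (auto simp: bipartition_def)
      moreover have "card (e \<inter> (L' \<inter> D)) = 1 \<and> card (e \<inter> (R' \<inter> D)) = 1" if e: "e \<in> comp_edges F D" for e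
      proof -
        have "e \<subseteq> D" "e \<in> comp_edges E ?W" using e \<open>D \<subseteq> ?W\<close> FE by (auto simp: comp_edges_def)
        moreover from this(1) have "e \<inter> (L' \<inter> D) = e \<inter> L'" "e \<inter> (R' \<inter> D) = e \<inter> R'" by blast+
        ultimately show ?thesis using b by (simp add: bipartition_def)
      qed
      ultimately show ?thesis using that unfolding bipartition_def by auto
    qed
    have "?T \<noteq> {}"
    proof
      assume T: "?T = {}"
      obtain e where e: "e \<in> E - F" using ne by blast
      have bC: "bipartition (C, comp_edges E C) L' R'" using b T by simp
      have "L' \<union> R' = C" using bC by (simp add: bipartition_def)
      then have "L' \<inter> C = L'" "R' \<inter> C = R'" by blast+
      then have bF: "bipartition (C, comp_edges F C) L' R'" using sub[of C] by simp
      have "C \<in> vcomps n E" using vcomps_merge(1)[OF oD(1) ne oD(4)] T by simp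
      then have "val n (side_sign L' R') (rho sg e) = 0" using val_side_sign_zero[OF order_refl _ bC] e by blast
      then show False using nonzero[OF oD(1) bF e oD(4)[OF e]] by blast
    qed
    then obtain D where "D \<in> ?T" by blast
    moreover then have "D \<subseteq> ?W" by blast
    ultimately show ?thesis using sub unfolding bipartite_def by blast
  qed
  have "card {D \<in> ?T. bipartite (D, comp_edges F D)} = (if bipartite (?W, comp_edges E ?W) then 1 else 0)"
  proof (cases "\<exists>D\<in>?T. bipartite (D, comp_edges F D)")
    case True
    then obtain D where D: "D \<in> ?T" "bipartite (D, comp_edges F D)" by blast
    have T: "?T = {D}" using T1[OF D] by blast
    then have "{D \<in> ?T. bipartite (D, comp_edges F D)} = {D}" using D by auto
    then show ?thesis using WE[OF D] by simp
  next
    case False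
    then have no: "{D \<in> ?T. bipartite (D, comp_edges F D)} = {}" by blast
    have "\<not> bipartite (?W, comp_edges E ?W)" using TW False by blast
    then show ?thesis unfolding no by simp
  qed
  then have "bicomp n F = bicomp n E + 1"
    using bicomp_merge[OF oD(1) ne oD(4)] oD(3) by simp
  moreover have "\<exists>L R. oriented D L R"
    if D: "D \<in> vcomps n F" "bipartite (D, comp_edges F D)" "(D, comp_edges F D) \<notin> components n E" for D
  proof -
    have "\<exists>e\<in>E - F. e \<inter> D \<noteq> {}" using untouched_iff[OF D(1)] D(3) by simp
    then show ?thesis using orient[OF D(1,2)] by simp
  qed
  ultimately show ?thesis by (simp add: facet_iff)
qed

text \<open>After subtracting the multiple of \<open>e0\<close> with the right value, only parities
  can obstruct. They are automatic at untouched components, and at a single touched \<open>D\<close>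
  the parity is tied to that of \<open>C\<close>, hence to the vanishing value.\<close>

lemma facet_reduction:
  assumes f: "facet_subgraph n E sg F" and few: "ncomp n F \<le> ncomp n E + 1"
  shows "\<exists>e0\<in>E - F. \<exists>d :: nat set \<Rightarrow> nat. \<forall>e\<in>E.
    (d e = 0 \<longleftrightarrow> e \<in> F) \<and> rho sg e - frag_cmul (int (d e)) (rho sg e0) \<in> diffs (gen_monoid (rho sg ` F))"
proof -
  have new: "\<exists>L R. oriented C L R" if "C \<in> vcomps n F" "bipartite (C, comp_edges F C)" "(C, comp_edges F C) \<notin> components n E" for C
    using f that unfolding facet_iff by blast
  obtain C L R where o: "oriented C L R" using facet_oriented[OF f] by blast
  note oD = orientedD[OF o]
  have LR: "L \<union> R = C" "L \<inter> R = {}" using oD(2) by (auto simp: bipartition_def)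
  note ne = facet_nonempty[OF f]
  have cT: "card (touched C) \<le> 1" using ncomp_merge[OF oD(1) ne oD(4)] few by simp
  have fT: "finite (touched C)" by (rule finite_subset[OF _ finite_vcomps]) (auto simp: touched_def)
  let ?s = "\<lambda>e. val n (side_sign L R) (rho sg e)"
  have s: "?s e = 1 \<or> ?s e = 2" if "e \<in> E - F" for e using oriented_val[OF o that] by auto
  have s0: "?s e = 0" if "e \<in> F" for e using val_side_sign_zero[OF FE oD(1,2) that] .
  \<comment> \<open>Values on outside edges are 1 or 2; one of least value divides all the
    others.\<close>
  obtain e0 where e0: "e0 \<in> E - F" "(\<forall>e\<in>E - F. ?s e = ?s e0) \<or> ?s e0 = 1"
  proof (cases "\<exists>e\<in>E - F. ?s e = 1")
    case False
    obtain e0 where e0: "e0 \<in> E - F" using ne by blast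
    have "?s e = 2" if "e \<in> E - F" for e using s[OF that] False that by blast
    then have "\<forall>e\<in>E - F. ?s e = ?s e0" using e0 by simp
    then show ?thesis using that e0 by blast
  qed (use that in blast)
  define d where "d = (\<lambda>e. if e \<in> F then 0 else if ?s e0 = 1 then nat (?s e) else 1)"
  have ds: "?s e = int (d e) * ?s e0" if "e \<in> E" for e
  proof (cases "e \<in> F")
    case True
    then show ?thesis using s0 by (simp add: d_def)
  next
    case False
    then have se: "?s e = 1 \<or> ?s e = 2" using s that by simp
    show ?thesis
    proof (cases "?s e0 = 1")
      case True
      then have "int (d e) = ?s e" using False se by (auto simp: d_def)
      then show ?thesis using True by simp
    next
      case n1: False
      then have "?s e = ?s e0" using e0(2) False that by blast
      then show ?thesis using False n1 by (simp add: d_def)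
    qed
  qed
  have d0: "d e = 0 \<longleftrightarrow> e \<in> F" if "e \<in> E" for e
    using s[of e] that by (auto simp: d_def)
  have "rho sg e - frag_cmul (int (d e)) (rho sg e0) \<in> diffs (gen_monoid (rho sg ` F))" if e: "e \<in> E" for e
  proof (rule edge_lattice_facet[OF new o])
    let ?g = "rho sg e - frag_cmul (int (d e)) (rho sg e0)"
    note gE = diffs_closed_diff[OF submonoid_gen[of "rho sg ` E"]]
    have rE: "rho sg e' \<in> diffs (gen_monoid (rho sg ` E))" if "e' \<in> E" for e'
      by (rule subsetD[OF diffs_submonoid(3)[OF submonoid_gen] gen_monoid_base[OF imageI[OF that]]])
    have "frag_cmul (int m) (rho sg e0) \<in> diffs (gen_monoid (rho sg ` E))" for m
    proof (induction m)
      case 0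
      then show ?case using diffs_submonoid(1)[OF submonoid_gen[of "rho sg ` E"]] by (simp add: submonoid_def)
    next
      case (Suc m)
      have "frag_cmul (int (Suc m)) (rho sg e0) = rho sg e0 + frag_cmul (int m) (rho sg e0)"
        by (simp add: frag_cmul_distrib)
      then show ?case using gE(2)[OF rE Suc] e0(1) by simp
    qed
    then show "?g \<in> diffs (gen_monoid (rho sg ` E))" using gE(1)[OF rE[OF e]] by blast
    show z: "val n (side_sign L R) ?g = 0"
      using ds[OF e] by (simp add: additive_funD[OF additive_val] val_frag_cmul)
    fix D assume D: "D \<in> vcomps n F" "\<not> bipartite (D, comp_edges F D)"
    have DC: "D \<noteq> C" using D oD(3) by auto
    have pg: "par n X ?g = par n X (rho sg e) - int (d e) * par n X (rho sg e0)" for X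
      by (simp add: additive_funD[OF additive_val] val_frag_cmul)
    show "even (par n D ?g)"
    proof (cases "D \<in> touched C")
      case False
      have "even (par n D (rho sg e'))" if e': "e' \<in> E" for e'
      proof (cases "e' \<in> F")
        case True
        then show ?thesis using par_even[OF FE D(1)] by blast
      next
        case nF: False
        then have "e' \<inter> D = {}" using e' False D(1) DC by (auto simp: touched_def)
        moreover obtain u v where "e' = {u, v}"
          "par n D (rho sg e') = of_int (sg e') * ((if u \<in> D then 1 else 0) + (if v \<in> D then 1 else 0))"
          using edge_val[OF e'] by blast
        ultimately show ?thesis by auto
      qed
      then show ?thesis unfolding pg using e e0(1) by simp
    next
      case True
      have "X = D" if "X \<in> touched C" for X
        using cT that True unfolding One_nat_def card_le_Suc0_iff_eq[OF fT] by blast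
      then have T: "touched C = {D}" using True by blast
      have disj: "C \<inter> D = {}" using vcomps_eqI[OF oD(1) D(1)] DC by blast
      \<comment> \<open>An outside edge lies in the union of \<open>C\<close> and \<open>D\<close>,
        so its two endpoints contribute an even number to the sum of both parities.\<close>
      have ev: "even (par n C (rho sg e') + par n D (rho sg e'))" if e': "e' \<in> E" for e'
      proof (cases "e' \<in> F")
        case True
        then show ?thesis using par_even[OF FE D(1)] par_even[OF FE oD(1)] by simp
      next
        case False
        then have "e' \<subseteq> C \<union> D" using vcomps_merge(3)[OF oD(1) ne oD(4)] e' T by simp
        moreover obtain u v where uv: "e' = {u, v}"
          "par n D (rho sg e') = of_int (sg e') * ((if u \<in> D then 1 else 0) + (if v \<in> D then 1 else 0))"
          using edge_val[OF e'] by blast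
        moreover obtain u' v' where uv': "e' = {u', v'}"
          "par n C (rho sg e') = of_int (sg e') * ((if u' \<in> C then 1 else 0) + (if v' \<in> C then 1 else 0))"
          using edge_val[OF e'] by blast
        moreover have "((if u' \<in> C then 1 else 0) + (if v' \<in> C then 1 else 0) :: int) =
            (if u \<in> C then 1 else 0) + (if v \<in> C then 1 else 0)"
          using uv(1) uv'(1) by (auto simp: doubleton_eq_iff)
        moreover have "u \<in> C \<longleftrightarrow> u \<notin> D" "v \<in> C \<longleftrightarrow> v \<notin> D" using disj calculation(1) uv(1) by blast+
        ultimately show ?thesis by auto
      qed
      have "even (par n C ?g + par n D ?g)"
      proof -
        have "par n C ?g + par n D ?g = (par n C (rho sg e) + par n D (rho sg e))
            - int (d e) * (par n C (rho sg e0) + par n D (rho sg e0))"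
          unfolding pg by (simp add: distrib_left)
        moreover have "even (par n C (rho sg e) + par n D (rho sg e))"
          "even (par n C (rho sg e0) + par n D (rho sg e0))" using ev e e0(1) by simp_all
        ultimately show ?thesis by simp
      qed
      \<comment> \<open>Modulo 2 \<open>side_sign\<close> is the indicator of \<open>C\<close>, so
        the parity over \<open>C\<close> is even because the functional vanishes on
        \<open>?g\<close>.\<close>
      moreover have "par n C ?g = val n (\<lambda>i. 1 * side_sign L R i + 2 * (if i \<in> R then 1 else 0)) ?g"
        by (rule arg_cong[where f = "\<lambda>y. val n y ?g"]) (use LR in \<open>auto simp: side_sign_def fun_eq_iff\<close>)
      then have "par n C ?g = 2 * par n R ?g" unfolding val_add using z by simp
      ultimately show ?thesis by simp
    qed
  qed
  then show ?thesis using d0 e0(1) by blast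
qed

end

subsection \<open>Primes of faces\<close>

definition face_ideal :: "('b \<Rightarrow> 'c::{zero, ord}) \<Rightarrow> 'b set \<Rightarrow> ('b \<Rightarrow>\<^sub>0 'k::zero) set" where
  "face_ideal \<delta> Q = {f \<in> mring Q. \<forall>q\<in>keys f. 0 < \<delta> q}"

text \<open>Degree 0 is the lowest degree. An element of \<open>mring Q\<close> outside the ideal
  has a nonzero component there, and these components multiply without cancellation.\<close>

lemma face_prime:
  fixes \<delta> :: "'b::linordered_ab_group_add \<Rightarrow> 'c::linordered_ab_group_add"
  assumes Q: "submonoid Q" and d: "additive_fun \<delta>" and pos: "\<And>q. q \<in> Q \<Longrightarrow> 0 \<le> \<delta> q"
  shows "prime_in (mring Q) (face_ideal \<delta> Q :: ('b \<Rightarrow>\<^sub>0 'k::idom) set)"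
  unfolding prime_in_def
proof (intro conjI ballI impI)
  note sQ = is_subringD[OF is_subring_mring[OF Q]]
  show "face_ideal \<delta> Q \<subseteq> mring Q" by (auto simp: face_ideal_def)
  show "0 \<in> (face_ideal \<delta> Q :: ('b \<Rightarrow>\<^sub>0 'k) set)" using sQ(2) by (simp add: face_ideal_def)
  show "1 \<notin> (face_ideal \<delta> Q :: ('b \<Rightarrow>\<^sub>0 'k) set)" by (simp add: face_ideal_def additive_funD[OF d])
  fix x y :: "'b \<Rightarrow>\<^sub>0 'k"
  show "x + y \<in> face_ideal \<delta> Q" if "x \<in> face_ideal \<delta> Q" "y \<in> face_ideal \<delta> Q"
    using that sQ(6)[of x y] keys_add[of x y] unfolding face_ideal_def by blast
  show "x * y \<in> face_ideal \<delta> Q" if x: "x \<in> mring Q" and y: "y \<in> face_ideal \<delta> Q"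
  proof -
    have "0 < \<delta> q" if "q \<in> keys (x * y)" for q
    proof -
      obtain a b where ab: "a \<in> keys x" "b \<in> keys y" "q = a + b"
        using \<open>q \<in> _\<close> by (rule keys_mult_elim)
      have "0 \<le> \<delta> a" using ab x pos by (auto simp: mring_def)
      moreover have "0 < \<delta> b" using ab y by (auto simp: face_ideal_def)
      ultimately show ?thesis unfolding ab(3) additive_funD(1)[OF d] by (rule add_nonneg_pos)
    qed
    then show ?thesis using x y sQ(4)[of x y] by (auto simp: face_ideal_def)
  qed
  have part0: "part \<delta> 0 f \<noteq> 0" if f: "f \<in> mring Q" "f \<notin> face_ideal \<delta> Q" for f :: "'b \<Rightarrow>\<^sub>0 'k"
  proof -
    obtain q where q: "q \<in> keys f" "\<not> 0 < \<delta> q" using f by (auto simp: face_ideal_def)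
    then have "\<delta> q = 0" using pos[of q] f(1) by (auto simp: mring_def)
    then have "q \<in> keys (part \<delta> 0 f)" using q by (simp add: keys_restr)
    then show ?thesis by auto
  qed
  show "x \<in> face_ideal \<delta> Q \<or> y \<in> face_ideal \<delta> Q"
    if xy: "x \<in> mring Q" "y \<in> mring Q" "x * y \<in> face_ideal \<delta> Q"
  proof (rule ccontr)
    assume n: "\<not> ?thesis"
    have "part \<delta> (0 + 0) (x * y) = part \<delta> 0 x * part \<delta> 0 y"
    proof (rule part_mult_extreme[OF d])
      fix p q assume "p \<in> keys x" "q \<in> keys y" "\<delta> p + \<delta> q = 0 + 0"
      then show "\<delta> p = 0" using pos[of p] pos[of q] xy by (auto simp: mring_def add_nonneg_eq_0_iff subset_iff)
    qed
    then have "part \<delta> 0 (x * y) \<noteq> 0" using part0[of x] part0[of y] xy n by simp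
    moreover have "part \<delta> 0 (x * y) = 0" using xy(3) by (intro restr_0) (auto simp: face_ideal_def)
    ultimately show False by contradiction
  qed
qed

lemma mon_frag_power:
  "(mon b ^ m :: 'k::comm_ring_1 laurent) = mon (frag_cmul (int m) b)"
proof (induction m)
  case (Suc m)
  have "frag_cmul (int (Suc m)) b = b + frag_cmul (int m) b" by (simp add: frag_cmul_distrib)
  then show ?case using Suc by (simp add: mult_single)
qed simp

lemma nat_multiple_in_submonoid:
  assumes "submonoid Q" "b \<in> Q" shows "frag_cmul (int m) b \<in> Q"
proof (induction m)
  case 0
  then show ?case using assms by (simp add: submonoid_def)
next
  case (Suc m)
  have "frag_cmul (int (Suc m)) b = b + frag_cmul (int m) b" by (simp add: frag_cmul_distrib)
  then show ?case using Suc assms by (simp add: submonoid_def)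
qed

text \<open>Each exponent is \<open>j b\<close> modulo the group of \<open>S\<close>. Dividing by
  the smallest power of \<open>mon b\<close> that occurs leaves an exponent of degree 0, which keeps
  the cofactor outside the face ideal; \<open>h\<close> clears the denominators in
  \<open>S\<close>.\<close>

lemma factor_out:
  fixes f :: "'k::field laurent"
  assumes S: "submonoid S" "S \<subseteq> Q" and Q: "submonoid Q" and b: "b \<in> Q"
    and d: "additive_fun \<delta>" "\<And>s. s \<in> S \<Longrightarrow> \<delta> s = (0 :: 'c::linordered_ab_group_add)"
    and f: "f \<noteq> 0" "\<And>q. q \<in> keys f \<Longrightarrow> \<exists>j. q - frag_cmul (int j) b \<in> diffs S"
  shows "\<exists>h\<in>S. \<exists>u m. mon h * f = u * mon b ^ m \<and> u \<in> mring Q - face_ideal \<delta> Q"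
proof -
  obtain j where j: "\<And>q. q \<in> keys f \<Longrightarrow> q - frag_cmul (int (j q)) b \<in> diffs S"
    using f(2) by metis
  obtain h where h: "h \<in> S" "\<And>q. q \<in> keys f \<Longrightarrow> h + (q - frag_cmul (int (j q)) b) \<in> S"
    using common_denominator[OF S(1), of "(\<lambda>q. q - frag_cmul (int (j q)) b) ` keys f"] j by auto
  define m where "m = Min (j ` keys f)"
  have jm: "m \<le> j q" if "q \<in> keys f" for q using that by (simp add: m_def)
  have "m \<in> j ` keys f" unfolding m_def using f(1) by (intro Min_in) auto
  then obtain q0 where q0: "q0 \<in> keys f" "j q0 = m" by auto
  define u where "u = mon (h - frag_cmul (int m) b) * f"
  have ku: "keys u = (\<lambda>q. h - frag_cmul (int m) b + q) ` keys f"
    unfolding u_def keys_mon_mult by simp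
  have eq: "h - frag_cmul (int m) b + q = (h + (q - frag_cmul (int (j q)) b)) + frag_cmul (int (j q - m)) b"
    if "q \<in> keys f" for q
    using jm[OF that] by (intro poly_mapping_eqI) (simp add: lookup_add lookup_minus of_nat_diff algebra_simps)
  have "h - frag_cmul (int m) b + q \<in> Q" if q: "q \<in> keys f" for q
  proof -
    have "h + (q - frag_cmul (int (j q)) b) \<in> Q" using h(2)[OF q] S(2) by blast
    then show ?thesis unfolding eq[OF q] using Q nat_multiple_in_submonoid[OF Q b] by (auto simp: submonoid_def)
  qed
  then have uQ: "u \<in> mring Q" by (auto simp: mring_def ku)
  have "\<delta> (h - frag_cmul (int m) b + q0) = 0" unfolding eq[OF q0(1)] using q0 d(2)[OF h(2)[OF q0(1)]] by simp
  moreover have "h - frag_cmul (int m) b + q0 \<in> keys u" using q0(1) unfolding ku by blast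
  ultimately have "u \<notin> face_ideal \<delta> Q" unfolding face_ideal_def by force
  moreover have "mon h * f = u * mon b ^ m"
  proof -
    have "u * mon b ^ m = mon (frag_cmul (int m) b) * (mon (h - frag_cmul (int m) b) * f)"
      unfolding u_def mon_frag_power by (simp only: mult.commute)
    also have "\<dots> = mon h * f" unfolding mon_mon_mult by simp
    finally show ?thesis by simp
  qed
  ultimately show ?thesis using h(1) uQ by blast
qed

text \<open>
  Splitting \<open>f = g + g'\<close> by the parity of a character, \<open>(g + g') (g - g') = g\<^sup>2 - g'\<^sup>2\<close> has only
  even exponents, and \<open>g - g' \<noteq> 0\<close> even in characteristic two.
\<close>

lemma even_conjugate:
  fixes f :: "'b::linordered_ab_group_add \<Rightarrow>\<^sub>0 'k::idom" and X :: "('b \<Rightarrow> int) set"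
  assumes Q: "submonoid Q" and f: "f \<in> mring Q" "f \<noteq> 0" and X: "finite X" "\<And>\<chi>. \<chi> \<in> X \<Longrightarrow> additive_fun \<chi>"
  shows "\<exists>w\<in>mring Q. f * w \<noteq> 0 \<and> (\<forall>q\<in>keys (f * w). \<forall>\<chi>\<in>X. even (\<chi> q))"
  using X
proof (induction X)
  case empty
  then show ?case using f is_subringD(1)[OF is_subring_mring[OF Q]] by (intro bexI[of _ 1]) auto
next
  case (insert \<chi> X)
  note sQ = is_subringD[OF is_subring_mring[OF Q]]
  obtain w where w: "w \<in> mring Q" "f * w \<noteq> 0" "\<forall>q\<in>keys (f * w). \<forall>\<chi>\<in>X. even (\<chi> q)"
    using insert by auto
  have d: "additive_fun \<chi>" using insert.prems by blast
  let ?S = "{q. even (\<chi> q)}"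
  define g where "g = restr ?S (f * w)"
  define g' where "g' = restr (- ?S) (f * w)"
  have fw: "f * w = g + g'" unfolding g_def g'_def by (rule restr_split)
  have fwQ: "f * w \<in> mring Q" using f w sQ(4) by blast
  have mring: "g \<in> mring Q" "g' \<in> mring Q" unfolding g_def g'_def using restr_in_mring[OF fwQ] by blast+
  have "f * (w * (g - g')) = (f * w) * (g - g')" by (simp only: mult.assoc)
  also have "\<dots> = g * g - g' * g'" unfolding fw by (simp add: algebra_simps)
  finally have e: "f * (w * (g - g')) = g * g - g' * g'" .
  have "g - g' \<noteq> 0"
  proof
    assume "g - g' = 0"
    then have "g = g'" by simp
    moreover have "keys g \<inter> keys g' = {}" by (auto simp: g_def g'_def keys_restr)
    ultimately have "g = 0" "g' = 0" by auto
    then show False using fw w(2) by simp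
  qed
  then have "f * (w * (g - g')) \<noteq> 0" using w(2) by (simp add: mult.assoc[symmetric])
  moreover have "even (\<psi> q)" if q: "q \<in> keys (f * (w * (g - g')))" and psi: "\<psi> \<in> insert \<chi> X" for q \<psi>
  proof -
    have dp: "additive_fun \<psi>" using insert.prems psi by blast
    have "even (\<psi> (a + b))" if "a \<in> keys g \<and> b \<in> keys g \<or> a \<in> keys g' \<and> b \<in> keys g'" for a b
    proof (cases "\<psi> \<in> X")
      case True
      then have "even (\<psi> a)" "even (\<psi> b)" using that w(3) by (auto simp: g_def g'_def keys_restr)
      then show ?thesis by (simp add: additive_funD[OF dp])
    next
      case False
      then have "\<psi> = \<chi>" using psi by simp
      then show ?thesis using that by (auto simp: additive_funD[OF d] g_def g'_def keys_restr)
    qed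
    moreover have "q \<in> keys (g * g) \<or> q \<in> keys (g' * g')"
      using keys_minus_elim[of q] q unfolding e by blast
    ultimately show ?thesis by (auto elim!: keys_mult_elim)
  qed
  moreover have "w * (g - g') \<in> mring Q" using w mring sQ(3,4) by blast
  ultimately show ?case by blast
qed

lemma in_prime_if_monomials:
  fixes I :: "('b::linordered_ab_group_add \<Rightarrow>\<^sub>0 'k::idom) set"
  assumes Q: "submonoid Q" and I: "prime_in (mring Q) I" and f: "f \<in> mring Q" "\<And>q. q \<in> keys f \<Longrightarrow> mon q \<in> I"
  shows "f \<in> I"
proof -
  have "part (\<lambda>q. q) \<gamma> f \<in> I" if g: "\<gamma> \<in> keys f" for \<gamma>
  proof -
    have "part (\<lambda>q. q) \<gamma> f = Poly_Mapping.single 0 (lookup f \<gamma>) * mon \<gamma>"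
      by (rule poly_mapping_eqI) (auto simp: lookup_restr mult_single lookup_single when_def)
    moreover have "Poly_Mapping.single 0 (lookup f \<gamma>) \<in> mring Q"
      using Q by (auto simp: mring_def submonoid_def)
    ultimately show ?thesis using prime_inD(4)[OF I] f(2)[OF g] by simp
  qed
  then have "(\<Sum>\<gamma>\<in>(\<lambda>q. q) ` keys f. part (\<lambda>q. q) \<gamma> f) \<in> I"
    by (intro prime_in_sum[OF I]) auto
  then show ?thesis using sum_parts[of f "\<lambda>q. q"] by simp
qed

lemma gen_nonneg:
  fixes \<delta> :: "'b::linordered_ab_group_add \<Rightarrow> 'c::linordered_ab_group_add"
  assumes "additive_fun \<delta>" "\<And>a. a \<in> A \<Longrightarrow> 0 \<le> \<delta> a" "q \<in> gen_monoid A" shows "0 \<le> \<delta> q"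
  using assms(3) by (induction rule: gen_monoid.induct) (auto simp: additive_funD[OF assms(1)] assms(2))

lemma gen_zero:
  fixes \<delta> :: "'b::linordered_ab_group_add \<Rightarrow> 'c::linordered_ab_group_add"
  assumes d: "additive_fun \<delta>" and A: "\<And>a. a \<in> A \<Longrightarrow> 0 \<le> \<delta> a" "\<And>a. a \<in> A \<Longrightarrow> \<delta> a = 0 \<Longrightarrow> a \<in> B"
    and "q \<in> gen_monoid A" "\<delta> q = 0" shows "q \<in> gen_monoid B"
  using assms(4,5)
proof (induction rule: gen_monoid.induct)
  case (add a x)
  have "0 \<le> \<delta> a" "0 \<le> \<delta> x" using add.hyps A(1) gen_nonneg[OF d A(1)] by auto
  then have "\<delta> a = 0" "\<delta> x = 0" using add.prems by (auto simp: additive_funD[OF d] add_nonneg_eq_0_iff)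
  then show ?case using add A(2) by (auto intro: gen_monoid.intros)
qed (rule gen_monoid.zero)

lemma gen_mon_in_prime:
  fixes I :: "('b::linordered_ab_group_add \<Rightarrow>\<^sub>0 'k::idom) set" and \<delta> :: "'b \<Rightarrow> 'c::linordered_ab_group_add"
  assumes I: "prime_in (mring (gen_monoid A)) I" and d: "additive_fun \<delta>"
    and A: "\<And>a. a \<in> A \<Longrightarrow> 0 < \<delta> a \<Longrightarrow> mon a \<in> I"
    and "q \<in> gen_monoid A" "0 < \<delta> q"
  shows "mon q \<in> I"
  using assms(4,5)
proof (induction rule: gen_monoid.induct)
  case zero
  then show ?case by (simp add: additive_funD[OF d])
next
  case (add a x)
  have e: "(mon (a + x) :: 'b \<Rightarrow>\<^sub>0 'k) = mon a * mon x" by (simp add: mult_single)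
  show ?case
  proof (cases "0 < \<delta> a")
    case True
    then show ?thesis unfolding e using A add.hyps by (intro prime_inD(5)[OF I]) auto
  next
    case False
    then have "0 < \<delta> x" using add.prems by (simp add: additive_funD[OF d] add_nonpos_nonpos leI not_less) (meson add_nonpos_nonpos not_less)
    then show ?thesis unfolding e using add.IH gen_monoid_base[OF add.hyps(1)] by (intro prime_inD(4)[OF I]) auto
  qed
qed

text \<open>An exponent of positive degree must involve a generator of positive degree, so the
  inclusion can be tested on generators.\<close>

lemma face_ideal_subset:
  fixes I :: "('b::linordered_ab_group_add \<Rightarrow>\<^sub>0 'k::idom) set" and \<delta> :: "'b \<Rightarrow> 'c::linordered_ab_group_add"
  assumes I: "prime_in (mring (gen_monoid A)) I" and d: "additive_fun \<delta>"
    and A: "\<And>a. a \<in> A \<Longrightarrow> 0 < \<delta> a \<Longrightarrow> mon a \<in> I"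
  shows "face_ideal \<delta> (gen_monoid A) \<subseteq> I"
proof
  fix f :: "'b \<Rightarrow>\<^sub>0 'k" assume f: "f \<in> face_ideal \<delta> (gen_monoid A)"
  have fk: "f \<in> mring (gen_monoid A)" using f by (simp add: face_ideal_def)
  have "mon q \<in> I" if q: "q \<in> keys f" for q
  proof (rule gen_mon_in_prime[OF I d A])
    show "q \<in> gen_monoid A" "0 < \<delta> q" using q f by (auto simp: face_ideal_def mring_def)
  qed
  then show "f \<in> I" by (rule in_prime_if_monomials[OF submonoid_gen I fk])
qed

subsection \<open>Serre's condition\<close>

text \<open>Farkas' alternative in integral form. The second case says that \<open>a0\<close>
  belongs to the smallest face containing \<open>B\<close>.\<close>

lemma farkas_monoid:
  fixes A B :: "(nat \<Rightarrow>\<^sub>0 int) set"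
  assumes fin: "finite A" and BA: "B \<subseteq> A" and a0: "a0 \<in> A"
    and kA: "\<And>a. a \<in> A \<Longrightarrow> keys a \<subseteq> {1..n}"
  shows "(\<exists>y :: nat \<Rightarrow> rat. (\<forall>a\<in>A. 0 \<le> val n y a) \<and> (\<forall>b\<in>B. val n y b = 0) \<and> 0 < val n y a0) \<or>
    (\<exists>x\<in>gen_monoid A. a0 + x \<in> gen_monoid B)"
proof -
  define \<iota> :: "(nat \<Rightarrow>\<^sub>0 int) \<Rightarrow> nat \<Rightarrow> rat" where "\<iota> = (\<lambda>q i. of_int (lookup q i))"
  have dot: "dot {1..n} y (\<iota> q) = val n y q" for y q by (simp add: dot_def val_def \<iota>_def)
  have "finite (A \<union> uminus ` B)" using fin finite_subset[OF BA fin] by simp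
  \<comment> \<open>The negatives of \<open>B\<close> force the functional to vanish on
    \<open>B\<close>, and the target \<open>- a0\<close> makes it positive at
    \<open>a0\<close>.\<close>
  then obtain qs where qs: "set qs = A \<union> uminus ` B" using finite_list by blast
  have kq: "keys q \<subseteq> {1..n}" if "q \<in> set qs" for q
  proof -
    have "q \<in> A \<or> (\<exists>b\<in>A. q = - b)" using that BA unfolding qs by blast
    then show ?thesis using kA by (elim disjE bexE) simp_all
  qed
  consider (func) y where "\<forall>v\<in>set (map \<iota> qs). 0 \<le> dot {1..n} y v" "dot {1..n} y (\<iota> (- a0)) < 0"
    | (cone) c where "\<forall>k<length qs. 0 \<le> c k"
      "\<forall>i\<in>{1..n}. \<iota> (- a0) i = (\<Sum>k<length qs. c k * \<iota> (qs ! k) i)"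
    using farkas_list[of "{1..n}" "map \<iota> qs" "\<iota> (- a0)"] by auto
  then show ?thesis
  proof cases
    case func
    have v: "0 \<le> val n y q" if "q \<in> set qs" for q using func(1) that by (auto simp flip: dot)
    have "\<forall>a\<in>A. 0 \<le> val n y a" using v qs by blast
    moreover have "val n y b = 0" if b: "b \<in> B" for b
    proof -
      have "0 \<le> val n y b" using v[of b] b BA qs by blast
      moreover have "0 \<le> val n y (- b)" using v[of "- b"] b qs by blast
      ultimately show ?thesis by (simp add: additive_funD[OF additive_val])
    qed
    moreover have "0 < val n y a0" using func(2) unfolding dot by (simp add: additive_funD[OF additive_val])
    ultimately show ?thesis by blast
  next
    case cone
    \<comment> \<open>A common denominator of the coefficients, built up one coefficient at a
      time.\<close>
    have "\<exists>N>0. \<forall>k<m. \<exists>z::nat. rat_of_nat N * c k = of_nat z" if "m \<le> length qs" for m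
      using that
    proof (induction m)
      case (Suc m)
      then obtain N where N: "N > 0" "\<forall>k<m. \<exists>z::nat. rat_of_nat N * c k = of_nat z" by auto
      obtain p r where pr: "c m = of_int p / of_int r" "r > 0" by (metis quotient_of_div quotient_of_denom_pos surj_pair)
      have "0 \<le> c m" using cone(1) Suc.prems by simp
      then have p: "0 \<le> p" using pr by (simp add: zero_le_divide_iff)
      have "\<exists>z::nat. rat_of_nat (N * nat r) * c k = of_nat z" if km: "k < Suc m" for k
      proof (cases "k = m")
        case True
        have "rat_of_nat (N * nat r) * c k = of_nat (N * nat p)" using pr p True by simp
        then show ?thesis by blast
      next
        case False
        then have "k < m" using km by simp
        then obtain z :: nat where z: "rat_of_nat N * c k = of_nat z" using N(2) by blast
        have "rat_of_nat (N * nat r) * c k = of_nat (nat r) * (rat_of_nat N * c k)" by simp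
        also have "\<dots> = of_nat (nat r * z)" unfolding z by simp
        finally show ?thesis by blast
      qed
      moreover have "N * nat r > 0" using N pr by simp
      ultimately show ?case by blast
    qed (intro exI[of _ 1], simp)
    then obtain N where N: "N > 0" "\<forall>k<length qs. \<exists>z::nat. rat_of_nat N * c k = of_nat z" by blast
    then obtain z where z: "\<And>k. k < length qs \<Longrightarrow> rat_of_nat N * c k = of_nat (z k)" by metis
    have eq: "frag_cmul (int N) (- a0) = (\<Sum>k<length qs. frag_cmul (int (z k)) (qs ! k))"
    proof (rule poly_mapping_eqI)
      fix i
      show "lookup (frag_cmul (int N) (- a0)) i = lookup (\<Sum>k<length qs. frag_cmul (int (z k)) (qs ! k)) i"
      proof (cases "i \<in> {1..n}")
        case True
        have "rat_of_int (int N * lookup (- a0) i) = of_nat N * \<iota> (- a0) i" by (simp add: \<iota>_def)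
        also have "\<dots> = (\<Sum>k<length qs. (of_nat N * c k) * \<iota> (qs ! k) i)"
          using cone(2) True by (simp add: sum_distrib_left mult.assoc)
        also have "\<dots> = (\<Sum>k<length qs. of_nat (z k) * \<iota> (qs ! k) i)"
          by (rule sum.cong) (simp_all add: z)
        also have "\<dots> = rat_of_int (\<Sum>k<length qs. int (z k) * lookup (qs ! k) i)"
          by (simp add: \<iota>_def)
        finally show ?thesis unfolding of_int_eq_iff by (simp add: lookup_sum)
      next
        case False
        have "lookup (qs ! k) i = 0" if "k < length qs" for k
          using kq[of "qs ! k"] that False by (auto simp: in_keys_iff)
        moreover have "lookup a0 i = 0" using kA[OF a0] False by (auto simp: in_keys_iff)
        ultimately show ?thesis by (simp add: lookup_sum)
      qed
    qed
    \<comment> \<open>The monoid generated by \<open>A\<close> and the negatives of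
      \<open>B\<close>, with each element written as one difference.\<close>
    let ?G = "{g. \<exists>s\<in>gen_monoid B. \<exists>t\<in>gen_monoid A. g = t - s}"
    have G: "submonoid ?G"
    proof -
      have "x + y \<in> ?G" if xy: "x \<in> ?G" "y \<in> ?G" for x y
      proof -
        obtain s t s' t' where h: "s \<in> gen_monoid B" "t \<in> gen_monoid A" "x = t - s"
          "s' \<in> gen_monoid B" "t' \<in> gen_monoid A" "y = t' - s'" using xy by blast
        have "x + y = (t + t') - (s + s')" using h by simp
        moreover have "t + t' \<in> gen_monoid A" "s + s' \<in> gen_monoid B"
          using h submonoid_gen unfolding submonoid_def by blast+
        ultimately show ?thesis by blast
      qed
      moreover have "0 \<in> ?G" using gen_monoid.zero[of A] gen_monoid.zero[of B]
        by (intro CollectI bexI[of _ 0]) auto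
      ultimately show ?thesis unfolding submonoid_def by blast
    qed
    have qG: "q \<in> ?G" if "q \<in> set qs" for q
    proof -
      have "q \<in> A \<or> (\<exists>b\<in>B. q = - b)" using that qs by blast
      then show ?thesis
      proof
        assume "q \<in> A"
        then have "q \<in> gen_monoid A" "q = q - 0" using gen_monoid_base by auto
        then show ?thesis using gen_monoid.zero by blast
      next
        assume "\<exists>b\<in>B. q = - b"
        then obtain b where "b \<in> gen_monoid B" "q = 0 - b" using gen_monoid_base by auto
        then show ?thesis using gen_monoid.zero by blast
      qed
    qed
    have "(\<Sum>k<m. frag_cmul (int (z k)) (qs ! k)) \<in> ?G" if "m \<le> length qs" for m
      using that
    proof (induction m)
      case 0
      then show ?case using G by (simp add: submonoid_def)
    next
      case (Suc m)
      have "frag_cmul (int (z m)) (qs ! m) \<in> ?G"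
        using Suc.prems by (intro nat_multiple_in_submonoid[OF G] qG) simp
      moreover have "(\<Sum>k<m. frag_cmul (int (z k)) (qs ! k)) \<in> ?G" using Suc by simp
      ultimately show ?case using G unfolding submonoid_def sum.lessThan_Suc by blast
    qed
    then have "frag_cmul (int N) (- a0) \<in> ?G" unfolding eq by blast
    then obtain s t where st: "s \<in> gen_monoid B" "t \<in> gen_monoid A" "frag_cmul (int N) (- a0) = t - s" by blast
    \<comment> \<open>One of the \<open>N\<close> copies of \<open>a0\<close> is kept; the other
      \<open>N - 1\<close> go into the monoid of \<open>A\<close>.\<close>
    have "a0 + (t + frag_cmul (int (N - 1)) a0) = s"
    proof -
      have "s = t - frag_cmul (int N) (- a0)" using st(3) by simp
      also have "\<dots> = a0 + (t + frag_cmul (int (N - 1)) a0)"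
        using N(1) by (intro poly_mapping_eqI) (simp add: lookup_add lookup_minus of_nat_diff algebra_simps)
      finally show ?thesis by simp
    qed
    moreover have "t + frag_cmul (int (N - 1)) a0 \<in> gen_monoid A"
      using st(2) nat_multiple_in_submonoid[OF submonoid_gen gen_monoid_base[OF a0], of "N - 1"]
        submonoid_gen[of A] unfolding submonoid_def by blast
    ultimately show ?thesis using st(1) by blast
  qed
qed

section \<open>Regular and irregular primes of faces\<close>

context ssubgraph
begin

abbreviation "Q \<equiv> gen_monoid (rho sg ` E)"
abbreviation "QF \<equiv> gen_monoid (rho sg ` F)"

lemma QF_sub: "QF \<subseteq> Q"
  using FE by (intro gen_monoid_mono) blast

lemma finite_E: "finite E"
proof (rule finite_subset)
  show "E \<subseteq> Pow {1..n}" using edge_sub by blast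
qed simp

lemma keys_Q: "q \<in> Q \<Longrightarrow> keys q \<subseteq> {1..n}"
proof (induction rule: gen_monoid.induct)
  case (add a x)
  then have "keys a \<subseteq> {1..n}" using keys_rho by blast
  then show ?case using add keys_add[of a x] by blast
qed simp

text \<open>The uniformizer is the monomial of \<open>e0\<close>: by \<open>facet_reduction\<close>
  every exponent is a natural multiple of \<open>rho sg e0\<close> modulo the group of the face, so
  \<open>factor_out\<close> applies to every nonzero \<open>f\<close>.\<close>

lemma dvr_reduction:
  fixes w :: "nat \<Rightarrow> rat"
  assumes f: "facet_subgraph n E sg F" and few: "ncomp n F \<le> ncomp n E + 1"
    and w0: "\<And>e. e \<in> F \<Longrightarrow> val n w (rho sg e) = 0"
    and wpos: "\<And>e. e \<in> E - F \<Longrightarrow> 0 < val n w (rho sg e)"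
  shows "\<exists>p\<in>face_ideal (val n w) Q. p \<noteq> 0 \<and>
    (\<forall>f\<in>mring Q. f \<noteq> 0 \<longrightarrow> (\<exists>m. \<exists>s\<in>mring Q - face_ideal (val n w) Q. \<exists>u\<in>mring Q - face_ideal (val n w) Q.
      s * f = u * (p :: 'k::field laurent) ^ m))"
proof -
  obtain e0 d where e0: "e0 \<in> E - F" and
    d: "\<And>e. e \<in> E \<Longrightarrow> rho sg e - frag_cmul (int (d e)) (rho sg e0) \<in> diffs QF"
    using facet_reduction[OF f few] by blast
  let ?b = "rho sg e0"
  have b: "?b \<in> Q" using e0 by (intro gen_monoid_base) blast
  have red: "\<exists>j. q - frag_cmul (int j) ?b \<in> diffs QF" if "q \<in> Q" for q
    using that
  proof (induction rule: gen_monoid.induct)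
    case zero
    have "(0 :: nat \<Rightarrow>\<^sub>0 int) - frag_cmul (int 0) ?b \<in> diffs QF"
      using diffs_submonoid(1)[OF submonoid_gen[of "rho sg ` F"]] by (simp add: submonoid_def)
    then show ?case by blast
  next
    case (add a x)
    then obtain e j where e: "e \<in> E" "a = rho sg e" and j: "x - frag_cmul (int j) ?b \<in> diffs QF" by blast
    have "a + x - frag_cmul (int (d e + j)) ?b = (rho sg e - frag_cmul (int (d e)) ?b) + (x - frag_cmul (int j) ?b)"
      by (rule poly_mapping_eqI) (simp add: e lookup_add lookup_minus algebra_simps)
    also have "\<dots> \<in> diffs QF" by (rule diffs_closed_diff(2)[OF submonoid_gen d[OF e(1)] j])
    finally show ?case by blast
  qed
  have zero: "val n w s = 0" if "s \<in> QF" for s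
    using val_gen_zero[of F w s] w0 that diffs_submonoid(3)[OF submonoid_gen[of "rho sg ` F"]] by blast
  have "\<exists>m. \<exists>s\<in>mring Q - face_ideal (val n w) Q. \<exists>u\<in>mring Q - face_ideal (val n w) Q.
      s * f = u * mon ?b ^ m" if f: "f \<in> mring Q" "f \<noteq> 0" for f :: "'k laurent"
  proof -
    have "\<exists>j. q - frag_cmul (int j) ?b \<in> diffs QF" if "q \<in> keys f" for q
      using red that f(1) by (auto simp: mring_def)
    then obtain h u m where h: "h \<in> QF" "mon h * f = u * mon ?b ^ m" "u \<in> mring Q - face_ideal (val n w) Q"
      using factor_out[OF submonoid_gen QF_sub submonoid_gen b additive_val zero f(2)] by blast
    have "(mon h :: 'k laurent) \<in> mring Q - face_ideal (val n w) Q"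
      using h(1) QF_sub zero[OF h(1)] by (auto simp: face_ideal_def)
    then show ?thesis using h(2,3) by blast
  qed
  moreover have "(mon ?b :: 'k laurent) \<in> face_ideal (val n w) Q"
    using b wpos[OF e0] by (simp add: face_ideal_def)
  ultimately show ?thesis by (intro bexI[of _ "mon ?b"]) auto
qed

text \<open>In the localization the monomials of \<open>e1\<close> and \<open>e2\<close> are not
  associated, but their squares are. The first fact excludes a single generator; the phenomenon
  behind the second still yields height one.\<close>

lemma irregular_if_bad:
  assumes f: "facet_subgraph n E sg F" and bad: "\<not> ncomp n F \<le> ncomp n E + 1"
  shows "\<exists>P. prime_in (mring Q) (P :: 'k::field laurent set) \<and>
    (\<forall>I. prime_in (mring Q) I \<longrightarrow> I \<subseteq> P \<longrightarrow> I \<noteq> {0} \<longrightarrow> I = P) \<and>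
    \<not> (\<exists>p\<in>P. \<forall>q\<in>P. \<exists>s\<in>mring Q - P. \<exists>r\<in>mring Q. s * q = r * p)"
proof -
  obtain y :: "nat \<Rightarrow> int" and e1 e2 where y0: "\<And>e. e \<in> F \<Longrightarrow> val n y (rho sg e) = 0"
    and y12: "\<And>e. e \<in> E - F \<Longrightarrow> val n y (rho sg e) \<in> {1, 2}"
    and e: "e1 \<in> E - F" "e2 \<in> E - F" "val n y (rho sg e1) = 1" "val n y (rho sg e2) = 1"
      "rho sg e1 - rho sg e2 \<notin> diffs QF"
    and lat: "\<And>q. q \<in> diffs Q \<Longrightarrow> val n y q = 0 \<Longrightarrow> (\<And>D. D \<in> vcomps n F \<Longrightarrow> even (par n D q)) \<Longrightarrow> q \<in> diffs QF"
  proof -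
    obtain y :: "nat \<Rightarrow> int" where y: "\<forall>e\<in>F. val n y (rho sg e) = 0" "\<forall>e\<in>E - F. val n y (rho sg e) \<in> {1, 2}"
      "\<exists>e1\<in>E - F. \<exists>e2\<in>E - F. val n y (rho sg e1) = 1 \<and> val n y (rho sg e2) = 1 \<and> rho sg e1 - rho sg e2 \<notin> diffs QF"
      "\<forall>q\<in>diffs Q. val n y q = 0 \<longrightarrow> (\<forall>D\<in>vcomps n F. even (par n D q)) \<longrightarrow> q \<in> diffs QF"
      using bad_facet_functional[OF f bad] by (elim exE conjE) (rule that)
    from y(3) obtain e1 e2 where "e1 \<in> E - F" "e2 \<in> E - F" "val n y (rho sg e1) = 1" "val n y (rho sg e2) = 1"
      "rho sg e1 - rho sg e2 \<notin> diffs QF"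
      by (elim bexE conjE) (rule that)
    then show thesis by (rule that[rotated 2]) (use y in simp_all)
  qed
  let ?\<sigma> = "val n y"
  define P :: "'k laurent set" where "P = face_ideal ?\<sigma> Q"
  have d: "additive_fun ?\<sigma>" by (rule additive_val)
  note dD = additive_funD[OF d]
  have nonneg: "0 \<le> ?\<sigma> a" if "a \<in> rho sg ` E" for a using that y0 y12 by fastforce
  have sQ: "0 \<le> ?\<sigma> q" if "q \<in> Q" for q using gen_nonneg[OF d nonneg that] .
  have QF0: "?\<sigma> s = 0" if "s \<in> QF" for s
    using val_gen_zero[of F y s] y0 that diffs_submonoid(3)[OF submonoid_gen[of "rho sg ` F"]] by blast
  have zQF: "q \<in> QF" if "q \<in> Q" "?\<sigma> q = 0" for q
  proof (rule gen_zero[OF d nonneg _ that])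
    fix a assume "a \<in> rho sg ` E" "?\<sigma> a = 0"
    then show "a \<in> rho sg ` F" using y12 by fastforce
  qed
  have P: "prime_in (mring Q) P" unfolding P_def by (rule face_prime[OF submonoid_gen d sQ])
  note pD = prime_inD[OF P]
  note srD = is_subringD[OF is_subring_mring[OF submonoid_gen[of "rho sg ` E"], where 'k = 'k]]
  note dQ = diffs_submonoid[OF submonoid_gen[of "rho sg ` E"]]
  note cQ = diffs_closed_diff[OF submonoid_gen[of "rho sg ` E"]]
  have rQ: "rho sg e \<in> Q" if "e \<in> E" for e using that by (intro gen_monoid_base) blast
  have monP: "mon q \<notin> P" if "q \<in> QF" for q using QF0[OF that] by (simp add: P_def face_ideal_def)
  let ?a = "rho sg e1"
  have aQ: "?a \<in> Q" using rQ e by blast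
  \<comment> \<open>The doubled exponent has even parities everywhere, so an exponent of even degree
    with even parities is a multiple of \<open>?b\<close> modulo the group of the face.\<close>
  let ?b = "?a + ?a"
  have bQ: "?b \<in> Q" using aQ submonoid_gen unfolding submonoid_def by blast
  have "I = P" if I: "prime_in (mring Q) I" "I \<subseteq> P" "I \<noteq> {0}" for I
  proof
    show "I \<subseteq> P" by fact
    note iD = prime_inD[OF I(1)]
    obtain f where f: "f \<in> I" "f \<noteq> 0" using I(3) iD(2) by blast
    have fQ: "f \<in> mring Q" using f iD(1) by blast
    \<comment> \<open>\<open>?\<sigma>\<close> is included because \<open>?b\<close> has degree 2,
      so the degrees must be even as well.\<close>
    let ?X = "insert ?\<sigma> ((\<lambda>D. par n D) ` vcomps n F)"
    have "finite ?X" using finite_vcomps by simp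
    moreover have "additive_fun \<chi>" if "\<chi> \<in> ?X" for \<chi> using that additive_val by auto
    ultimately obtain w where w: "w \<in> mring Q" "f * w \<noteq> 0" "\<forall>q\<in>keys (f * w). \<forall>\<chi>\<in>?X. even (\<chi> q)"
      using even_conjugate[OF submonoid_gen fQ f(2), of ?X] by blast
    have fwI: "f * w \<in> I" using iD(5)[OF w(1) f(1)] .
    have red: "\<exists>j. q - frag_cmul (int j) ?b \<in> diffs QF" if q: "q \<in> keys (f * w)" for q
    proof -
      have qQ: "q \<in> Q" using q fwI iD(1) by (auto simp: mring_def)
      have "even (?\<sigma> q)" using w(3) q by blast
      then obtain k where k: "?\<sigma> q = 2 * k" by (auto elim: evenE)
      then have k0: "k = int (nat k)" using sQ[OF qQ] by simp
      have "frag_cmul (int (nat k)) ?b \<in> Q" by (rule nat_multiple_in_submonoid[OF submonoid_gen bQ])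
      then have "q - frag_cmul (int (nat k)) ?b \<in> diffs Q" using cQ(1) dQ(3) qQ by blast
      moreover have "?\<sigma> (q - frag_cmul (int (nat k)) ?b) = 0"
      proof -
        have "?\<sigma> ?b = 2" by (simp only: dD e(3))
        then have "?\<sigma> (q - frag_cmul (int (nat k)) ?b) = 2 * k - int (nat k) * 2"
          by (simp only: dD(4) val_frag_cmul k of_int_eq_id id_apply)
        then show ?thesis using k0 by linarith
      qed
      moreover have "even (par n D (q - frag_cmul (int (nat k)) ?b))" if "D \<in> vcomps n F" for D
      proof -
        have "even (par n D q)" using w(3) q that by blast
        moreover have "even (par n D ?b)" by (simp only: additive_funD[OF additive_val]) simp
        ultimately show ?thesis by (simp only: additive_funD(4)[OF additive_val] val_frag_cmul) simp
      qed
      ultimately show ?thesis using lat by blast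
    qed
    obtain h u m where h: "h \<in> QF" "mon h * (f * w) = u * mon ?b ^ m" "u \<in> mring Q - face_ideal ?\<sigma> Q"
      using factor_out[OF submonoid_gen QF_sub submonoid_gen bQ d QF0 w(2) red] by blast
    have "(mon h :: 'k laurent) \<in> mring Q" using h(1) QF_sub by auto
    then have "mon h * (f * w) \<in> I" using fwI by (rule iD(4))
    moreover have "u \<notin> I" using h(3) I(2) by (auto simp: P_def)
    moreover have bk: "(mon ?b :: 'k laurent) \<in> mring Q" using bQ by simp
    ultimately have "mon ?b ^ m \<in> I" using iD(7)[of u "mon ?b ^ m"] h(2,3) srD(7)[OF bk] by auto
    then have "mon ?b \<in> I" using prime_in_power[OF is_subring_mring[OF submonoid_gen] I(1) bk] by blast
    then have "mon ?a * mon ?a \<in> I" by (simp add: mult_single)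
    then have aI: "mon ?a \<in> I" using iD(7)[of "mon ?a" "mon ?a"] aQ by auto
    \<comment> \<open>Twice \<open>rho sg e - k ?a\<close> lies in the group of the face. Hence the
      square of the monomial of \<open>e\<close>, times a face monomial, is a multiple of
      \<open>mon ?a\<close> and lies in \<open>I\<close>; face monomials do not.\<close>
    have edge: "mon (rho sg e) \<in> I" if eE: "e \<in> E - F" for e
    proof -
      define k where "k = nat (?\<sigma> (rho sg e))"
      have k: "?\<sigma> (rho sg e) = int k" "k > 0" using y12[OF eE] by (auto simp: k_def)
      let ?t = "rho sg e - frag_cmul (int k) ?a"
      have "?t \<in> diffs Q"
        using cQ(1) dQ(3) rQ[of e] eE nat_multiple_in_submonoid[OF submonoid_gen aQ, of k] by blast
      then have "?t + ?t \<in> diffs Q" using cQ(2) by blast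
      moreover have "?\<sigma> ?t = 0" unfolding dD(4) val_frag_cmul using k(1) e(3) by simp
      then have "?\<sigma> (?t + ?t) = 0" by (simp only: dD(1) add_0)
      moreover have "even (par n D (?t + ?t))" for D by (simp only: additive_funD[OF additive_val]) simp
      ultimately have "?t + ?t \<in> diffs QF" using lat by blast
      then obtain s1 s2 where s: "s1 \<in> QF" "s2 \<in> QF" "?t + ?t = s1 - s2" unfolding diffs_def by blast
      \<comment> \<open>One \<open>?a\<close> is split off to exhibit the factor in
        \<open>I\<close>; positivity of \<open>k\<close> keeps \<open>2 * k - 1\<close> a natural
        number.\<close>
      have "rho sg e + (rho sg e + s2) = ?a + (frag_cmul (int (2 * k - 1)) ?a + s1)"
      proof -
        have "rho sg e + (rho sg e + s2) = (?t + ?t) + s2 + frag_cmul (int (2 * k)) ?a"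
          by (rule poly_mapping_eqI, unfold lookup_add lookup_minus lookup_frag_cmul) (simp add: algebra_simps)
        also have "\<dots> = s1 + frag_cmul (int (2 * k)) ?a" unfolding s(3) by simp
        also have "\<dots> = ?a + (frag_cmul (int (2 * k - 1)) ?a + s1)"
          by (rule poly_mapping_eqI, unfold lookup_add lookup_frag_cmul)
            (use k(2) in \<open>simp add: of_nat_diff algebra_simps\<close>)
        finally show ?thesis .
      qed
      then have "(mon (rho sg e) * (mon (rho sg e) * mon s2) :: 'k laurent)
          = mon ?a * mon (frag_cmul (int (2 * k - 1)) ?a + s1)"
        by (simp only: mult_single mult_1)
      also have "\<dots> \<in> I"
      proof (rule iD(5)[OF _ aI])
        have "frag_cmul (int (2 * k - 1)) ?a + s1 \<in> Q"
          using nat_multiple_in_submonoid[OF submonoid_gen aQ, of "2 * k - 1"] s(1) QF_sub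
            submonoid_gen[of "rho sg ` E"] unfolding submonoid_def by blast
        then show "(mon (frag_cmul (int (2 * k - 1)) ?a + s1) :: 'k laurent) \<in> mring Q" by simp
      qed
      finally have i: "(mon (rho sg e) * (mon (rho sg e) * mon s2) :: 'k laurent) \<in> I" .
      have k1: "(mon (rho sg e) :: 'k laurent) \<in> mring Q" using rQ[of e] eE by simp
      have k2: "(mon s2 :: 'k laurent) \<in> mring Q" using s(2) QF_sub by auto
      have "mon s2 \<notin> I" using monP[OF s(2)] I(2) by blast
      then show ?thesis using iD(7)[OF k1 srD(4)[OF k1 k2] i] iD(7)[OF k1 k2] by blast
    qed
    show "P \<subseteq> I" unfolding P_def
    proof (rule face_ideal_subset[OF I(1) d])
      fix a assume "a \<in> rho sg ` E" "0 < ?\<sigma> a"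
      then obtain e' where "e' \<in> E" "a = rho sg e'" "e' \<notin> F" using y0 by fastforce
      then show "mon a \<in> I" using edge by blast
    qed
  qed
  moreover have False if p: "p \<in> P" "\<And>q. q \<in> P \<Longrightarrow> \<exists>s\<in>mring Q - P. \<exists>r\<in>mring Q. s * q = r * p" for p
  proof -
    \<comment> \<open>In \<open>s * mon (rho sg e) = r * p\<close> the element \<open>s\<close> has
      a nonzero part of degree 0, while \<open>p\<close> starts in degree 1 or later; the parts of
      degree 1 are compared.\<close>
    have key: "\<exists>s r. part ?\<sigma> 0 s \<noteq> 0 \<and> s \<in> mring Q \<and> r \<in> mring Q \<and>
        mon (rho sg e) * part ?\<sigma> 0 s = part ?\<sigma> 0 r * part ?\<sigma> 1 p"
      if eE: "e \<in> E - F" and one: "?\<sigma> (rho sg e) = 1" for e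
    proof -
      have "mon (rho sg e) \<in> P" using rQ[of e] eE one by (simp add: P_def face_ideal_def)
      then obtain s r where sr: "s \<in> mring Q - P" "r \<in> mring Q" "s * mon (rho sg e) = r * p" using p(2) by blast
      obtain q where q: "q \<in> keys s" "\<not> 0 < ?\<sigma> q" using sr(1) by (auto simp: P_def face_ideal_def)
      then have "?\<sigma> q = 0" using sQ[of q] sr(1) by (auto simp: mring_def)
      then have "q \<in> keys (part ?\<sigma> 0 s)" using q by (simp add: keys_restr)
      then have nz: "part ?\<sigma> 0 s \<noteq> 0" by auto
      have "part ?\<sigma> 1 (mon (rho sg e) * s) = mon (rho sg e) * part ?\<sigma> (1 - 1) s"
        by (rule part_mult_homogeneous[OF d]) (use one in simp)
      moreover have "part ?\<sigma> (0 + 1) (r * p) = part ?\<sigma> 0 r * part ?\<sigma> 1 p"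
      proof (rule part_mult_extreme[OF d])
        fix a b assume ab: "a \<in> keys r" "b \<in> keys p" "?\<sigma> a + ?\<sigma> b = 0 + 1"
        have "0 \<le> ?\<sigma> a" using ab(1) sr(2) sQ by (auto simp: mring_def)
        moreover have "0 < ?\<sigma> b" using ab(2) p(1) by (auto simp: P_def face_ideal_def)
        ultimately show "?\<sigma> a = 0" using ab(3) by linarith
      qed
      moreover have "mon (rho sg e) * s = r * p" using sr(3) by (simp only: mult.commute)
      ultimately show ?thesis using nz sr by (intro exI[of _ s] exI[of _ r]) auto
    qed
    obtain s1 r1 where 1: "part ?\<sigma> 0 s1 \<noteq> 0" "s1 \<in> mring Q" "r1 \<in> mring Q"
      "mon (rho sg e1) * part ?\<sigma> 0 s1 = part ?\<sigma> 0 r1 * part ?\<sigma> 1 p" using key[OF e(1,3)] by blast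
    obtain s2 r2 where 2: "part ?\<sigma> 0 s2 \<noteq> 0" "s2 \<in> mring Q" "r2 \<in> mring Q"
      "mon (rho sg e2) * part ?\<sigma> 0 s2 = part ?\<sigma> 0 r2 * part ?\<sigma> 1 p" using key[OF e(2,4)] by blast
    have "mon (rho sg e2) * part ?\<sigma> 0 s2 \<noteq> 0" using 2(1) by simp
    then have r2: "part ?\<sigma> 0 r2 \<noteq> 0" unfolding 2(4) by auto
    \<comment> \<open>Cross-multiplication eliminates \<open>part ?\<sigma> 1 p\<close>. The
      resulting nonzero polynomial has all its exponents in both \<open>rho sg e1 + QF\<close> and
      \<open>rho sg e2 + QF\<close>, so the two edges differ by an element of the group of the
      face.\<close>
    let ?x = "(mon (rho sg e1) * part ?\<sigma> 0 s1) * part ?\<sigma> 0 r2"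
    have "?x \<noteq> 0" using r2 1(1) by simp
    then obtain q where q: "q \<in> keys ?x" by (meson all_not_in_conv keys_eq_empty)
    have "?x = (mon (rho sg e2) * part ?\<sigma> 0 s2) * part ?\<sigma> 0 r1"
      unfolding 1(4) 2(4) by (simp only: ac_simps)
    then have q': "q \<in> keys ((mon (rho sg e2) * part ?\<sigma> 0 s2) * part ?\<sigma> 0 r1)" using q by simp
    have elem: "\<exists>t\<in>QF. x = rho sg e + t"
      if x: "x \<in> keys ((mon (rho sg e) * part ?\<sigma> 0 s) * part ?\<sigma> 0 r)" and sr: "s \<in> mring Q" "r \<in> mring Q"
      for x e and s r :: "'k laurent"
    proof -
      obtain a b where ab: "a \<in> keys (mon (rho sg e) * part ?\<sigma> 0 s)" "b \<in> keys (part ?\<sigma> 0 r)" "x = a + b"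
        using x by (rule keys_mult_elim)
      obtain c where c: "c \<in> keys (part ?\<sigma> 0 s)" "a = rho sg e + c"
        using ab(1) unfolding keys_mon_mult by blast
      have "b \<in> QF" "c \<in> QF" using zQF ab(2) c(1) sr by (auto simp: keys_restr mring_def)
      then have "c + b \<in> QF" using submonoid_gen[of "rho sg ` F"] unfolding submonoid_def by blast
      then show ?thesis using ab(3) c(2) by (auto simp: add.assoc)
    qed
    obtain t1 t2 where t: "t1 \<in> QF" "q = rho sg e1 + t1" "t2 \<in> QF" "q = rho sg e2 + t2"
      using elem[OF q 1(2) 2(3)] elem[OF q' 2(2) 1(3)] by blast
    have "rho sg e1 - rho sg e2 = (rho sg e1 + t1) - (rho sg e2 + t1)" by simp
    also have "\<dots> = (rho sg e2 + t2) - (rho sg e2 + t1)" by (simp only: t(2)[symmetric] t(4)[symmetric])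
    also have "\<dots> = t2 - t1" by simp
    finally have "rho sg e1 - rho sg e2 = t2 - t1" .
    then show False using e(5) t(1,3) unfolding diffs_def by blast
  qed
  ultimately show ?thesis using P by (intro exI[of _ P]) blast
qed

end


section \<open>Height-one primes of the edge ring\<close>

lemma edge_ring_eq: "edge_ring E sg = sring (mring (gen_monoid (rho sg ` E)))"
  by (simp add: edge_ring_def sring_def mring_def)

text \<open>\<open>P\<close> is not given as a face ideal; the face is guessed from the edge
  monomials that \<open>P\<close> omits, and height one forces equality with the face ideal of any
  supporting functional.\<close>

lemma (in sgraph) dvr_at_monomial_prime:
  fixes P :: "'k::field laurent set"
  defines "Q \<equiv> gen_monoid (rho sg ` E)"
  assumes P: "prime_in (mring Q) P" and q0: "q0 \<in> Q" "mon q0 \<in> P"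
    and ht: "\<And>I. prime_in (mring Q) I \<Longrightarrow> I \<subseteq> P \<Longrightarrow> I \<noteq> {0} \<Longrightarrow> I = P"
    and comb: "\<And>F. facet_subgraph n E sg F \<Longrightarrow> ncomp n F \<le> ncomp n E + 1"
  shows "\<exists>p\<in>P. p \<noteq> 0 \<and> (\<forall>f\<in>mring Q. f \<noteq> 0 \<longrightarrow> (\<exists>m. \<exists>s\<in>mring Q - P. \<exists>u\<in>mring Q - P. s * f = u * p ^ m))"
proof -
  define F where "F = {e \<in> E. mon (rho sg e) \<notin> P}"
  interpret ssubgraph n E sg F by unfold_locales (auto simp: F_def)
  note pD = prime_inD[OF P]
  have QF_notin: "mon q \<notin> P" if "q \<in> QF" for q
    using that
  proof (induction rule: gen_monoid.induct)
    case zero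
    then show ?case using pD(6) by simp
  next
    case (add a x)
    have k: "(mon a :: 'k laurent) \<in> mring Q" "(mon x :: 'k laurent) \<in> mring Q"
      using add.hyps gen_monoid_base[of a "rho sg ` F"] QF_sub by (auto simp: Q_def)
    have "mon a \<notin> P" using add.hyps by (auto simp: F_def)
    then have "mon a * mon x \<notin> P" using pD(7)[OF k] add.IH by blast
    then show ?case by (simp add: mult_single)
  qed
  have ne: "E - F \<noteq> {}"
  proof
    assume "E - F = {}"
    then have "E = F" by (auto simp: F_def)
    then show False using QF_notin[of q0] q0 by (simp add: Q_def)
  qed
  have edge: "mon (rho sg e) \<in> P" if "e \<in> E - F" for e using that by (simp add: F_def)
  \<comment> \<open>Such a functional has a nonzero prime face ideal inside \<open>P\<close>, hence
    equal to \<open>P\<close>. As \<open>P\<close> contains the monomials of all outside edges, one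
    positive value forces all of them to be positive.\<close>
  have face: "face_ideal (val n y) Q = P \<and> (\<forall>e\<in>E - F. 0 < val n y (rho sg e))"
    if y: "\<And>e. e \<in> E \<Longrightarrow> 0 \<le> val n y (rho sg e)" "\<And>e. e \<in> F \<Longrightarrow> val n y (rho sg e) = 0"
      and e1: "e1 \<in> E - F" "0 < val n y (rho sg e1)" for y :: "nat \<Rightarrow> rat" and e1
  proof -
    have "face_ideal (val n y) Q = P"
    proof (rule ht)
      have "0 \<le> val n y q" if "q \<in> Q" for q
        using gen_nonneg[OF additive_val _ that[unfolded Q_def]] y(1) by blast
      then show "prime_in (mring Q) (face_ideal (val n y) Q :: 'k laurent set)"
        unfolding Q_def by (rule face_prime[OF submonoid_gen additive_val])
      show "face_ideal (val n y) Q \<subseteq> P" unfolding Q_def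
      proof (rule face_ideal_subset[OF P[unfolded Q_def] additive_val])
        fix a assume "a \<in> rho sg ` E" "0 < val n y a"
        then obtain e where "e \<in> E" "a = rho sg e" "e \<notin> F" using y(2) by fastforce
        then show "mon a \<in> P" using edge by blast
      qed
      have m: "(mon (rho sg e1) :: 'k laurent) \<in> face_ideal (val n y) Q"
        using e1 gen_monoid_base[of "rho sg e1" "rho sg ` E"] by (simp add: face_ideal_def Q_def)
      show "face_ideal (val n y) Q \<noteq> ({0} :: 'k laurent set)"
      proof
        assume "face_ideal (val n y) Q = ({0} :: 'k laurent set)"
        from m[unfolded this] show False by simp
      qed
    qed
    moreover have "0 < val n y (rho sg e)" if "e \<in> E - F" for e
      using edge[OF that] unfolding \<open>face_ideal (val n y) Q = P\<close>[symmetric] by (simp add: face_ideal_def)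
    ultimately show ?thesis by blast
  qed
  obtain e1 where e1: "e1 \<in> E - F" using ne by blast
  \<comment> \<open>This excludes the second case of \<open>farkas_monoid\<close>: a monomial of the
    face would be a multiple of \<open>mon (rho sg e1)\<close> and thus lie in
    \<open>P\<close>.\<close>
  have "\<not> (\<exists>x\<in>Q. rho sg e1 + x \<in> QF)"
  proof
    assume "\<exists>x\<in>Q. rho sg e1 + x \<in> QF"
    then obtain x where x: "x \<in> Q" "rho sg e1 + x \<in> QF" by blast
    have "(mon x :: 'k laurent) \<in> mring Q" using x(1) by simp
    then have "mon (rho sg e1) * mon x \<in> P" using edge[OF e1] by (rule pD(5))
    then show False using QF_notin[OF x(2)] by (simp add: mult_single)
  qed
  moreover have "finite (rho sg ` E)" using finite_E by simp
  moreover have "rho sg ` F \<subseteq> rho sg ` E" "rho sg e1 \<in> rho sg ` E" using FE e1 by blast+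
  moreover have "keys a \<subseteq> {1..n}" if "a \<in> rho sg ` E" for a using that keys_rho by blast
  ultimately obtain w :: "nat \<Rightarrow> rat" where w: "\<forall>a\<in>rho sg ` E. 0 \<le> val n w a"
    "\<forall>b\<in>rho sg ` F. val n w b = 0" "0 < val n w (rho sg e1)"
    using farkas_monoid[of "rho sg ` E" "rho sg ` F" "rho sg e1" n] unfolding Q_def by blast
  have w0: "val n w (rho sg e) = 0" if "e \<in> F" for e using w(2) that by blast
  have wP: "face_ideal (val n w) Q = P" and wpos: "\<And>e. e \<in> E - F \<Longrightarrow> 0 < val n w (rho sg e)"
    using face[of w e1] w e1 by auto
  have one: "\<exists>c. \<forall>e\<in>E. val n z (rho sg e) = c * val n w (rho sg e)"
    if z: "\<And>e. e \<in> F \<Longrightarrow> val n z (rho sg e) = 0" for z :: "nat \<Rightarrow> rat"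
  proof -
    let ?r = "\<lambda>e. val n z (rho sg e) / val n w (rho sg e)"
    \<comment> \<open>With the least ratio, \<open>z - c w\<close> is nonnegative on all edges and
      zero on \<open>e'\<close>. Were it positive anywhere, \<open>face\<close> would make it
      positive on \<open>e'\<close>.\<close>
    define c where "c = Min (?r ` (E - F))"
    have fin: "finite (?r ` (E - F))" using finite_E by simp
    have "c \<in> ?r ` (E - F)" unfolding c_def using fin ne by (intro Min_in) auto
    then obtain e' where e': "e' \<in> E - F" "c = ?r e'" by blast
    have c_le: "c \<le> ?r e" if "e \<in> E - F" for e unfolding c_def using fin that by (intro Min_le) auto
    define y where "y = (\<lambda>i. 1 * z i + (- c) * w i)"
    have y: "val n y q = val n z q - c * val n w q" for q unfolding y_def val_add by simp
    have y0: "val n y (rho sg e) = 0" if "e \<in> F" for e unfolding y using z[OF that] w0[OF that] by simp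
    have ynn: "0 \<le> val n y (rho sg e)" if e: "e \<in> E" for e
    proof (cases "e \<in> F")
      case False
      then have "c \<le> ?r e" "0 < val n w (rho sg e)" using c_le wpos e by auto
      then show ?thesis unfolding y by (simp add: le_divide_eq)
    qed (simp add: y0)
    have ye': "val n y (rho sg e') = 0" unfolding y using e' wpos[OF e'(1)] by simp
    have "val n y (rho sg e) = 0" if e: "e \<in> E" for e
    proof (rule ccontr)
      assume nz: "val n y (rho sg e) \<noteq> 0"
      then have "e \<in> E - F" using y0 e by blast
      moreover have "0 < val n y (rho sg e)" using ynn[OF e] nz by simp
      ultimately have "0 < val n y (rho sg e')" using face[OF ynn y0] e'(1) by blast
      then show False using ye' by simp
    qed
    then show ?thesis unfolding y by (intro exI[of _ c]) auto
  qed
  have f: "facet_subgraph n E sg F" by (rule facet_of_functional[OF ne w0 wpos one])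
  show ?thesis
    using dvr_reduction[OF f comb[OF f] w0 wpos, where 'k = 'k] unfolding Q_def[symmetric] wP .
qed

theorem mainTheorem6:
  fixes n :: nat and E :: "nat set set" and sg :: "nat set \<Rightarrow> int"
  assumes "signed_graph n E sg"
  shows "serre_R1 (edge_ring E sg :: ((nat \<Rightarrow>\<^sub>0 int) \<Rightarrow>\<^sub>0 'k::field) ring) \<longleftrightarrow>
         (\<forall>F. facet_subgraph n E sg F \<longrightarrow> ncomp n F \<le> ncomp n E + 1)"
proof
  interpret sgraph n E sg by unfold_locales (rule assms)
  let ?Q = "gen_monoid (rho sg ` E)"
  let ?A = "mring ?Q :: 'k laurent set"
  have sub: "is_subring ?A" by (rule is_subring_mring[OF submonoid_gen])
  {
    assume R1: "serre_R1 (edge_ring E sg :: 'k laurent ring)"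
    show "\<forall>F. facet_subgraph n E sg F \<longrightarrow> ncomp n F \<le> ncomp n E + 1"
    proof (intro allI impI, rule ccontr)
      fix F assume f: "facet_subgraph n E sg F" and bad: "\<not> ncomp n F \<le> ncomp n E + 1"
      interpret ssubgraph n E sg F using f by unfold_locales (simp add: facet_subgraph_def)
      obtain P where P: "prime_in ?A P"
        and ht: "\<And>I. prime_in ?A I \<Longrightarrow> I \<subseteq> P \<Longrightarrow> I \<noteq> {0} \<Longrightarrow> I = P"
        and np: "\<not> (\<exists>p\<in>P. \<forall>q\<in>P. \<exists>s\<in>?A - P. \<exists>r\<in>?A. s * q = r * p)"
        using irregular_if_bad[OF f bad, where 'k = 'k] by blast
      interpret domain_loc ?A P by unfold_locales (rule sub, rule P)
      have dim: "krull_dim Rp \<le> 1" using ht by (rule krull_dim_le_1)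
      then have "regular_local_ring Rp"
        using R1 primeideal_sring_iff[OF sub] P unfolding serre_R1_def edge_ring_eq by blast
      then show False using regular_imp_principal[OF _ dim] np by blast
    qed
  next
    assume comb: "\<forall>F. facet_subgraph n E sg F \<longrightarrow> ncomp n F \<le> ncomp n E + 1"
    show "serre_R1 (edge_ring E sg :: 'k laurent ring)"
      unfolding serre_R1_def edge_ring_eq
    proof (intro allI impI, elim conjE)
      fix P assume "primeideal P (sring ?A)" and dim: "krull_dim (localization (sring ?A) P) \<le> 1"
      then have P: "prime_in ?A P" using primeideal_sring_iff[OF sub] by blast
      interpret domain_loc ?A P by unfold_locales (rule sub, rule P)
      show "regular_local_ring Rp"
      proof (cases "P = {0}")
        case True
        then show ?thesis by (rule regular_if_zero)
      next
        case False
        have ht: "I = P" if "prime_in ?A I" "I \<subseteq> P" "I \<noteq> {0}" for I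
          using no_prime_between[OF dim that] .
        have "\<exists>p\<in>P. p \<noteq> 0 \<and> (\<forall>f\<in>?A. f \<noteq> 0 \<longrightarrow> (\<exists>m. \<exists>s\<in>?A - P. \<exists>u\<in>?A - P. s * f = u * p ^ m))"
        proof (cases "\<exists>q\<in>?Q. mon q \<in> P")
          case True
          then show ?thesis using dvr_at_monomial_prime[OF P _ _ ht] comb by blast
        next
          case nomon: False
          interpret ssubgraph n E sg E by unfold_locales simp
          \<comment> \<open>Vertices are numbered from 1 to \<open>n\<close>, whereas
            \<open>dvr_no_monomials\<close> counts coordinates from 0.\<close>
          have "keys q \<subseteq> {..<Suc n}" if "q \<in> ?Q" for q using keys_Q[OF that] by auto
          then show ?thesis using dvr_no_monomials[OF submonoid_gen _ P False _ ht] nomon by blast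
        qed
        then obtain p where "p \<in> P" "p \<noteq> 0"
          "\<And>f. f \<in> ?A \<Longrightarrow> f \<noteq> 0 \<Longrightarrow> \<exists>m. \<exists>s\<in>?A - P. \<exists>u\<in>?A - P. s * f = u * p ^ m" by blast
        then show ?thesis by (rule regular_if_dvr)
      qed
    qed
  }
qed

end
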